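(* Let $K$ be a p.c.f. self-similar set generated by an IFS $F_i(x)=\rho(x-b_i)+b_i$, $1\le i\le N$, on $\mathbb R^d$ with $0<\rho<1$. Assume that the asymptotic geometric growth rates $R(p,q)$ $(>1)$ exist for all $p\neq q$ in $V_0$, and let $$R^\#=\min\big\{s:\ \forall\,p\ne q\text{ in }V_0\ \exists\text{ a chain }p=p_1,\dots,p_m=q\text{ in }V_0\text{ with }R(p_i,p_{i+1})\le s,\ 1\le i\le m-1\big\}.$$ Suppose there is a compatible relation on $V_0$ such that for any small $\varepsilon>0$, $\lim_{n\to\infty}(R^\#)^{(1-\varepsilon)n}/R^\sim_n(J_i,J_j)=0$ for all $J_i\neq J_j$ in $V_0^\sim$. Suppose moreover that $$\max\{\dim_H\overline J:\ J\text{ a boundary class in }V_*\}<\dim_HK .$$ Then for every $\sigma<\sigma^\#$, $B^\sigma_{2,\infty}$ is dense in $L^2(K,\mu)$. If, further, every $u\in\ell(V_0^\sim)$ has an extension $u\in\ell(V_*^\sim)$ such that $$\sup_{n\ge0}(R^\#)^nE_n[u]<\infty,$$ then $B^{\sigma^\#}_{2,\infty}$ is dense in $L^2(K,\mu)$.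
   Context: **P.c.f. setting.** $K=\bigcup_{i=1}^NF_i(K)$ is the nonempty compact self-similar set, assumed connected. For a word $\omega=\omega_1\cdots\omega_n\in\{1,\dots,N\}^n$, $|\omega|=n$, put $F_\omega=F_{\omega_1}\circ\cdots\circ F_{\omega_n}$, $K_\omega=F_\omega(K)$. Let $\pi:\{1,\dots,N\}^{\infty}\to K$ be $\{\pi(\omega)\}=\bigcap_nK_{\omega_1\cdots\omega_n}$, $\tau$ the left shift, $\mathcal C=\pi^{-1}(\bigcup_{i<j}(K_i\cap K_j))$ and $\mathcal P=\bigcup_{m\ge1}\tau^m(\mathcal C)$. The IFS (and $K$) is p.c.f. if $\mathcal P$ is finite. The boundary is $V_0=\pi(\mathcal P)$, assumed to have at least two points; $V_n=\bigcup_iF_i(V_{n-1})$, $V_*=\bigcup_nV_n$, and $V_\omega=F_\omega(V_0)$, $|\omega|=n$, is an $n$-cell. Let $\alpha=\log N/|\log\rho|=\dim_HK$ and let $\mu$ be the self-similar measure $\mu=\frac1N\sum_i\mu\circ F_i^{-1}$ (the normalized $\alpha$-Hausdorff measure). **Besov spaces.** For $\sigma>0$, $[u]^2_{B^\sigma_{2,\infty}}=\sup_{0<r<1}r^{-\alpha-2\sigma}\int_K\int_{B(x,r)}|u(x)-u(y)|^2d\mu(y)d\mu(x)$ and $B^\sigma_{2,\infty}=\{u\in L^2(K,\mu):\|u\|_2+[u]_{B^\sigma_{2,\infty}}<\infty\}$. $\sigma^\#=\sup\{\sigma: B^\sigma_{2,\infty}\text{ contains non-constant functions}\}$. **Primal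 energy and traces.** For $u:V_n\to\mathbb R$ (or $u$ on $V_*$, restricted to $V_n$), $E_n[u]=\sum_{|\omega|=n}\sum_{\{x,y\}\subset V_\omega}|u(x)-u(y)|^2$ (unordered pairs). The trace $R_n(p,q)$, $p\neq q\in V_0$, is defined by: for all $u:V_0\to\mathbb R$, $\min\{E_n[v]: v:V_n\to\mathbb R,\ v|_{V_0}=u\}=\sum_{\{p,q\}\subset V_0}\frac1{R_n(p,q)}|u(p)-u(q)|^2$. An increasing sequence $(R_n)$ of positive reals has asymptotic geometric growth rate $R>1$ if for every $\varepsilon>0$ there is $N(\varepsilon)$ with $R^{(1-\varepsilon)n}\le R_n\le R^{(1+\varepsilon)n}$ for all $n\ge N(\varepsilon)$; $R(p,q)$ denotes the rate of $(R_n(p,q))_n$. **Compatible relations and quotient traces.** Let $\sim\,=\,\sim_0$ be an equivalence relation on $V_0$ with at least two classes. Let $\sim_n$ be the smallest equivalence relation on $V_n$ such that (1) $x\sim_{n-1}y$ in $V_{n-1}$ implies $x\sim_ny$; (2) $x\sim_{n-1}y$ in $V_{n-1}$ implies $F_i(x)\sim_nF_i(y)$ for $1\le i\le N$. The relation $\sim$ is compatible if for all $n\ge0$ and $x,y\in V_n$: $x\sim_ny$ iff $x\sim_{n+1}y$. It then induces an equivalence relation on $V_*$ ($x\sim y$ iff $x\sim_ny$ for $n$ with $x,y\in V_n$). A class $J$ of $V_*$ is a boundary class if $J\cap V_0\neq\emptyset$. $V_n^\sim$, $V_*^\sim$ are the sets of classes in $V_n$, $V_*$; $\ell(V_n^\sim)$,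 $\ell(V_*^\sim)$ are the real functions on $V_n$, $V_*$ that are constant on classes. The quotient trace $R_n^\sim(J_i,J_j)\in(0,\infty]$ is defined by: for all $u\in\ell(V_0^\sim)$, $\min\{E_n[v]: v\in\ell(V_n^\sim),\ v|_{V_0}=u\}=\sum_{\{J_i,J_j\}\subset V_0^\sim}\frac1{R^\sim_n(J_i,J_j)}|u(J_i)-u(J_j)|^2$. *)

theory Defs
  imports "HOL-Probability.Probability"
begin

text \<open>
  Throughout, an iterated function system is a family \<open>F i\<close> of maps with index \<open>i\<close>
  ranging over \<open>{1..N}\<close>; values \<open>F i\<close> for other indices are irrelevant.
\<close>

section \<open>P.c.f. self-similar sets\<close>

definition self_similar_set :: "nat \<Rightarrow> (nat \<Rightarrow> 'a \<Rightarrow> 'a) \<Rightarrow> 'a::metric_space set \<Rightarrow> bool" where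
  "self_similar_set N F K \<longleftrightarrow> K \<noteq> {} \<and> compact K \<and> K = (\<Union>i\<in>{1..N}. F i ` K)"

definition words :: "nat \<Rightarrow> nat \<Rightarrow> nat list set" where
  "words N n = {w. length w = n \<and> set w \<subseteq> {1..N}}"

definition word_map :: "(nat \<Rightarrow> 'a \<Rightarrow> 'a) \<Rightarrow> nat list \<Rightarrow> 'a \<Rightarrow> 'a" where
  "word_map F w = foldr (\<lambda>i f. F i \<circ> f) w id"

definition inf_words :: "nat \<Rightarrow> (nat \<Rightarrow> nat) set" where
  "inf_words N = {w. \<forall>k. w k \<in> {1..N}}"

definition coding :: "(nat \<Rightarrow> 'a \<Rightarrow> 'a) \<Rightarrow> 'a set \<Rightarrow> (nat \<Rightarrow> nat) \<Rightarrow> 'a" where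
  "coding F K w = (THE x. {x} = (\<Inter>n. word_map F (map w [0..<n]) ` K))"

definition left_shift :: "(nat \<Rightarrow> nat) \<Rightarrow> nat \<Rightarrow> nat" where
  "left_shift w = (\<lambda>k. w (Suc k))"

definition critical_set :: "nat \<Rightarrow> (nat \<Rightarrow> 'a \<Rightarrow> 'a) \<Rightarrow> 'a set \<Rightarrow> (nat \<Rightarrow> nat) set" where
  "critical_set N F K =
     {w \<in> inf_words N. \<exists>i\<in>{1..N}. \<exists>j\<in>{1..N}. i < j \<and> coding F K w \<in> F i ` K \<inter> F j ` K}"

definition post_critical_set :: "nat \<Rightarrow> (nat \<Rightarrow> 'a \<Rightarrow> 'a) \<Rightarrow> 'a set \<Rightarrow> (nat \<Rightarrow> nat) set" where
  "post_critical_set N F K = (\<Union>m\<in>{1..}. (left_shift ^^ m) ` critical_set N F K)"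

definition pcf :: "nat \<Rightarrow> (nat \<Rightarrow> 'a \<Rightarrow> 'a) \<Rightarrow> 'a set \<Rightarrow> bool" where
  "pcf N F K \<longleftrightarrow> finite (post_critical_set N F K)"

fun vertices :: "nat \<Rightarrow> (nat \<Rightarrow> 'a \<Rightarrow> 'a) \<Rightarrow> 'a set \<Rightarrow> nat \<Rightarrow> 'a set" where
  "vertices N F K 0 = coding F K ` post_critical_set N F K"
| "vertices N F K (Suc n) = (\<Union>i\<in>{1..N}. F i ` vertices N F K n)"

definition all_vertices :: "nat \<Rightarrow> (nat \<Rightarrow> 'a \<Rightarrow> 'a) \<Rightarrow> 'a set \<Rightarrow> 'a set" where
  "all_vertices N F K = (\<Union>n. vertices N F K n)"

text \<open>
  The self-similar probability measure with equal weights, as a Borel measure whose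
  underlying space is \<open>K\<close> itself; thus integrals over \<open>\<mu>\<close> are integrals over \<open>K\<close>.
\<close>

definition self_similar_measure ::
    "nat \<Rightarrow> (nat \<Rightarrow> 'a \<Rightarrow> 'a) \<Rightarrow> 'a::metric_space set \<Rightarrow> 'a measure \<Rightarrow> bool" where
  "self_similar_measure N F K \<mu> \<longleftrightarrow>
     prob_space \<mu> \<and> sets \<mu> = sets (restrict_space borel K) \<and>
     (\<forall>A\<in>sets \<mu>. emeasure \<mu> A = ennreal (1 / real N) * (\<Sum>i=1..N. emeasure \<mu> (F i -` A \<inter> K)))"

section \<open>Hausdorff dimension\<close>

text \<open>
  Boundedness of the covering sets is required explicitly because \<^const>\<open>diameter\<close>
  is \<open>0\<close> on unbounded sets.
\<close>

definition hausdorff_content :: "real \<Rightarrow> real \<Rightarrow> 'a::metric_space set \<Rightarrow> ennreal" where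
  "hausdorff_content s \<delta> A =
     (INF U \<in> {U :: nat \<Rightarrow> 'a set. A \<subseteq> (\<Union>i. U i) \<and> (\<forall>i. bounded (U i) \<and> diameter (U i) \<le> \<delta>)}.
        \<Sum>i. ennreal (diameter (U i) powr s))"

definition hausdorff_measure :: "real \<Rightarrow> 'a::metric_space set \<Rightarrow> ennreal" where
  "hausdorff_measure s A = (SUP \<delta>\<in>{0<..}. hausdorff_content s \<delta> A)"

definition hausdorff_dim :: "'a::euclidean_space set \<Rightarrow> real" where
  "hausdorff_dim A = Inf {s. 0 < s \<and> hausdorff_measure s A = 0}"

section \<open>\<open>L\<^sup>2\<close> and the Besov spaces\<close>

definition L2 :: "'a measure \<Rightarrow> ('a \<Rightarrow> real) set" where
  "L2 \<mu> = {u \<in> borel_measurable \<mu>. integrable \<mu> (\<lambda>x. (u x)\<^sup>2)}"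

definition L2_norm :: "'a measure \<Rightarrow> ('a \<Rightarrow> real) \<Rightarrow> real" where
  "L2_norm \<mu> u = sqrt (\<integral>x. (u x)\<^sup>2 \<partial>\<mu>)"

definition dense_in_L2 :: "'a measure \<Rightarrow> ('a \<Rightarrow> real) set \<Rightarrow> bool" where
  "dense_in_L2 \<mu> B \<longleftrightarrow>
     B \<subseteq> L2 \<mu> \<and> (\<forall>f\<in>L2 \<mu>. \<forall>\<epsilon>>0. \<exists>g\<in>B. L2_norm \<mu> (\<lambda>x. f x - g x) < \<epsilon>)"

definition similarity_dim :: "nat \<Rightarrow> real \<Rightarrow> real" where
  "similarity_dim N \<rho> = ln (real N) / \<bar>ln \<rho>\<bar>"

definition besov_seminorm_sq ::
    "real \<Rightarrow> 'a::metric_space measure \<Rightarrow> real \<Rightarrow> ('a \<Rightarrow> real) \<Rightarrow> ennreal" where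
  "besov_seminorm_sq \<alpha> \<mu> \<sigma> u =
     (SUP r\<in>{0<..<1}. ennreal (r powr (- \<alpha> - 2 * \<sigma>)) *
        (\<integral>\<^sup>+x. (\<integral>\<^sup>+y\<in>ball x r. ennreal (\<bar>u x - u y\<bar>\<^sup>2) \<partial>\<mu>) \<partial>\<mu>))"

definition besov :: "real \<Rightarrow> 'a::metric_space measure \<Rightarrow> real \<Rightarrow> ('a \<Rightarrow> real) set" where
  "besov \<alpha> \<mu> \<sigma> = {u \<in> L2 \<mu>. besov_seminorm_sq \<alpha> \<mu> \<sigma> u < \<infinity>}"

text \<open>
  Functions stand for their classes modulo null sets, so ``non-constant'' means not almost
  everywhere equal to a constant.  The supremum is taken in the extended reals.
\<close>

definition sigma_sharp :: "real \<Rightarrow> 'a::metric_space measure \<Rightarrow> ereal" where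
  "sigma_sharp \<alpha> \<mu> =
     (SUP \<sigma> \<in> {\<sigma>. 0 < \<sigma> \<and> (\<exists>u\<in>besov \<alpha> \<mu> \<sigma>. \<not> (\<exists>c. AE x in \<mu>. u x = c))}. ereal \<sigma>)"

section \<open>Primal energies and traces\<close>

definition is_minimum :: "real set \<Rightarrow> real \<Rightarrow> bool" where
  "is_minimum S m \<longleftrightarrow> m \<in> S \<and> (\<forall>x\<in>S. m \<le> x)"

text \<open>
  A sum over unordered pairs of distinct elements is written as one half of the sum over
  ordered pairs.  Functions on \<open>V\<^sub>n\<close> or \<open>V\<^sub>*\<close> are total functions of which only the values on
  these sets are used.
\<close>

definition energy :: "nat \<Rightarrow> (nat \<Rightarrow> 'a \<Rightarrow> 'a) \<Rightarrow> 'a set \<Rightarrow> nat \<Rightarrow> ('a \<Rightarrow> real) \<Rightarrow> real" where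
  "energy N F K n u =
     (\<Sum>w\<in>words N n. let C = word_map F w ` vertices N F K 0 in
        (1/2) * (\<Sum>x\<in>C. \<Sum>y\<in>C - {x}. \<bar>u x - u y\<bar>\<^sup>2))"

text \<open>\<open>r p q\<close> is the trace \<open>R\<^sub>n(p,q)\<close>, a positive real for distinct \<open>p\<close>, \<open>q\<close> in \<open>V\<^sub>0\<close>.\<close>

definition is_trace ::
    "nat \<Rightarrow> (nat \<Rightarrow> 'a \<Rightarrow> 'a) \<Rightarrow> 'a set \<Rightarrow> nat \<Rightarrow> ('a \<Rightarrow> 'a \<Rightarrow> real) \<Rightarrow> bool" where
  "is_trace N F K n r \<longleftrightarrow>
     (let V0 = vertices N F K 0 in
       (\<forall>p\<in>V0. \<forall>q\<in>V0. p \<noteq> q \<longrightarrow> 0 < r p q \<and> r p q = r q p) \<and>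
       (\<forall>u. is_minimum {energy N F K n v | v. \<forall>x\<in>V0. v x = u x}
              ((1/2) * (\<Sum>p\<in>V0. \<Sum>q\<in>V0 - {p}. 1 / r p q * \<bar>u p - u q\<bar>\<^sup>2))))"

definition has_growth_rate :: "(nat \<Rightarrow> real) \<Rightarrow> real \<Rightarrow> bool" where
  "has_growth_rate a R \<longleftrightarrow>
     1 < R \<and> (\<forall>n. 0 < a n) \<and> incseq a \<and>
     (\<forall>\<epsilon>>0. \<exists>n0. \<forall>n\<ge>n0. R powr ((1 - \<epsilon>) * real n) \<le> a n \<and> a n \<le> R powr ((1 + \<epsilon>) * real n))"

text \<open>
  Consecutive points of a chain are distinct, since \<open>R(p,q)\<close> is defined for \<open>p \<noteq> q\<close> only.
\<close>

definition R_sharp :: "'a set \<Rightarrow> ('a \<Rightarrow> 'a \<Rightarrow> real) \<Rightarrow> real" where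
  "R_sharp V0 R = (LEAST s. \<forall>p\<in>V0. \<forall>q\<in>V0. p \<noteq> q \<longrightarrow>
     (\<exists>xs. xs \<noteq> [] \<and> hd xs = p \<and> last xs = q \<and> set xs \<subseteq> V0 \<and>
        (\<forall>i. Suc i < length xs \<longrightarrow> xs ! i \<noteq> xs ! Suc i \<and> R (xs ! i) (xs ! Suc i) \<le> s)))"

section \<open>Compatible relations and quotient traces\<close>

fun vertex_rel ::
    "nat \<Rightarrow> (nat \<Rightarrow> 'a \<Rightarrow> 'a) \<Rightarrow> 'a set \<Rightarrow> ('a \<times> 'a) set \<Rightarrow> nat \<Rightarrow> ('a \<times> 'a) set" where
  "vertex_rel N F K S 0 = S"
| "vertex_rel N F K S (Suc n) =
     \<Inter> {T. equiv (vertices N F K (Suc n)) T \<and> vertex_rel N F K S n \<subseteq> T \<and>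
            (\<forall>(x, y)\<in>vertex_rel N F K S n. \<forall>i\<in>{1..N}. (F i x, F i y) \<in> T)}"

definition compatible ::
    "nat \<Rightarrow> (nat \<Rightarrow> 'a \<Rightarrow> 'a) \<Rightarrow> 'a set \<Rightarrow> ('a \<times> 'a) set \<Rightarrow> bool" where
  "compatible N F K S \<longleftrightarrow>
     equiv (vertices N F K 0) S \<and> 2 \<le> card (vertices N F K 0 // S) \<and>
     (\<forall>n. \<forall>x\<in>vertices N F K n. \<forall>y\<in>vertices N F K n.
        (x, y) \<in> vertex_rel N F K S n \<longleftrightarrow> (x, y) \<in> vertex_rel N F K S (Suc n))"

definition all_vertices_rel ::
    "nat \<Rightarrow> (nat \<Rightarrow> 'a \<Rightarrow> 'a) \<Rightarrow> 'a set \<Rightarrow> ('a \<times> 'a) set \<Rightarrow> ('a \<times> 'a) set" where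
  "all_vertices_rel N F K S =
     {(x, y). \<exists>n. x \<in> vertices N F K n \<and> y \<in> vertices N F K n \<and> (x, y) \<in> vertex_rel N F K S n}"

definition boundary_classes ::
    "nat \<Rightarrow> (nat \<Rightarrow> 'a \<Rightarrow> 'a) \<Rightarrow> 'a set \<Rightarrow> ('a \<times> 'a) set \<Rightarrow> 'a set set" where
  "boundary_classes N F K S =
     {J \<in> all_vertices N F K // all_vertices_rel N F K S. J \<inter> vertices N F K 0 \<noteq> {}}"

definition class_functions :: "('a \<times> 'a) set \<Rightarrow> ('a \<Rightarrow> real) set" where
  "class_functions T = {u. \<forall>(x, y)\<in>T. u x = u y}"

text \<open>
  \<open>r I J\<close> is the quotient trace on distinct classes \<open>I\<close>, \<open>J\<close> in \<open>V\<^sub>0\<close>, with values in \<open>(0,\<infinity>]\<close>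
  and \<open>1/\<infinity> = 0\<close>.  The boundary datum in \<open>\<ell>(V\<^sub>0\<^sup>\<sim>)\<close> is given as a function \<open>u\<close> on the set of classes.
\<close>

definition is_quotient_trace ::
    "nat \<Rightarrow> (nat \<Rightarrow> 'a \<Rightarrow> 'a) \<Rightarrow> 'a set \<Rightarrow> ('a \<times> 'a) set \<Rightarrow> nat \<Rightarrow>
     ('a set \<Rightarrow> 'a set \<Rightarrow> ennreal) \<Rightarrow> bool" where
  "is_quotient_trace N F K S n r \<longleftrightarrow>
     (let V0 = vertices N F K 0 in
       (\<forall>I\<in>V0 // S. \<forall>J\<in>V0 // S. I \<noteq> J \<longrightarrow> 0 < r I J \<and> r I J = r J I) \<and>
       (\<forall>u. is_minimum
              {energy N F K n v | v. v \<in> class_functions (vertex_rel N F K S n) \<and>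
                                      (\<forall>J\<in>V0 // S. \<forall>x\<in>J. v x = u J)}
              ((1/2) * (\<Sum>I\<in>V0 // S. \<Sum>J\<in>V0 // S - {I}. enn2real (1 / r I J) * \<bar>u I - u J\<bar>\<^sup>2))))"

end

theory Submission
  imports Defs
begin

text \<open>
  The whole argument runs through energies on the vertex sets. All maps have the same linear part
  and meeting cells of one level share a vertex, so two meeting cells are in one of finitely many
  relative positions. Consequently disjoint cells of level \<open>n\<close> have distance at least
  \<open>c \<rho>\<^sup>n\<close> (\<open>cells_separated\<close>) and each cell meets boundedly many others (\<open>card_adj\<close>). This gives
  \<open>\<mu> (B(x, r)) \<le> C r\<^sup>\<alpha>\<close> and makes the double integral over \<open>\<bar>x - y\<bar> < r\<close> in the Besov seminorm
  comparable to a sum over pairs of meeting cells of size about \<open>r\<close>.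

  Upper bound for the critical exponent. For \<open>u\<close> in the Besov space of exponent \<open>\<sigma>\<close>, let \<open>f\<^sub>n\<close> assign
  to a vertex the mean of \<open>u\<close> over a cell of level \<open>n\<close> containing it. Then
  \<open>E\<^sub>n[f\<^sub>n] \<le> C \<rho>\<^bsup>(2\<sigma> - \<alpha>) n\<^esup>\<close>, whereas \<open>\<bar>f\<^sub>n(p) - f\<^sub>n(q)\<bar>\<^sup>2 \<le> R\<^sub>n(p,q) E\<^sub>n[f\<^sub>n]\<close> by the definition of the trace.
  Along a chain of edges of rate at most \<open>R\<^sup>#\<close> the right-hand side tends to zero as soon as \<open>\<sigma>\<close>
  exceeds \<open>\<sigma>\<^sub>0 = (\<alpha> + log R\<^sup># / \<bar>log \<rho>\<bar>) / 2\<close>. The means then become equal and \<open>u\<close> is constant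
  (\<open>besov_imp_constant\<close>). Hence \<open>\<sigma>\<^sup># \<le> \<sigma>\<^sub>0\<close> (\<open>sigma_sharp_le\<close>), and it suffices to prove density for
  exponents below \<open>\<sigma>\<^sub>0\<close>, respectively for \<open>\<sigma>\<^sub>0\<close> itself.

  Density. Fix \<open>\<theta> > 1\<close> with \<open>\<theta> \<rho>\<^bsup>2\<sigma> - \<alpha>\<^esup> \<ge> 1\<close>. A function on the vertices with \<open>E\<^sub>n \<le> C \<theta>\<^bsup>-n\<^esup>\<close> along
  the multiples of some level \<open>m\<close> has square-summable oscillations of the same order on the cells,
  hence extends continuously to \<open>K\<close> and lies in the Besov space (\<open>oscillation_bound\<close>,
  \<open>continuous_extension\<close>, \<open>oscillation_imp_besov\<close>). Such functions with prescribed values on the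
  classes in \<open>V\<^sub>0\<close> exist. Below \<open>\<sigma>\<^sub>0\<close>, the growth of the quotient traces gives an extension to one level
  \<open>m\<close> with \<open>E\<^sub>m \<le> \<theta>\<^bsup>-m\<^esup> E\<^sub>0\<close>, and this extension is repeated inside every cell
  (\<open>iterated_extension\<close>); at \<open>\<sigma>\<^sub>0\<close> it is the additional hypothesis.
  To approximate a continuous function \<open>f\<close>, give each class of a fine level the value of \<open>f\<close> at one of
  its points and extend cell by cell between the extreme vertex values (\<open>besov_extension\<close>). The
  error is small where all nearby classes are small. A class of large diameter has to run
  through copies of the boundary classes (\<open>class_in_one_cell\<close>), whose closures have dimension less
  than \<open>\<alpha>\<close> and hence measure zero, so the exceptional cells have small total measure
  (\<open>besov_dense\<close>).
\<close>

section \<open>Cells of a p.c.f. self-similar set\<close>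

text \<open>Unfolded by the simplifier, \<open>V\<^sub>0\<close> would turn into an image of the post-critical set.\<close>

declare vertices.simps(1) [simp del]

lemma words_0 [simp]: "words N 0 = {[]}"
  by (auto simp: words_def)

lemma Nil_in_words [simp]: "[] \<in> words N n \<longleftrightarrow> n = 0"
  by (auto simp: words_def)

lemma Cons_in_words [simp]: "i # w \<in> words N (Suc n) \<longleftrightarrow> i \<in> {1..N} \<and> w \<in> words N n"
  by (auto simp: words_def)

lemma words_Suc: "words N (Suc n) = (\<lambda>(i, w). i # w) ` ({1..N} \<times> words N n)"
  by (force simp: words_def length_Suc_conv)

lemma words_SucE:
  assumes "w \<in> words N (Suc n)"
  obtains i v where "w = i # v" "i \<in> {1..N}" "v \<in> words N n"
  using assms unfolding words_Suc by auto

lemma words_add: "words N (n + m) = (\<lambda>(v, w). v @ w) ` (words N n \<times> words N m)"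
proof (induction n)
  case (Suc n)
  show ?case
    unfolding add_Suc words_Suc Suc.IH by (force simp: image_iff)
qed force

lemma append_in_words: "v \<in> words N n \<Longrightarrow> w \<in> words N m \<Longrightarrow> v @ w \<in> words N (n + m)"
  by (auto simp: words_def)

lemma words_addE:
  assumes "u \<in> words N (n + m)"
  obtains v w where "u = v @ w" "v \<in> words N n" "w \<in> words N m"
  using assms unfolding words_add by auto

lemma finite_words [simp]: "finite (words N n)"
  by (induction n) (auto simp: words_Suc)

lemma card_words: "card (words N n) = N ^ n"
proof (induction n)
  case (Suc n)
  have "inj_on (\<lambda>(i, w). i # w) ({1..N} \<times> words N n)" by (auto simp: inj_on_def)
  with Suc show ?case by (simp add: words_Suc card_image card_cartesian_product)
qed auto

lemma inj_append_words: "inj_on (\<lambda>(v, w). v @ w) (words N n \<times> words N m)"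
  by (auto simp: inj_on_def words_def)

lemma sum_words_add:
  "(\<Sum>u\<in>words N (n + m). f u) = (\<Sum>v\<in>words N n. \<Sum>w\<in>words N m. f (v @ w))"
  unfolding words_add
  by (subst sum.reindex[OF inj_append_words]) (simp add: sum.cartesian_product case_prod_beta)

lemma word_map_Nil [simp]: "word_map F [] = id"
  by (simp add: word_map_def)

lemma word_map_Cons [simp]: "word_map F (i # w) x = F i (word_map F w x)"
  by (simp add: word_map_def)

lemma word_map_append [simp]: "word_map F (v @ w) x = word_map F v (word_map F w x)"
  by (induction v) simp_all

lemma prefix_word:
  assumes "w \<in> inf_words N" shows "map w [0..<n] \<in> words N n"
  using assms by (auto simp: words_def inf_words_def)

lemma map_upt_add: "map w [0..<n + m] = map w [0..<n] @ map (\<lambda>k. w (n + k)) [0..<m]"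
proof -
  have "[n..<n + m] = map (\<lambda>k. n + k) [0..<m]"
    using map_add_upt[of n m] by (simp add: add.commute)
  then show ?thesis by (simp add: upt_add_eq_append[of 0 n m] o_def)
qed

lemma funpow_left_shift: "(left_shift ^^ m) w = (\<lambda>k. w (m + k))"
  by (induction m) (auto simp: left_shift_def)

locale pcf_ifs =
  fixes N :: nat and \<rho> :: real and b :: "nat \<Rightarrow> 'a::euclidean_space"
    and F :: "nat \<Rightarrow> 'a \<Rightarrow> 'a" and K :: "'a set"
  assumes rho_pos: "0 < \<rho>" and rho_less_1: "\<rho> < 1"
    and F_eq: "\<And>i x. i \<in> {1..N} \<Longrightarrow> F i x = \<rho> *\<^sub>R (x - b i) + b i"
    and self_similar: "self_similar_set N F K" and connected_K: "connected K"
    and pcf: "pcf N F K" and two_vertices: "2 \<le> card (vertices N F K 0)"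
begin

abbreviation "W \<equiv> words N"
abbreviation "\<Phi> \<equiv> word_map F"
abbreviation "V \<equiv> vertices N F K"
abbreviation "Vs \<equiv> all_vertices N F K"
abbreviation "cell w \<equiv> \<Phi> w ` K"
abbreviation "code \<equiv> coding F K"
abbreviation "E \<equiv> energy N F K"

lemma K_nonempty: "K \<noteq> {}" and compact_K: "compact K" and K_eq: "K = (\<Union>i\<in>{1..N}. F i ` K)"
  using self_similar unfolding self_similar_set_def by blast+

lemma F_diff: "i \<in> {1..N} \<Longrightarrow> F i x - F i y = \<rho> *\<^sub>R (x - y)"
  by (simp add: F_eq algebra_simps)

lemma \<Phi>_diff: "w \<in> W n \<Longrightarrow> \<Phi> w x - \<Phi> w y = \<rho> ^ n *\<^sub>R (x - y)"
proof (induction n arbitrary: w)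
  case (Suc n)
  then obtain i v where "w = i # v" "i \<in> {1..N}" "v \<in> W n" by (auto simp: words_Suc)
  then have "\<Phi> w x - \<Phi> w y = \<rho> *\<^sub>R (\<Phi> v x - \<Phi> v y)" using F_diff by simp
  also have "\<dots> = \<rho> ^ Suc n *\<^sub>R (x - y)" unfolding Suc.IH[OF \<open>v \<in> W n\<close>] by simp
  finally show ?case .
qed auto

lemma dist_\<Phi>: "w \<in> W n \<Longrightarrow> dist (\<Phi> w x) (\<Phi> w y) = \<rho> ^ n * dist x y"
  using rho_pos by (simp add: dist_norm \<Phi>_diff)

lemma \<Phi>_inj: "w \<in> W n \<Longrightarrow> \<Phi> w x = \<Phi> w y \<longleftrightarrow> x = y"
  using \<Phi>_diff[of w n x y] rho_pos by auto

lemma inj_\<Phi>: "w \<in> W n \<Longrightarrow> inj_on (\<Phi> w) A"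
  by (simp add: inj_on_def \<Phi>_inj)

lemma continuous_\<Phi>: "w \<in> W n \<Longrightarrow> continuous_on A (\<Phi> w)"
proof -
  assume w: "w \<in> W n"
  have "\<Phi> w x = \<Phi> w 0 + \<rho> ^ n *\<^sub>R x" for x
    using \<Phi>_diff[OF w, of x 0] by (metis add.commute diff_add_cancel diff_zero)
  then have eq: "\<Phi> w = (\<lambda>x. \<Phi> w 0 + \<rho> ^ n *\<^sub>R x)" by (rule ext)
  show ?thesis by (subst eq) (intro continuous_intros)
qed

lemma compact_cell: "w \<in> W n \<Longrightarrow> compact (cell w)"
  using compact_K continuous_\<Phi> compact_continuous_image by blast

lemma F_in_K: "i \<in> {1..N} \<Longrightarrow> x \<in> K \<Longrightarrow> F i x \<in> K"
  using K_eq by blast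

lemma \<Phi>_in_K: "w \<in> W n \<Longrightarrow> x \<in> K \<Longrightarrow> \<Phi> w x \<in> K"
proof (induction n arbitrary: w)
  case (Suc n)
  then show ?case by (auto simp: words_Suc F_in_K)
qed auto

lemma K_cells: "K = (\<Union>w\<in>W n. cell w)"
proof (induction n)
  case (Suc n)
  have "K = (\<Union>i\<in>{1..N}. F i ` (\<Union>w\<in>W n. cell w))" using K_eq Suc by simp
  also have "\<dots> = (\<Union>w\<in>W (Suc n). cell w)" by (force simp: words_Suc)
  finally show ?case .
qed auto

lemma in_cellE:
  assumes "x \<in> K" obtains w y where "w \<in> W n" "y \<in> K" "x = \<Phi> w y"
  using assms K_cells[of n] by blast

lemma cell_append_subset: "w \<in> W m \<Longrightarrow> cell (v @ w) \<subseteq> cell v"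
  using \<Phi>_in_K by auto

lemma dist_K: "x \<in> K \<Longrightarrow> y \<in> K \<Longrightarrow> dist x y \<le> diameter K"
  using compact_K compact_imp_bounded diameter_bounded_bound by blast

lemma dist_cell: "w \<in> W n \<Longrightarrow> x \<in> cell w \<Longrightarrow> y \<in> cell w \<Longrightarrow> dist x y \<le> \<rho> ^ n * diameter K"
  using dist_K rho_pos by (auto simp: dist_\<Phi>)

lemma power_rho_tendsto_0: "(\<lambda>n. \<rho> ^ n * c) \<longlonglongrightarrow> 0"
proof -
  have "(\<lambda>n. \<rho> ^ n) \<longlonglongrightarrow> 0" using rho_pos rho_less_1 by (intro LIMSEQ_power_zero) auto
  then show ?thesis by (rule tendsto_mult_left_zero)
qed

lemma diameter_K_nonneg: "0 \<le> diameter K"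
  using compact_K compact_imp_bounded diameter_ge_0 by blast

lemma in_all_cells_eq:
  assumes "\<And>n. w n \<in> W n" "\<And>n. x \<in> cell (w n)" "\<And>n. y \<in> cell (w n)"
  shows "x = y"
proof -
  have "dist x y \<le> \<rho> ^ n * diameter K" for n
    by (rule dist_cell[OF assms(1,2,3)])
  then have "dist x y \<le> 0"
    by (intro LIMSEQ_le_const[OF power_rho_tendsto_0[of "diameter K"]]) auto
  then show ?thesis by simp
qed

lemma code_unique:
  assumes w: "w \<in> inf_words N" and x: "\<And>n. x \<in> cell (map w [0..<n])"
  shows "code w = x"
proof -
  have "(\<Inter>n. cell (map w [0..<n])) = {x}"
    using x in_all_cells_eq[of "\<lambda>n. map w [0..<n]" _ x, OF prefix_word[OF w]] by blast
  then show ?thesis unfolding coding_def by auto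
qed

lemma code_in_cell:
  assumes w: "w \<in> inf_words N" shows "code w \<in> cell (map w [0..<n])"
proof -
  have "(\<Inter>n. cell (map w [0..<n])) \<noteq> {}"
  proof (rule compact_nest)
    show "compact (cell (map w [0..<n]))" for n using compact_cell prefix_word[OF w] by blast
    show "cell (map w [0..<n]) \<noteq> {}" for n using K_nonempty by simp
    fix m n :: nat assume "m \<le> n"
    then obtain k where n: "n = m + k" using le_Suc_ex by blast
    have "(\<lambda>k. w (m + k)) \<in> inf_words N" using w by (auto simp: inf_words_def)
    then show "cell (map w [0..<n]) \<subseteq> cell (map w [0..<m])"
      unfolding n map_upt_add by (rule cell_append_subset[OF prefix_word])
  qed
  then obtain x where "\<And>n. x \<in> cell (map w [0..<n])" by blast
  with code_unique[OF w this] show ?thesis by blast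
qed

lemma code_in_K: "w \<in> inf_words N \<Longrightarrow> code w \<in> K"
  using code_in_cell[of w 0] by simp

lemma code_shift:
  assumes w: "w \<in> inf_words N"
  shows "code w = \<Phi> (map w [0..<n]) (code (\<lambda>k. w (n + k)))"
proof (rule code_unique[OF w])
  fix m
  have s: "(\<lambda>k. w (n + k)) \<in> inf_words N" using w by (auto simp: inf_words_def)
  define y where "y = code (\<lambda>k. w (n + k))"
  have *: "\<Phi> (map w [0..<n]) y \<in> cell (map w [0..<n + m])" for m
    unfolding map_upt_add using code_in_cell[OF s, of m] by (auto simp: y_def)
  have "map w [0..<n + m] = map w [0..<m] @ map (\<lambda>k. w (m + k)) [0..<n]"
    using map_upt_add[of w m n] by (simp add: add.commute)
  moreover have "map (\<lambda>k. w (m + k)) [0..<n] \<in> W n"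
    using w by (intro prefix_word) (auto simp: inf_words_def)
  ultimately have "cell (map w [0..<n + m]) \<subseteq> cell (map w [0..<m])"
    using cell_append_subset by metis
  then show "\<Phi> (map w [0..<n]) (code (\<lambda>k. w (n + k))) \<in> cell (map w [0..<m])"
    using *[of m] y_def by blast
qed

lemma address_exists:
  assumes "x \<in> K" obtains w where "w \<in> inf_words N" "code w = x"
proof -
  have ex: "\<exists>i y. i \<in> {1..N} \<and> y \<in> K \<and> x = F i y" if "x \<in> K" for x using that K_eq by blast
  then obtain i y where iy: "\<And>x. x \<in> K \<Longrightarrow> i x \<in> {1..N} \<and> y x \<in> K \<and> x = F (i x) (y x)"
    by metis
  define w where "w k = i ((y ^^ k) x)" for k
  have yK: "(y ^^ k) x \<in> K" for k by (induction k) (use assms iy in auto)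
  then have w: "w \<in> inf_words N" using iy by (auto simp: inf_words_def w_def)
  have "x = \<Phi> (map w [0..<n]) ((y ^^ n) x)" for n
  proof (induction n)
    case (Suc n)
    have "(y ^^ n) x = F (w n) ((y ^^ Suc n) x)" using iy[OF yK[of n]] by (simp add: w_def)
    then have "x = \<Phi> (map w [0..<n]) (F (w n) ((y ^^ Suc n) x))" using Suc by (rule subst)
    then show ?case by (simp del: funpow.simps)
  qed simp
  then have "code w = x" using yK by (intro code_unique[OF w]) blast
  with w that show thesis by blast
qed

lemma V0_eq: "V 0 = code ` post_critical_set N F K"
  by (rule vertices.simps(1))

lemma finite_V0: "finite (V 0)"
  using pcf by (simp add: pcf_def V0_eq)

lemma post_critical_subset: "post_critical_set N F K \<subseteq> inf_words N"
  by (auto simp: post_critical_set_def critical_set_def inf_words_def funpow_left_shift)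

lemma V0_subset_K: "V 0 \<subseteq> K"
  unfolding V0_eq using post_critical_subset code_in_K by blast

lemma V0_nonempty: "V 0 \<noteq> {}"
  using two_vertices by (metis card.empty not_numeral_le_zero)

lemma post_critical_shift: "w \<in> post_critical_set N F K \<Longrightarrow> left_shift w \<in> post_critical_set N F K"
proof -
  assume "w \<in> post_critical_set N F K"
  then obtain m c where "m \<ge> 1" "c \<in> critical_set N F K" "w = (left_shift ^^ m) c"
    by (auto simp: post_critical_set_def)
  then have "left_shift w = (left_shift ^^ Suc m) c" by simp
  then show ?thesis using \<open>c \<in> _\<close> unfolding post_critical_set_def
    by (metis One_nat_def UN_I atLeast_iff imageI le_add1 plus_1_eq_Suc)
qed

lemma V0_subset_V1: "V 0 \<subseteq> V (Suc 0)"
proof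
  fix x assume "x \<in> V 0"
  then obtain w where w: "w \<in> post_critical_set N F K" "x = code w"
    unfolding V0_eq by auto
  then have i: "w \<in> inf_words N" using post_critical_subset by blast
  have "x = F (w 0) (code (left_shift w))"
    using code_shift[OF i, of 1] w by (simp add: left_shift_def)
  moreover have "w 0 \<in> {1..N}" using i by (auto simp: inf_words_def)
  ultimately show "x \<in> V (Suc 0)" using post_critical_shift[OF w(1)] by (auto simp: V0_eq intro!: bexI[of _ "w 0"])
qed

lemma V_Suc_subset: "V n \<subseteq> V (Suc n)"
proof (induction n)
  case 0 show ?case by (rule V0_subset_V1)
next
  case (Suc n)
  have "V (Suc n) = (\<Union>i\<in>{1..N}. F i ` V n)" by simp
  also have "\<dots> \<subseteq> (\<Union>i\<in>{1..N}. F i ` V (Suc n))" using Suc by blast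
  also have "\<dots> = V (Suc (Suc n))" by simp
  finally show ?case .
qed

lemma V_mono: "m \<le> n \<Longrightarrow> V m \<subseteq> V n"
  using V_Suc_subset by (rule lift_Suc_mono_le)

lemma V_add: "V (n + m) = (\<Union>w\<in>W n. \<Phi> w ` V m)"
proof (induction n)
  case (Suc n)
  have "V (Suc n + m) = (\<Union>i\<in>{1..N}. F i ` V (n + m))" by simp
  also have "\<dots> = (\<Union>w\<in>W (Suc n). \<Phi> w ` V m)" unfolding Suc by (force simp: words_Suc)
  finally show ?case .
qed auto

lemma V_eq: "V n = (\<Union>w\<in>W n. \<Phi> w ` V 0)"
  using V_add[of n 0] by simp

lemma finite_V: "finite (V n)"
  by (subst V_eq) (simp add: finite_V0)

lemma V_subset_K: "V n \<subseteq> K"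
  using V0_subset_K \<Phi>_in_K by (subst V_eq) (auto)

lemma Vs_subset_K: "Vs \<subseteq> K"
  using V_subset_K by (auto simp: all_vertices_def)

lemma V_subset_Vs: "V n \<subseteq> Vs"
  by (auto simp: all_vertices_def)

lemma \<Phi>_in_V: "w \<in> W n \<Longrightarrow> x \<in> V m \<Longrightarrow> \<Phi> w x \<in> V (n + m)"
  unfolding V_add by blast

lemma \<Phi>_in_Vs: "w \<in> W n \<Longrightarrow> x \<in> Vs \<Longrightarrow> \<Phi> w x \<in> Vs"
  using \<Phi>_in_V unfolding all_vertices_def by blast

text \<open>
  A common point of the cells of two words of equal length lies in the intersection of two
  first-level cells after the common prefix is cancelled. Its address is therefore critical, and
  the tail of this address, which codes the preimage of the point in \<open>K\<close>, is post-critical.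
\<close>

lemma cells_meet_in_vertices:
  assumes "v \<in> W n" "w \<in> W n" "v \<noteq> w" "x \<in> K" "y \<in> K" "\<Phi> v x = \<Phi> w y"
  shows "x \<in> V 0"
  using assms
proof (induction n arbitrary: v w)
  case (Suc n)
  then obtain i v' j w' where vw: "v = i # v'" "w = j # w'"
      and ij: "i \<in> {1..N}" "j \<in> {1..N}" "v' \<in> W n" "w' \<in> W n"
    by (meson words_SucE)
  show ?case
  proof (cases "i = j")
    case True
    have "[i] \<in> W 1" using ij by simp
    from \<Phi>_inj[OF this] have "\<Phi> v' x = \<Phi> w' y" using Suc.prems(6) vw True by simp
    then show ?thesis using Suc.IH[of v' w'] Suc.prems vw True ij by auto
  next
    case False
    obtain a where a: "a \<in> inf_words N" "code a = x" using address_exists Suc.prems by blast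
    define c where "c k = (if k < Suc n then v ! k else a (k - Suc n))" for k
    have lv: "length v = Suc n" "set v \<subseteq> {1..N}" using Suc.prems by (auto simp: words_def)
    have c: "c \<in> inf_words N"
      using a lv nth_mem[of _ v] by (auto simp: inf_words_def c_def subset_iff)
    have pre: "map c [0..<Suc n] = v" using lv by (intro nth_equalityI) (auto simp: c_def simp del: upt_Suc)
    have tl: "(\<lambda>k. c (Suc n + k)) = a" by (auto simp: c_def)
    have "code c = \<Phi> v x" using code_shift[OF c, of "Suc n"] unfolding pre tl a .
    then have "code c \<in> F i ` K" "code c \<in> F j ` K"
      using Suc.prems(6) vw \<Phi>_in_K[OF ij(3) Suc.prems(4)] \<Phi>_in_K[OF ij(4) Suc.prems(5)]
      by (auto intro: image_eqI[of _ _ "\<Phi> v' x"] image_eqI[of _ _ "\<Phi> w' y"])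
    then have "c \<in> critical_set N F K"
    proof -
      have "\<exists>i\<in>{1..N}. \<exists>j\<in>{1..N}. i < j \<and> code c \<in> F i ` K \<inter> F j ` K"
        using ij(1,2) False \<open>code c \<in> F i ` K\<close> \<open>code c \<in> F j ` K\<close>
        by (metis IntI linorder_neqE_nat)
      then show ?thesis using c unfolding critical_set_def by blast
    qed
    then have "(left_shift ^^ Suc n) c \<in> post_critical_set N F K"
      unfolding post_critical_set_def by (intro UN_I[of "Suc n"]) auto
    then have "a \<in> post_critical_set N F K" unfolding funpow_left_shift tl .
    with a show ?thesis unfolding V0_eq by auto
  qed
qed auto

text \<open>
  A finite connected set is a single point, but \<open>K\<close> contains the two boundary points. Infinity of \<open>K\<close>
  is what keeps two cells of one level from coinciding.
\<close>

lemma infinite_K: "infinite K"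
proof
  assume f: "finite K"
  then have "card (V 0) \<le> card K" using V0_subset_K card_mono by blast
  moreover obtain x where "K = {x}"
    using connected_K f K_nonempty connected_finite_iff_sing by blast
  ultimately show False using two_vertices by simp
qed

lemma \<Phi>_eq_imp_eq:
  assumes "v \<in> W n" "w \<in> W n" "\<And>x. \<Phi> v x = \<Phi> w x" shows "v = w"
proof (rule ccontr)
  assume "v \<noteq> w"
  then have "K \<subseteq> V 0" using cells_meet_in_vertices[OF assms(1,2)] assms(3) by blast
  then show False using infinite_K finite_V0 finite_subset by blast
qed

lemma N_ge_2: "2 \<le> N"
proof (rule ccontr)
  assume "\<not> 2 \<le> N"
  then consider "N = 0" | "N = 1" by linarith
  then show False
  proof cases
    case 1 then show False using K_eq K_nonempty by simp
  next
    case 2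
    have W: "W n = {replicate n 1}" for n
      by (induction n) (auto simp: words_Suc 2)
    have "x = y" if "x \<in> K" "y \<in> K" for x y
      using that K_cells W by (intro in_all_cells_eq[of "\<lambda>n. replicate n 1" x y]) auto
    then have "finite K" using K_nonempty by (metis finite.simps is_singletonI' is_singleton_def)
    then show False using infinite_K by simp
  qed
qed

subsection \<open>Neighbouring cells\<close>

definition shifts :: "'a set" where
  "shifts = insert 0 ((\<lambda>(p, q). p - q) ` (V 0 \<times> V 0))"

definition adj :: "nat list \<Rightarrow> nat list \<Rightarrow> bool" where
  "adj v w \<longleftrightarrow> cell v \<inter> cell w \<noteq> {}"

lemma adj_sym: "adj v w \<Longrightarrow> adj w v"
  by (auto simp: adj_def)

lemma adj_refl [simp]: "adj w w"
  using K_nonempty by (auto simp: adj_def)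

lemma finite_shifts: "finite shifts"
  by (simp add: shifts_def finite_V0)

lemma adj_vertex:
  assumes "v \<in> W n" "w \<in> W n" "adj v w"
  obtains p q where "p \<in> V 0" "q \<in> V 0" "\<Phi> v p = \<Phi> w q"
proof (cases "v = w")
  case True with that V0_nonempty show thesis by blast
next
  case False
  from assms obtain x y where xy: "x \<in> K" "y \<in> K" "\<Phi> v x = \<Phi> w y" by (auto simp: adj_def)
  with that cells_meet_in_vertices[OF assms(1,2) False xy]
    cells_meet_in_vertices[OF assms(2,1) False[symmetric] xy(2,1)]
  show thesis by metis
qed

text \<open>
  All maps of one level have the same linear part, so two cells are translates of each other. When
  they meet, they do so at a vertex, which leaves only finitely many relative positions.
\<close>

lemma adj_shift:
  assumes "v \<in> W n" "w \<in> W n" "adj v w"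
  obtains d where "d \<in> shifts" "\<And>x. \<Phi> w x = \<Phi> v (x + d)"
proof -
  obtain p q where pq: "p \<in> V 0" "q \<in> V 0" "\<Phi> v p = \<Phi> w q" using adj_vertex assms by metis
  have "\<Phi> w x = \<Phi> v (x + (p - q))" for x
  proof -
    have "\<Phi> v (x + (p - q)) - \<Phi> v p = \<Phi> w x - \<Phi> w q"
      unfolding \<Phi>_diff[OF assms(1)] \<Phi>_diff[OF assms(2)] by simp
    then show ?thesis using pq(3) by simp
  qed
  moreover have "p - q \<in> shifts" using pq by (force simp: shifts_def)
  ultimately show thesis using that by blast
qed

text \<open>
  The shift relative to \<open>v\<close> determines the map of the other word, and different words of one length
  have different maps because their cells share only finitely many points.
\<close>

lemma card_adj:
  assumes v: "v \<in> W n" shows "card {w \<in> W n. adj v w} \<le> card shifts"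
proof -
  have "\<forall>w\<in>{w \<in> W n. adj v w}. \<exists>d. d \<in> shifts \<and> (\<forall>x. \<Phi> w x = \<Phi> v (x + d))"
    using adj_shift[OF v] by blast
  then obtain d where "\<forall>w\<in>{w \<in> W n. adj v w}. d w \<in> shifts \<and> (\<forall>x. \<Phi> w x = \<Phi> v (x + d w))"
    by (rule bchoice[THEN exE])
  then have d: "\<And>w. w \<in> W n \<Longrightarrow> adj v w \<Longrightarrow> d w \<in> shifts"
      "\<And>w x. w \<in> W n \<Longrightarrow> adj v w \<Longrightarrow> \<Phi> w x = \<Phi> v (x + d w)"
    by blast+
  have "inj_on d {w \<in> W n. adj v w}"
    using \<Phi>_eq_imp_eq d(2) by (intro inj_onI) auto
  then show ?thesis using d(1) finite_shifts by (intro card_inj_on_le[of d]) auto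
qed

text \<open>
  The distance of two disjoint cells is decided at the last level where their ancestors still meet.
  There the ancestors are in one of finitely many relative positions, hence so are their children,
  and finitely many pairs of disjoint compact sets have a positive least distance.
\<close>

lemma cells_separated:
  obtains c where "0 < c"
    "\<And>n v w x y. v \<in> W n \<Longrightarrow> w \<in> W n \<Longrightarrow> \<not> adj v w \<Longrightarrow> x \<in> cell v \<Longrightarrow> y \<in> cell w \<Longrightarrow>
       c * \<rho> ^ n \<le> dist x y"
proof -
  define Q where "Q = (\<lambda>(d, i, j) c. 0 < c \<and> ((\<forall>x\<in>K. \<forall>y\<in>K. F i x \<noteq> F j y + d) \<longrightarrow>
      (\<forall>x\<in>K. \<forall>y\<in>K. c \<le> dist (F i x) (F j y + d))))"
  define I where "I = shifts \<times> {1..N} \<times> {1..N}"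
  have ex: "\<exists>c. Q t c" if "t \<in> I" for t
  proof -
    obtain d i j where t: "t = (d, i, j)" and ij: "i \<in> {1..N}" "j \<in> {1..N}" "d \<in> shifts"
      using \<open>t \<in> I\<close> by (auto simp: I_def)
    have 1: "compact (F i ` K)" "compact (F j ` K)"
      using ij compact_cell[of "[i]" 1] compact_cell[of "[j]" 1] by simp_all
    have 2: "compact ((\<lambda>y. y + d) ` F j ` K)"
      by (rule compact_continuous_image[OF _ 1(2)]) (intro continuous_intros)
    show ?thesis
    proof (cases "\<forall>x\<in>K. \<forall>y\<in>K. F i x \<noteq> F j y + d")
      case True
      then have "F i ` K \<inter> (\<lambda>y. y + d) ` F j ` K = {}" by auto
      then obtain c where "0 < c" "\<forall>x\<in>F i ` K. \<forall>y\<in>(\<lambda>y. y + d) ` F j ` K. c \<le> dist x y"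
        using separate_compact_closed[OF 1(1) compact_imp_closed[OF 2]] by blast
      then show ?thesis unfolding t Q_def by auto
    next
      case False
      then show ?thesis unfolding t Q_def by (auto intro!: exI[of _ 1])
    qed
  qed
  then obtain c where c: "\<And>t. t \<in> I \<Longrightarrow> Q t (c t)" by metis
  define c0 where "c0 = Min (insert 1 (c ` I))"
  have fin: "finite I" using finite_shifts by (simp add: I_def)
  have cpos: "\<And>t. t \<in> I \<Longrightarrow> 0 < c t" using c unfolding Q_def by fastforce
  have c0: "0 < c0" using fin cpos by (auto simp: c0_def)
  have c0_le: "c0 \<le> c t" if "t \<in> I" for t using that fin by (auto simp: c0_def)
  have "c0 * \<rho> ^ n \<le> dist x y"
    if "v \<in> W n" "w \<in> W n" "\<not> adj v w" "x \<in> cell v" "y \<in> cell w" for n v w x y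
    using that
  proof (induction n arbitrary: v w x y)
    case (Suc n)
    have "v \<in> W (n + 1)" "w \<in> W (n + 1)" using Suc.prems by simp_all
    then obtain v' w' v'' w'' where vw: "v = v' @ v''" "w = w' @ w''" "v' \<in> W n" "w' \<in> W n"
        "v'' \<in> W 1" "w'' \<in> W 1"
      by (metis words_addE)
    then obtain i j where ij: "v'' = [i]" "w'' = [j]" "i \<in> {1..N}" "j \<in> {1..N}"
      by (auto simp: words_Suc)
    have le: "c0 * \<rho> ^ Suc n \<le> c0 * \<rho> ^ n"
      using c0 rho_pos rho_less_1 by (intro mult_left_mono power_decreasing) auto
    show ?case
    proof (cases "adj v' w'")
      case False
      have "x \<in> cell v'" "y \<in> cell w'"
        using Suc.prems vw cell_append_subset[OF vw(5)] cell_append_subset[OF vw(6)] by blast+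
      from Suc.IH[OF vw(3,4) False this] le show ?thesis by linarith
    next
      case True
      obtain d where d: "d \<in> shifts" "\<And>x. \<Phi> w' x = \<Phi> v' (x + d)"
        using adj_shift[OF vw(3,4) True] by blast
      obtain x' y' where xy: "x = \<Phi> v' (F i x')" "y = \<Phi> v' (F j y' + d)" "x' \<in> K" "y' \<in> K"
        using Suc.prems(4,5) vw ij d by auto
      have "\<forall>x\<in>K. \<forall>y\<in>K. F i x \<noteq> F j y + d"
        using Suc.prems(3) d(2) unfolding adj_def vw ij by fastforce
      moreover have t: "(d, i, j) \<in> I" using ij d by (auto simp: I_def)
      ultimately have "c (d, i, j) \<le> dist (F i x') (F j y' + d)"
        using c[OF t] xy(3,4) unfolding Q_def by auto
      then have "c0 \<le> dist (F i x') (F j y' + d)" using c0_le[OF t] by linarith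
      then have "c0 * \<rho> ^ n \<le> dist x y"
        using xy(1,2) dist_\<Phi>[OF vw(3)] rho_pos by (simp add: mult.commute)
      with le show ?thesis by linarith
    qed
  qed (use adj_refl in auto)
  with c0 that show thesis by blast
qed

text \<open>
  Points of \<open>V n\<close> communicate through cells: otherwise the cells reachable from one point and the
  remaining cells would split \<open>K\<close> into two disjoint nonempty closed sets.
\<close>

lemma vertices_chain:
  assumes refl: "\<And>x. x \<in> V n \<Longrightarrow> Q x x"
    and sym: "\<And>x y. Q x y \<Longrightarrow> Q y x" and trans: "\<And>x y z. Q x y \<Longrightarrow> Q y z \<Longrightarrow> Q x z"
    and cells: "\<And>w p q. w \<in> W n \<Longrightarrow> p \<in> V 0 \<Longrightarrow> q \<in> V 0 \<Longrightarrow> Q (\<Phi> w p) (\<Phi> w q)"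
    and x: "x \<in> V n" and y: "y \<in> V n"
  shows "Q x y"
proof (rule ccontr)
  assume nQ: "\<not> Q x y"
  define A where "A = {w \<in> W n. \<forall>p\<in>V 0. Q x (\<Phi> w p)}"
  have dich: "w \<in> A" if "w \<in> W n" "p \<in> V 0" "Q x (\<Phi> w p)" for w p
    using that cells trans by (auto simp: A_def)
  have cl: "closed (\<Union>w\<in>B. cell w)" if "B \<subseteq> W n" for B
    using that finite_subset[OF that]
    by (intro closed_UN ballI compact_imp_closed compact_cell[of _ n]) auto
  obtain wx px where "wx \<in> W n" "px \<in> V 0" "x = \<Phi> wx px" using x V_eq by blast
  with dich refl x have Ax: "wx \<in> A" by metis
  obtain wy py where wy: "wy \<in> W n" "py \<in> V 0" "y = \<Phi> wy py" using y V_eq by blast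
  then have Ay: "wy \<in> W n - A" using nQ by (auto simp: A_def)
  have "(\<Union>w\<in>A. cell w) \<inter> (\<Union>w\<in>W n - A. cell w) = {}"
  proof (rule ccontr)
    assume "\<not> ?thesis"
    then obtain v w where vw: "v \<in> A" "w \<in> W n - A" "adj v w" by (auto simp: adj_def)
    then have "v \<in> W n" "w \<in> W n" by (auto simp: A_def)
    from adj_vertex[OF this vw(3)] obtain p q where "p \<in> V 0" "q \<in> V 0" "\<Phi> v p = \<Phi> w q" by metis
    with vw dich[of w q] show False by (auto simp: A_def)
  qed
  moreover have "K \<subseteq> (\<Union>w\<in>A. cell w) \<union> (\<Union>w\<in>W n - A. cell w)"
    by (subst K_cells[of n]) blast
  moreover have "(\<Union>w\<in>B. cell w) \<inter> K \<noteq> {}" if "B \<subseteq> W n" "w \<in> B" for B w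
  proof -
    obtain z where "z \<in> K" using K_nonempty by blast
    moreover have "\<Phi> w z \<in> K" using \<Phi>_in_K[of w n z] that \<open>z \<in> K\<close> by blast
    ultimately show ?thesis using that(2) by blast
  qed
  from this[OF _ Ax] this[OF _ Ay]
  have "(\<Union>w\<in>A. cell w) \<inter> K \<noteq> {}" "(\<Union>w\<in>W n - A. cell w) \<inter> K \<noteq> {}"
    by (auto simp: A_def)
  moreover have "closed (\<Union>w\<in>A. cell w)" "closed (\<Union>w\<in>W n - A. cell w)"
    using cl by (auto simp: A_def)
  ultimately show False
    using connected_K unfolding connected_closed by (metis inf_bot_left)
qed

end

section \<open>The self-similar measure\<close>

text \<open>
  It selects the level whose cells have the size of a given radius.
\<close>

lemma power_bracket:
  fixes r t :: real assumes "0 < r" "r < 1" "0 < t" "t < 1"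
  obtains n where "r ^ Suc n \<le> t" "t < r ^ n"
proof -
  have "(\<lambda>n. r ^ n) \<longlonglongrightarrow> 0" using assms by (intro LIMSEQ_power_zero) auto
  then have "\<forall>\<^sub>F n in sequentially. r ^ n < t" using assms by (intro order_tendstoD) auto
  then obtain n where "r ^ n < t" by (auto simp: eventually_sequentially)
  then have ex: "\<exists>n. r ^ Suc n \<le> t"
    using assms by (intro exI[of _ n]) (auto intro: order_trans[OF mult_left_le_one_le])
  define n where "n = (LEAST n. r ^ Suc n \<le> t)"
  have "r ^ Suc n \<le> t" unfolding n_def by (rule LeastI_ex[OF ex])
  moreover have "t < r ^ n"
  proof (cases n)
    case (Suc m)
    then have "\<not> r ^ Suc m \<le> t" unfolding n_def by (metis lessI not_less_Least)
    with Suc show ?thesis by simp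
  qed (use assms in simp)
  ultimately show thesis using that by blast
qed

text \<open>
  The decomposition of a second moment around the mean. It serves twice: the mean is the constant
  of least square deviation, and the square of a difference of means is at most a mean square.
\<close>

lemma (in prob_space) sq_deviation_eq:
  fixes g :: "'a \<Rightarrow> real"
  assumes g: "integrable M g" "integrable M (\<lambda>x. (g x)\<^sup>2)"
  shows "(\<integral>\<^sup>+x. ennreal ((g x - c)\<^sup>2) \<partial>M)
    = (\<integral>\<^sup>+x. ennreal ((g x - (\<integral>x. g x \<partial>M))\<^sup>2) \<partial>M) + ennreal (((\<integral>x. g x \<partial>M) - c)\<^sup>2)"
proof -
  define m where "m = (\<integral>x. g x \<partial>M)"
  have i: "integrable M (\<lambda>x. (g x - d)\<^sup>2)" for d
    unfolding power2_diff using g by auto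
  have e: "(\<integral>x. (g x - d)\<^sup>2 \<partial>M) = (\<integral>x. (g x)\<^sup>2 \<partial>M) + d\<^sup>2 - 2 * m * d" for d
    unfolding power2_diff using g by (simp add: m_def prob_space)
  have n: "(\<integral>\<^sup>+x. ennreal ((g x - d)\<^sup>2) \<partial>M) = ennreal (\<integral>x. (g x - d)\<^sup>2 \<partial>M)" for d
    by (rule nn_integral_eq_integral) (use i in auto)
  have "(\<integral>x. (g x - c)\<^sup>2 \<partial>M) = (\<integral>x. (g x - m)\<^sup>2 \<partial>M) + (m - c)\<^sup>2"
    unfolding e by (simp add: power2_eq_square algebra_simps)
  then show ?thesis unfolding n m_def[symmetric] by simp
qed

lemma (in prob_space) sq_integral_diff_le:
  fixes g :: "'a \<Rightarrow> real"
  assumes "integrable M g" "integrable M (\<lambda>x. (g x)\<^sup>2)"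
  shows "ennreal (((\<integral>x. g x \<partial>M) - c)\<^sup>2) \<le> (\<integral>\<^sup>+x. ennreal ((g x - c)\<^sup>2) \<partial>M)"
  unfolding sq_deviation_eq[OF assms, of c] by simp

lemma (in prob_space) sq_deviation_minimal:
  fixes g :: "'a \<Rightarrow> real"
  assumes "integrable M g" "integrable M (\<lambda>x. (g x)\<^sup>2)"
  shows "(\<integral>\<^sup>+x. ennreal ((g x - (\<integral>x. g x \<partial>M))\<^sup>2) \<partial>M) \<le> (\<integral>\<^sup>+x. ennreal ((g x - c)\<^sup>2) \<partial>M)"
  unfolding sq_deviation_eq[OF assms, of c] by simp

lemma sq_add_le: "(s + t)\<^sup>2 \<le> 2 * s\<^sup>2 + 2 * t\<^sup>2" for s t :: real
proof -
  have "0 \<le> (s - t)\<^sup>2" by simp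
  then show ?thesis by (simp add: power2_eq_square algebra_simps)
qed

locale pcf_ifs_measure = pcf_ifs N \<rho> b F K
  for N :: nat and \<rho> :: real and b :: "nat \<Rightarrow> 'a::euclidean_space"
    and F :: "nat \<Rightarrow> 'a \<Rightarrow> 'a" and K :: "'a set" +
  fixes \<mu> :: "'a measure"
  assumes mu: "self_similar_measure N F K \<mu>"
begin

abbreviation \<alpha> :: real where "\<alpha> \<equiv> similarity_dim N \<rho>"

sublocale prob_space \<mu>
  using mu by (simp add: self_similar_measure_def)

lemma sets_mu: "sets \<mu> = sets (restrict_space borel K)"
  using mu by (simp add: self_similar_measure_def)

lemma space_mu: "space \<mu> = K"
  using sets_eq_imp_space_eq[OF sets_mu] by (simp add: space_restrict_space)

lemma K_borel: "K \<in> sets borel"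
  using compact_K by (intro borel_closed compact_imp_closed)

lemma in_sets_mu: "A \<in> sets borel \<Longrightarrow> A \<inter> K \<in> sets \<mu>"
  unfolding sets_mu sets_restrict_space by auto

lemma closed_in_sets_mu: "closed A \<Longrightarrow> A \<subseteq> K \<Longrightarrow> A \<in> sets \<mu>"
  using in_sets_mu[of A] by (simp add: Int_absorb2)

lemma continuous_on_borel_mu: "continuous_on K f \<Longrightarrow> f \<in> borel_measurable \<mu>"
  using borel_measurable_continuous_on_restrict[of K f] measurable_cong_sets[OF sets_mu refl] by blast

lemma measurable_\<Phi>: "w \<in> W n \<Longrightarrow> \<Phi> w \<in> \<mu> \<rightarrow>\<^sub>M \<mu>"
proof -
  assume w: "w \<in> W n"
  have "\<Phi> w \<in> \<mu> \<rightarrow>\<^sub>M restrict_space borel K"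
    using continuous_on_borel_mu[OF continuous_\<Phi>[OF w]] \<Phi>_in_K[OF w]
    by (intro measurable_restrict_space2) (auto simp: space_mu)
  then show ?thesis using measurable_cong_sets[OF refl sets_mu] by blast
qed

lemma measurable_F: "i \<in> {1..N} \<Longrightarrow> F i \<in> \<mu> \<rightarrow>\<^sub>M \<mu>"
proof -
  assume "i \<in> {1..N}"
  then have "\<Phi> [i] \<in> \<mu> \<rightarrow>\<^sub>M \<mu>" by (intro measurable_\<Phi>[of _ 1]) auto
  moreover have "\<Phi> [i] = F i" by auto
  ultimately show ?thesis by simp
qed

lemma nn_integral_one_level:
  assumes "f \<in> borel_measurable \<mu>"
  shows "(\<integral>\<^sup>+x. f x \<partial>\<mu>) = ennreal (1 / real N) * (\<Sum>i=1..N. \<integral>\<^sup>+x. f (F i x) \<partial>\<mu>)"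
  using assms
proof (induction rule: borel_measurable_induct)
  case (cong f g)
  have "(\<integral>\<^sup>+x. f (F i x) \<partial>\<mu>) = (\<integral>\<^sup>+x. g (F i x) \<partial>\<mu>)" if "i \<in> {1..N}" for i
    using cong that F_in_K by (intro nn_integral_cong) (auto simp: space_mu)
  moreover have "(\<integral>\<^sup>+x. f x \<partial>\<mu>) = (\<integral>\<^sup>+x. g x \<partial>\<mu>)"
    using cong by (intro nn_integral_cong) auto
  ultimately show ?case using cong by simp
next
  case (set A)
  have "(\<integral>\<^sup>+x. indicator A (F i x) \<partial>\<mu>) = emeasure \<mu> (F i -` A \<inter> K)" if "i \<in> {1..N}" for i
  proof -
    have "(\<integral>\<^sup>+x. indicator A (F i x) \<partial>\<mu>) = (\<integral>\<^sup>+x. indicator (F i -` A \<inter> K) x \<partial>\<mu>)"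
      by (intro nn_integral_cong) (auto simp: indicator_def space_mu)
    moreover have "F i -` A \<inter> K \<in> sets \<mu>"
      using measurable_sets[OF measurable_F[OF that] set] by (simp add: space_mu)
    ultimately show ?thesis by simp
  qed
  then show ?case using set mu by (simp add: self_similar_measure_def)
next
  case (mult u c)
  have "(\<integral>\<^sup>+x. c * u (F i x) \<partial>\<mu>) = c * (\<integral>\<^sup>+x. u (F i x) \<partial>\<mu>)" if "i \<in> {1..N}" for i
    using measurable_compose[OF measurable_F[OF that] mult(2)] by (rule nn_integral_cmult)
  then show ?case using mult
    by (simp add: nn_integral_cmult sum_distrib_left[symmetric] mult.left_commute)
next
  case (add u v)
  have "(\<integral>\<^sup>+x. v (F i x) + u (F i x) \<partial>\<mu>) = (\<integral>\<^sup>+x. v (F i x) \<partial>\<mu>) + (\<integral>\<^sup>+x. u (F i x) \<partial>\<mu>)"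
    if "i \<in> {1..N}" for i
    using measurable_compose[OF measurable_F[OF that]] add by (intro nn_integral_add) auto
  then show ?case using add
    by (simp add: nn_integral_add sum.distrib distrib_left)
next
  case (seq U)
  have "(\<integral>\<^sup>+x. (SUP k. U k) (F i x) \<partial>\<mu>) = (SUP k. \<integral>\<^sup>+x. U k (F i x) \<partial>\<mu>)" if "i \<in> {1..N}" for i
    unfolding SUP_apply
    using measurable_compose[OF measurable_F[OF that]] seq
    by (intro nn_integral_monotone_convergence_SUP) (auto simp: incseq_def le_fun_def)
  then have "(\<Sum>i=1..N. \<integral>\<^sup>+x. (SUP k. U k) (F i x) \<partial>\<mu>)
      = (\<Sum>i=1..N. SUP k. \<integral>\<^sup>+x. U k (F i x) \<partial>\<mu>)" by simp
  also have "\<dots> = (SUP k. \<Sum>i=1..N. \<integral>\<^sup>+x. U k (F i x) \<partial>\<mu>)"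
  proof (rule ennreal_SUP_sum[symmetric])
    show "incseq (\<lambda>k. \<integral>\<^sup>+x. U k (F i x) \<partial>\<mu>)" for i
      using \<open>incseq U\<close> by (auto simp: incseq_def le_fun_def intro!: nn_integral_mono)
  qed
  finally have "ennreal (1 / real N) * (\<Sum>i=1..N. \<integral>\<^sup>+x. (SUP k. U k) (F i x) \<partial>\<mu>)
      = (SUP k. \<integral>\<^sup>+x. U k x \<partial>\<mu>)"
    using seq by (simp add: SUP_mult_left_ennreal)
  also have "\<dots> = (\<integral>\<^sup>+x. (SUP k. U k) x \<partial>\<mu>)"
    unfolding SUP_apply using seq by (intro nn_integral_monotone_convergence_SUP[symmetric]) auto
  finally show ?case by simp
qed

lemma nn_integral_cells:
  assumes "f \<in> borel_measurable \<mu>"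
  shows "(\<integral>\<^sup>+x. f x \<partial>\<mu>) = ennreal (1 / real N ^ n) * (\<Sum>w\<in>W n. \<integral>\<^sup>+x. f (\<Phi> w x) \<partial>\<mu>)"
proof (induction n)
  case (Suc n)
  have "(\<integral>\<^sup>+x. f (\<Phi> w x) \<partial>\<mu>) = ennreal (1 / real N) * (\<Sum>v\<in>W 1. \<integral>\<^sup>+x. f (\<Phi> (w @ v) x) \<partial>\<mu>)"
    if "w \<in> W n" for w
  proof -
    have "(\<Sum>v\<in>W 1. \<integral>\<^sup>+x. f (\<Phi> (w @ v) x) \<partial>\<mu>) = (\<Sum>i=1..N. \<integral>\<^sup>+x. f (\<Phi> w (F i x)) \<partial>\<mu>)"
      by (rule sum.reindex_bij_witness[of _ "\<lambda>i. [i]" hd]) (auto simp: words_Suc)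
    then show ?thesis
      using nn_integral_one_level[OF measurable_compose[OF measurable_\<Phi>[OF that] assms]] by simp
  qed
  then have "(\<integral>\<^sup>+x. f x \<partial>\<mu>) = ennreal (1 / real N ^ n) *
      (\<Sum>w\<in>W n. ennreal (1 / real N) * (\<Sum>v\<in>W 1. \<integral>\<^sup>+x. f (\<Phi> (w @ v) x) \<partial>\<mu>))"
    using Suc by simp
  also have "\<dots> = ennreal (1 / real N ^ Suc n) * (\<Sum>w\<in>W (n + 1). \<integral>\<^sup>+x. f (\<Phi> w x) \<partial>\<mu>)"
    unfolding sum_words_add sum_distrib_left[symmetric] mult.assoc[symmetric]
    by (simp add: ennreal_mult[symmetric] mult.commute)
  finally show ?case by simp
qed simp

lemma N_pos: "0 < real N"
  using N_ge_2 by simp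

lemma sum_cells:
  assumes "f \<in> borel_measurable \<mu>"
  shows "(\<Sum>w\<in>W n. \<integral>\<^sup>+x. f (\<Phi> w x) \<partial>\<mu>) = ennreal (real N ^ n) * (\<integral>\<^sup>+x. f x \<partial>\<mu>)"
proof -
  have "ennreal (real N ^ n) * ennreal (1 / real N ^ n) = 1"
    using N_pos by (simp add: ennreal_mult[symmetric])
  then show ?thesis
    unfolding nn_integral_cells[OF assms, of n] mult.assoc[symmetric] by simp
qed

lemma L2_integrable: "u \<in> L2 \<mu> \<Longrightarrow> integrable \<mu> u"
  by (auto simp: L2_def intro: square_integrable_imp_integrable)

lemma L2_bounded:
  assumes "f \<in> borel_measurable \<mu>" "\<And>x. x \<in> K \<Longrightarrow> \<bar>f x\<bar> \<le> M" shows "f \<in> L2 \<mu>"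
proof -
  have "integrable \<mu> (\<lambda>x. (f x)\<^sup>2)"
  proof (rule integrable_const_bound[of _ "M\<^sup>2"])
    show "AE x in \<mu>. norm ((f x)\<^sup>2) \<le> M\<^sup>2"
    proof (rule AE_I2)
      fix x assume "x \<in> space \<mu>"
      then have "\<bar>f x\<bar>\<^sup>2 \<le> M\<^sup>2" using assms by (intro power_mono) (auto simp: space_mu)
      then show "norm ((f x)\<^sup>2) \<le> M\<^sup>2" by simp
    qed
  qed (use assms in measurable)
  with assms show ?thesis by (simp add: L2_def)
qed

lemma continuous_in_L2: "continuous_on K u \<Longrightarrow> u \<in> L2 \<mu>"
proof -
  assume u: "continuous_on K u"
  have "bounded (u ` K)" using u compact_K by (intro compact_imp_bounded compact_continuous_image)
  then obtain M where "\<And>x. x \<in> K \<Longrightarrow> \<bar>u x\<bar> \<le> M" unfolding bounded_iff by auto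
  with continuous_on_borel_mu[OF u] show ?thesis by (rule L2_bounded)
qed

lemma L2_\<Phi>:
  assumes u: "u \<in> L2 \<mu>" and w: "w \<in> W n"
  shows "(\<lambda>x. u (\<Phi> w x)) \<in> L2 \<mu>"
proof -
  have m: "u \<in> borel_measurable \<mu>" using u by (simp add: L2_def)
  have fin: "(\<integral>\<^sup>+x. ennreal ((u x)\<^sup>2) \<partial>\<mu>) < \<infinity>"
    using u unfolding L2_def by (auto simp: integrable_iff_bounded)
  have "(\<integral>\<^sup>+x. ennreal ((u (\<Phi> w x))\<^sup>2) \<partial>\<mu>) \<le> (\<Sum>w\<in>W n. \<integral>\<^sup>+x. ennreal ((u (\<Phi> w x))\<^sup>2) \<partial>\<mu>)"
    using w by (intro member_le_sum) auto
  also have "\<dots> = ennreal (real N ^ n) * (\<integral>\<^sup>+x. ennreal ((u x)\<^sup>2) \<partial>\<mu>)"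
    using m by (intro sum_cells) measurable
  also have "\<dots> < \<infinity>" using fin by (simp add: ennreal_mult_less_top)
  finally have f: "(\<integral>\<^sup>+x. ennreal ((u (\<Phi> w x))\<^sup>2) \<partial>\<mu>) < \<infinity>" .
  have "(\<lambda>x. u (\<Phi> w x)) \<in> borel_measurable \<mu>"
    using measurable_compose[OF measurable_\<Phi>[OF w] m] .
  with f show ?thesis unfolding L2_def by (auto simp: integrable_iff_bounded)
qed

section \<open>Growth of balls and Hausdorff dimension\<close>

lemma \<alpha>_pos: "0 < \<alpha>"
  using N_ge_2 rho_pos rho_less_1 by (simp add: similarity_dim_def divide_pos_neg)

lemma rho_powr_\<alpha>: "\<rho> powr \<alpha> = 1 / real N"
proof -
  have "ln \<rho> < 0" using rho_pos rho_less_1 by simp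
  then have "\<alpha> * ln \<rho> = - ln (real N)" by (simp add: similarity_dim_def)
  then show ?thesis using rho_pos N_pos by (simp add: powr_def exp_minus inverse_eq_divide)
qed

lemma rho_power_powr: "(\<rho> ^ n) powr s = (\<rho> powr s) ^ n"
  using rho_pos by (simp add: powr_realpow[symmetric] powr_powr mult.commute)

text \<open>
  Two points of a ball of radius below half the separation constant of level \<open>n\<close> cannot lie in disjoint
  cells. The cells of level \<open>n\<close> that meet the ball therefore all meet each other, so their number is
  bounded, and each contributes a mass of \<open>N\<^bsup>-n\<^esup>\<close>.
\<close>

lemma emeasure_ball_le:
  obtains C where "0 < C"
    "\<And>x d. 0 < d \<Longrightarrow> emeasure \<mu> (cball x d \<inter> K) \<le> ennreal (C * d powr \<alpha>)"
proof -
  obtain c where c: "0 < c" and sep: "\<And>n v w x y. v \<in> W n \<Longrightarrow> w \<in> W n \<Longrightarrow> \<not> adj v w \<Longrightarrow>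
      x \<in> cell v \<Longrightarrow> y \<in> cell w \<Longrightarrow> c * \<rho> ^ n \<le> dist x y"
    using cells_separated by metis
  define M where "M = card shifts"
  have "0 \<in> shifts" by (simp add: shifts_def)
  then have "M \<noteq> 0" unfolding M_def using finite_shifts card_0_eq by blast
  then have M: "1 \<le> M" by simp
  define C where "C = M * (2 / (c * \<rho>)) powr \<alpha>"
  have C: "0 < C" using M c rho_pos by (simp add: C_def)
  have "emeasure \<mu> (cball x d \<inter> K) \<le> ennreal (C * d powr \<alpha>)" if d: "0 < d" for x d
  proof (cases "2 * d / c < 1")
    case True
    obtain n where n: "\<rho> ^ Suc n \<le> 2 * d / c" "2 * d / c < \<rho> ^ n"
      using power_bracket[OF rho_pos rho_less_1 _ True] c d by auto
    define A where "A = cball x d \<inter> K"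
    define I where "I = {w \<in> W n. cell w \<inter> A \<noteq> {}}"
    have "card I \<le> M"
    proof (cases "I = {}")
      case False
      then obtain v where v: "v \<in> I" by blast
      have "I \<subseteq> {w \<in> W n. adj v w}"
      proof
        fix w assume w: "w \<in> I"
        obtain y z where "y \<in> cell v" "z \<in> cell w" "y \<in> A" "z \<in> A"
          using v w by (auto simp: I_def)
        moreover from this have "dist x y \<le> d" "dist x z \<le> d" by (auto simp: A_def)
        moreover have "dist y z \<le> dist x y + dist x z" by (metis dist_triangle3)
        moreover have "2 * d < c * \<rho> ^ n" using n(2) c by (simp add: field_simps)
        ultimately have "adj v w" using sep[of v n w y z] v w by (force simp: I_def)
        then show "w \<in> {w \<in> W n. adj v w}" using w by (simp add: I_def)
      qed
      then have "card I \<le> card {w \<in> W n. adj v w}" by (intro card_mono) auto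
      also have "\<dots> \<le> M" unfolding M_def using v by (intro card_adj) (auto simp: I_def)
      finally show ?thesis .
    qed simp
    have A: "A \<in> sets \<mu>" unfolding A_def by (intro in_sets_mu) auto
    have "emeasure \<mu> A = (\<integral>\<^sup>+x. indicator A x \<partial>\<mu>)" using A by simp
    also have "\<dots> = ennreal (1 / real N ^ n) * (\<Sum>w\<in>W n. \<integral>\<^sup>+x. indicator A (\<Phi> w x) \<partial>\<mu>)"
      using A by (intro nn_integral_cells) auto
    also have "(\<Sum>w\<in>W n. \<integral>\<^sup>+x. indicator A (\<Phi> w x) \<partial>\<mu>) \<le> (\<Sum>w\<in>W n. if w \<in> I then 1 else 0)"
    proof (rule sum_mono)
      fix w assume w: "w \<in> W n"
      show "(\<integral>\<^sup>+x. indicator A (\<Phi> w x) \<partial>\<mu>) \<le> (if w \<in> I then 1 else (0::ennreal))"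
      proof (cases "w \<in> I")
        case True
        have "(\<integral>\<^sup>+x. indicator A (\<Phi> w x) \<partial>\<mu>) \<le> (\<integral>\<^sup>+x. 1 \<partial>\<mu>)"
          by (intro nn_integral_mono) (auto simp: indicator_def)
        then show ?thesis using True emeasure_space_1 by simp
      next
        case False
        then have "(\<integral>\<^sup>+x. indicator A (\<Phi> w x) \<partial>\<mu>) = (\<integral>\<^sup>+x. 0 \<partial>\<mu>)"
          using w by (intro nn_integral_cong) (auto simp: I_def space_mu indicator_def)
        then show ?thesis by simp
      qed
    qed
    also have "(\<Sum>w\<in>W n. if w \<in> I then 1 else 0) = (of_nat (card I) :: ennreal)"
      by (subst sum.inter_filter[symmetric]) (auto simp: I_def)
    also have "\<dots> = ennreal (real (card I))" by (simp add: ennreal_of_nat_eq_real_of_nat)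
    also have "ennreal (1 / real N ^ n) * ennreal (real (card I)) = ennreal (card I / real N ^ n)"
      by (simp add: ennreal_mult[symmetric])
    also have "\<dots> \<le> ennreal (C * d powr \<alpha>)"
    proof (rule ennreal_leI)
      have "1 / real N ^ n = (\<rho> ^ n) powr \<alpha>"
        by (simp add: rho_power_powr rho_powr_\<alpha> power_one_over)
      also have "\<dots> \<le> (2 / (c * \<rho>) * d) powr \<alpha>"
        using n(1) c rho_pos \<alpha>_pos by (intro powr_mono2) (auto simp: field_simps)
      also have "\<dots> = (2 / (c * \<rho>)) powr \<alpha> * d powr \<alpha>"
        by (rule powr_mult)
      finally have "card I * (1 / real N ^ n) \<le> M * ((2 / (c * \<rho>)) powr \<alpha> * d powr \<alpha>)"
        using \<open>card I \<le> M\<close> by (intro mult_mono) auto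
      then show "card I / real N ^ n \<le> C * d powr \<alpha>" by (simp add: C_def mult.assoc)
    qed
    finally show ?thesis by (simp add: A_def mult_left_mono)
  next
    case False
    have "c * \<rho> \<le> c" using c rho_less_1 by simp
    moreover have "c \<le> 2 * d" using False c by (simp add: field_simps)
    ultimately have "c * \<rho> \<le> 2 * d" by linarith
    then have "1 \<le> 2 / (c * \<rho>) * d" using c rho_pos by (simp add: field_simps)
    then have "1 \<le> (2 / (c * \<rho>) * d) powr \<alpha>" using \<alpha>_pos by (simp add: ge_one_powr_ge_zero)
    also have "\<dots> = (2 / (c * \<rho>)) powr \<alpha> * d powr \<alpha>"
      by (rule powr_mult)
    also have "\<dots> \<le> M * ((2 / (c * \<rho>)) powr \<alpha> * d powr \<alpha>)" using M mult_right_mono[of 1 "real M" "(2 / (c * \<rho>)) powr \<alpha> * d powr \<alpha>"] by simp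
    finally have "1 \<le> C * d powr \<alpha>" by (simp add: C_def mult.assoc)
    then have "ennreal 1 \<le> ennreal (C * d powr \<alpha>)" by (rule ennreal_leI)
    moreover have "emeasure \<mu> (cball x d \<inter> K) \<le> 1"
      by (rule emeasure_le_1)
    ultimately show ?thesis unfolding ennreal_1 by (rule order_trans[rotated])
  qed
  with C that show thesis by blast
qed

lemma emeasure_point: "x \<in> K \<Longrightarrow> emeasure \<mu> {x} = 0"
proof -
  assume x: "x \<in> K"
  obtain C where C: "0 < C" "\<And>x d. 0 < d \<Longrightarrow> emeasure \<mu> (cball x d \<inter> K) \<le> ennreal (C * d powr \<alpha>)"
    using emeasure_ball_le by metis
  have le: "emeasure \<mu> {x} \<le> ennreal (C * (\<rho> ^ n) powr \<alpha>)" for n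
  proof -
    have "emeasure \<mu> {x} \<le> emeasure \<mu> (cball x (\<rho> ^ n) \<inter> K)"
      using x rho_pos by (intro emeasure_mono in_sets_mu) auto
    also have "\<dots> \<le> ennreal (C * (\<rho> ^ n) powr \<alpha>)" using C rho_pos by auto
    finally show ?thesis .
  qed
  have "(\<lambda>n. C * (\<rho> ^ n) powr \<alpha>) \<longlonglongrightarrow> C * 0"
    unfolding rho_power_powr rho_powr_\<alpha> using N_ge_2
    by (intro tendsto_mult tendsto_const LIMSEQ_power_zero) auto
  then have "(\<lambda>n. ennreal (C * (\<rho> ^ n) powr \<alpha>)) \<longlonglongrightarrow> ennreal 0"
    by (intro tendsto_ennrealI) simp
  then have "emeasure \<mu> {x} \<le> ennreal 0" using le by (intro LIMSEQ_le_const) auto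
  then show ?thesis by simp
qed

lemma emeasure_finite_set: "finite A \<Longrightarrow> A \<subseteq> K \<Longrightarrow> emeasure \<mu> A = 0"
proof (induction rule: finite_induct)
  case (insert x A)
  have "emeasure \<mu> (insert x A) \<le> emeasure \<mu> {x} + emeasure \<mu> A"
    using insert emeasure_subadditive[of "{x}" \<mu> A]
    by (simp add: closed_in_sets_mu finite_imp_closed)
  then show ?case using insert emeasure_point by simp
qed simp

text \<open>
  The mass distribution principle: since balls of radius \<open>d\<close> have measure at most \<open>C d\<^sup>\<alpha>\<close>, a set of
  positive measure cannot be covered by sets whose diameters have small \<open>s\<close>-th powers in sum.
\<close>

lemma emeasure_0_if_hausdorff_0:
  assumes "closed A" "A \<subseteq> K" "s < \<alpha>" "hausdorff_measure s A = 0"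
  shows "emeasure \<mu> A = 0"
proof -
  obtain C where C: "0 < C" "\<And>x d. 0 < d \<Longrightarrow> emeasure \<mu> (cball x d \<inter> K) \<le> ennreal (C * d powr \<alpha>)"
    using emeasure_ball_le by metis
  have "hausdorff_content s 1 A \<le> hausdorff_measure s A"
    unfolding hausdorff_measure_def by (rule SUP_upper) simp
  then have 0: "hausdorff_content s 1 A = 0" using assms by simp
  have "ennreal (1 / C) * emeasure \<mu> A \<le> hausdorff_content s 1 A"
    unfolding hausdorff_content_def
  proof (rule INF_greatest, safe)
    fix U :: "nat \<Rightarrow> 'a set"
    assume cov: "A \<subseteq> (\<Union>i. U i)" and U: "\<forall>i. bounded (U i) \<and> diameter (U i) \<le> 1"
    define x where "x i = (SOME y. y \<in> U i)" for i
    define B where "B i = (if x i \<in> K \<or> 0 < diameter (U i) then cball (x i) (diameter (U i)) \<inter> K else {})" for i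
    have BU: "U i \<inter> K \<subseteq> B i" for i
    proof
      fix y assume y: "y \<in> U i \<inter> K"
      then have xi: "x i \<in> U i" unfolding x_def by (auto intro: someI)
      then have "dist (x i) y \<le> diameter (U i)" using U y diameter_bounded_bound by blast
      moreover from this y have "x i \<in> K \<or> 0 < diameter (U i)"
      proof (cases "x i = y")
        case False
        then have "0 < dist (x i) y" by simp
        with \<open>dist (x i) y \<le> diameter (U i)\<close> have "0 < diameter (U i)" by linarith
        then show ?thesis ..
      qed (use y in simp)
      ultimately show "y \<in> B i" using y by (auto simp: B_def)
    qed
    have Bs: "B i \<in> sets \<mu>" for i unfolding B_def by (auto intro: in_sets_mu)
    have Bm: "emeasure \<mu> (B i) \<le> ennreal C * ennreal (diameter (U i) powr s)" for i
    proof (cases "0 < diameter (U i)")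
      case True
      have "emeasure \<mu> (B i) \<le> ennreal (C * diameter (U i) powr \<alpha>)" using True C(2) by (simp add: B_def)
      also have "\<dots> \<le> ennreal (C * diameter (U i) powr s)"
        using C(1) U assms(3) True by (intro ennreal_leI mult_left_mono powr_mono') auto
      finally show ?thesis using C(1) by (simp add: ennreal_mult)
    next
      case False
      then have "diameter (U i) = 0" using U diameter_ge_0 by (metis linorder_not_less order_le_less)
      then have "B i \<subseteq> {x i} \<inter> K" by (auto simp: B_def split: if_splits)
      then have "emeasure \<mu> (B i) = 0" by (intro emeasure_finite_set) (auto intro: finite_subset)
      then show ?thesis by simp
    qed
    have "A \<subseteq> (\<Union>i. B i)"
    proof
      fix y assume "y \<in> A"
      then obtain i where "y \<in> U i \<inter> K" using cov assms(2) by auto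
      then show "y \<in> (\<Union>i. B i)" using BU[of i] by auto
    qed
    then have "emeasure \<mu> A \<le> emeasure \<mu> (\<Union>i. B i)"
      by (rule emeasure_mono) (use Bs in auto)
    also have "\<dots> \<le> (\<Sum>i. emeasure \<mu> (B i))"
      using Bs by (intro emeasure_subadditive_countably) auto
    also have "\<dots> \<le> (\<Sum>i. ennreal C * ennreal (diameter (U i) powr s))"
      using Bm by (intro suminf_le) auto
    also have "\<dots> = ennreal C * (\<Sum>i. ennreal (diameter (U i) powr s))" by simp
    finally have "ennreal (1 / C) * emeasure \<mu> A
        \<le> ennreal (1 / C) * (ennreal C * (\<Sum>i. ennreal (diameter (U i) powr s)))"
      by (rule mult_left_mono) simp
    also have "\<dots> = (\<Sum>i. ennreal (diameter (U i) powr s))"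
      using C(1) by (simp add: mult.assoc[symmetric] ennreal_mult[symmetric])
    finally show "ennreal (1 / C) * emeasure \<mu> A \<le> (\<Sum>i. ennreal (diameter (U i) powr s))" .
  qed
  with 0 C(1) show ?thesis by auto
qed

text \<open>
  The \<open>N\<^sup>n\<close> cells of level \<open>n\<close>, with diameters \<open>\<rho>\<^sup>n diam K\<close>, are the covering: \<open>N \<rho>\<^sup>s < 1\<close> for \<open>s > \<alpha>\<close>.
\<close>

lemma hausdorff_measure_K:
  assumes s: "\<alpha> < s" shows "hausdorff_measure s K = 0"
proof -
  define D where "D = diameter K"
  define x where "x n = D powr s * (real N * \<rho> powr s) ^ n" for n
  have "\<rho> powr s < \<rho> powr \<alpha>" using s rho_pos rho_less_1 by (simp add: powr_less_mono')
  then have "real N * \<rho> powr s < 1" using N_pos by (simp add: rho_powr_\<alpha> field_simps)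
  then have "(\<lambda>n. (real N * \<rho> powr s) ^ n) \<longlonglongrightarrow> 0"
    using N_pos by (intro LIMSEQ_power_zero) simp
  then have "x \<longlonglongrightarrow> 0" unfolding x_def by (rule tendsto_mult_right_zero)
  then have lim: "(\<lambda>n. ennreal (x n)) \<longlonglongrightarrow> ennreal 0" by (rule tendsto_ennrealI)
  have "hausdorff_content s \<delta> K = 0" if \<delta>: "0 < \<delta>" for \<delta> :: real
  proof -
    have "\<forall>\<^sub>F n in sequentially. \<rho> ^ n * D < \<delta>"
      using power_rho_tendsto_0[of D] \<delta> by (intro order_tendstoD) auto
    then have "\<forall>\<^sub>F n in sequentially. hausdorff_content s \<delta> K \<le> ennreal (x n)"
    proof eventually_elim
      case (elim n)
      obtain f where f: "bij_betw f {0..<card (W n)} (W n)"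
        using ex_bij_betw_nat_finite[OF finite_words] by blast
      define U where "U i = (if i < N ^ n then cell (f i) else {})" for i
      have fW: "f i \<in> W n" if "i < N ^ n" for i using f that by (auto simp: bij_betw_def card_words)
      have dU: "diameter (U i) \<le> \<rho> ^ n * D" for i
      proof (cases "i < N ^ n")
        case True
        then show ?thesis using dist_cell[OF fW[OF True]] K_nonempty
          by (auto simp: U_def D_def dist_norm intro!: diameter_le)
      next
        case False
        then show ?thesis using rho_pos diameter_K_nonneg by (simp add: U_def D_def)
      qed
      have bU: "bounded (U i)" for i
        using compact_cell[OF fW] by (auto simp: U_def intro: compact_imp_bounded)
      have cov: "K \<subseteq> (\<Union>i. U i)"
      proof
        fix y assume "y \<in> K"
        then obtain w where "w \<in> W n" "y \<in> cell w" using K_cells[of n] by blast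
        moreover from this obtain i where "i < N ^ n" "w = f i"
          using f unfolding bij_betw_def card_words by (metis atLeastLessThan_iff imageE)
        ultimately show "y \<in> (\<Union>i. U i)" by (auto simp: U_def)
      qed
      have "hausdorff_content s \<delta> K \<le> (\<Sum>i. ennreal (diameter (U i) powr s))"
        unfolding hausdorff_content_def
        using cov bU order_trans[OF dU less_imp_le[OF elim]] by (intro INF_lower) auto
      also have "\<dots> = (\<Sum>i<N ^ n. ennreal (diameter (U i) powr s))"
        by (intro suminf_finite) (auto simp: U_def)
      also have "\<dots> \<le> (\<Sum>i<N ^ n. ennreal ((\<rho> ^ n * D) powr s))"
        using dU bU s \<alpha>_pos by (intro sum_mono ennreal_leI powr_mono2) (auto intro: diameter_ge_0)
      also have "\<dots> = ennreal (N ^ n * (\<rho> ^ n * D) powr s)"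
        by (simp add: ennreal_mult ennreal_of_nat_eq_real_of_nat)
      also have "N ^ n * (\<rho> ^ n * D) powr s = x n"
        using rho_pos diameter_K_nonneg
        by (simp add: x_def D_def powr_mult rho_power_powr power_mult_distrib)
      finally show ?case .
    qed
    then have "hausdorff_content s \<delta> K \<le> ennreal 0"
      using lim by (intro tendsto_lowerbound[OF lim]) auto
    then show ?thesis by simp
  qed
  then show ?thesis unfolding hausdorff_measure_def by (auto intro!: antisym SUP_least)
qed

lemma hausdorff_measure_mono:
  assumes "A \<subseteq> B" shows "hausdorff_measure s A \<le> hausdorff_measure s B"
  unfolding hausdorff_measure_def hausdorff_content_def
  using assms by (intro SUP_mono' INF_superset_mono) auto

lemma hausdorff_dim_K_le: "hausdorff_dim K \<le> \<alpha>"
proof (rule dense_ge)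
  fix s assume "\<alpha> < s"
  then show "hausdorff_dim K \<le> s"
    unfolding hausdorff_dim_def using hausdorff_measure_K \<alpha>_pos
    by (intro cInf_lower bdd_belowI[of _ 0]) auto
qed

lemma emeasure_0_if_dim_less:
  assumes "closed A" "A \<subseteq> K" "hausdorff_dim A < hausdorff_dim K"
  shows "emeasure \<mu> A = 0"
proof -
  have "hausdorff_measure (\<alpha> + 1) A = 0"
    using hausdorff_measure_mono[OF assms(2), of "\<alpha> + 1"] hausdorff_measure_K[of "\<alpha> + 1"] by simp
  then have ne: "{s. 0 < s \<and> hausdorff_measure s A = 0} \<noteq> {}" using \<alpha>_pos by (auto intro!: exI[of _ "\<alpha> + 1"])
  have "Inf {s. 0 < s \<and> hausdorff_measure s A = 0} < \<alpha>"
    using assms(3) hausdorff_dim_K_le by (simp add: hausdorff_dim_def)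
  from cInf_lessD[OF ne this] obtain s where "s < \<alpha>" "hausdorff_measure s A = 0" by blast
  then show ?thesis by (rule emeasure_0_if_hausdorff_0[OF assms(1,2)])
qed

text \<open>
  The preimage of the copy under the map of any other word of the same length consists of vertices.
\<close>

lemma emeasure_\<Phi>_image_0:
  assumes A: "closed A" "A \<subseteq> K" "emeasure \<mu> A = 0" and w: "w \<in> W n"
  shows "emeasure \<mu> (\<Phi> w ` A) = 0"
proof -
  have "compact A" using A compact_K by (metis Int_absorb2 closed_Int_compact)
  then have "closed (\<Phi> w ` A)" by (intro compact_imp_closed compact_continuous_image continuous_\<Phi>[OF w])
  moreover have "\<Phi> w ` A \<subseteq> K" using A \<Phi>_in_K[OF w] by blast
  ultimately have B: "\<Phi> w ` A \<in> sets \<mu>" by (rule closed_in_sets_mu)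
  have "(\<integral>\<^sup>+x. indicator (\<Phi> w ` A) (\<Phi> v x) \<partial>\<mu>) = (0::ennreal)" if v: "v \<in> W n" for v
  proof -
    have "(\<integral>\<^sup>+x. indicator (\<Phi> w ` A) (\<Phi> v x) \<partial>\<mu>) \<le> (\<integral>\<^sup>+x. indicator (A \<union> V 0) x \<partial>\<mu>)"
    proof (rule nn_integral_mono)
      fix x assume "x \<in> space \<mu>"
      then have x: "x \<in> K" by (simp add: space_mu)
      have "x \<in> A \<union> V 0" if "\<Phi> v x \<in> \<Phi> w ` A"
      proof (cases "v = w")
        case True then show ?thesis using that \<Phi>_inj[OF w] by auto
      next
        case False
        from that obtain a where "a \<in> A" "\<Phi> v x = \<Phi> w a" by blast
        then show ?thesis using cells_meet_in_vertices[OF v w False x] A by blast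
      qed
      then show "indicator (\<Phi> w ` A) (\<Phi> v x) \<le> (indicator (A \<union> V 0) x :: ennreal)"
        by (auto simp: indicator_def)
    qed
    also have "\<dots> = emeasure \<mu> (A \<union> V 0)"
      using A closed_in_sets_mu finite_V0 V0_subset_K by (auto intro!: nn_integral_indicator sets.Un finite_imp_closed)
    also have "\<dots> \<le> emeasure \<mu> A + emeasure \<mu> (V 0)"
      using A closed_in_sets_mu finite_V0 V0_subset_K
      by (intro emeasure_subadditive) (auto intro: finite_imp_closed)
    also have "\<dots> = 0" using A emeasure_finite_set[OF finite_V0 V0_subset_K] by simp
    finally show ?thesis by simp
  qed
  then have "(\<integral>\<^sup>+x. indicator (\<Phi> w ` A) x \<partial>\<mu>) = 0"
    using B by (subst nn_integral_cells[of _ n]) auto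
  then show ?thesis using B by simp
qed

end

section \<open>Energies and traces\<close>

context pcf_ifs
begin

abbreviation e0 :: "('a \<Rightarrow> real) \<Rightarrow> real" where
  "e0 g \<equiv> (1/2) * (\<Sum>p\<in>V 0. \<Sum>q\<in>V 0 - {p}. \<bar>g p - g q\<bar>\<^sup>2)"

lemma energy_eq: "E n u = (\<Sum>w\<in>W n. e0 (\<lambda>x. u (\<Phi> w x)))"
  unfolding energy_def Let_def
proof (rule sum.cong[OF refl])
  fix w assume w: "w \<in> W n"
  have "\<Phi> w ` V 0 - {\<Phi> w p} = \<Phi> w ` (V 0 - {p})" for p
    using \<Phi>_inj[OF w] by auto
  then have "(\<Sum>x\<in>\<Phi> w ` V 0. \<Sum>y\<in>\<Phi> w ` V 0 - {x}. \<bar>u x - u y\<bar>\<^sup>2)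
      = (\<Sum>p\<in>V 0. \<Sum>q\<in>V 0 - {p}. \<bar>u (\<Phi> w p) - u (\<Phi> w q)\<bar>\<^sup>2)"
    by (simp add: sum.reindex[OF inj_\<Phi>[OF w]])
  then show "(1/2) * (\<Sum>x\<in>\<Phi> w ` V 0. \<Sum>y\<in>\<Phi> w ` V 0 - {x}. \<bar>u x - u y\<bar>\<^sup>2)
      = e0 (\<lambda>x. u (\<Phi> w x))" by simp
qed

lemma energy_0: "E 0 u = e0 u"
  by (simp add: energy_eq)

lemma energy_split: "E (n + k) u = (\<Sum>w\<in>W n. E k (\<lambda>x. u (\<Phi> w x)))"
  by (simp add: energy_eq sum_words_add)

lemma energy_nonneg: "0 \<le> E n u"
  unfolding energy_eq by (intro sum_nonneg mult_nonneg_nonneg) (auto intro!: sum_nonneg)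

lemma energy_subcell_le: "w \<in> W n \<Longrightarrow> E k (\<lambda>x. u (\<Phi> w x)) \<le> E (n + k) u"
  unfolding energy_split by (rule member_le_sum) (auto intro: energy_nonneg)

lemma energy_cong: "(\<And>x. x \<in> V n \<Longrightarrow> u x = v x) \<Longrightarrow> E n u = E n v"
  unfolding energy_eq using \<Phi>_in_V[of _ n _ 0]
  by (intro sum.cong refl arg_cong[where f = "\<lambda>t. (1/2) * t"]) simp

lemma energy_mono:
  assumes "\<And>x y. \<bar>u x - u y\<bar> \<le> \<bar>v x - v y\<bar>" shows "E n u \<le> E n v"
  unfolding energy_eq using assms by (intro sum_mono mult_left_mono power_mono) auto

lemma two_summands_le_double_sum:
  fixes f :: "'b \<Rightarrow> 'b \<Rightarrow> real"
  assumes "finite A" "p \<in> A" "q \<in> A" "p \<noteq> q" and nn: "\<And>x y. 0 \<le> f x y"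
  shows "f p q + f q p \<le> (\<Sum>x\<in>A. \<Sum>y\<in>A - {x}. f x y)"
proof -
  have le: "f x y \<le> (\<Sum>y\<in>A - {x}. f x y)" if "y \<in> A - {x}" for x y
    using assms(1) nn that by (intro member_le_sum) auto
  have "f p q + f q p \<le> (\<Sum>x\<in>{p, q}. \<Sum>y\<in>A - {x}. f x y)"
    using le[of q p] le[of p q] assms by simp
  also have "\<dots> \<le> (\<Sum>x\<in>A. \<Sum>y\<in>A - {x}. f x y)"
    using assms by (intro sum_mono2) (auto intro: sum_nonneg)
  finally show ?thesis .
qed

lemma edge_le_energy: "p \<in> V 0 \<Longrightarrow> q \<in> V 0 \<Longrightarrow> (g p - g q)\<^sup>2 \<le> E 0 g"
proof (cases "p = q")
  case False
  assume "p \<in> V 0" "q \<in> V 0"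
  from two_summands_le_double_sum[OF finite_V0 this False, of "\<lambda>x y. \<bar>g x - g y\<bar>\<^sup>2"]
  show ?thesis unfolding energy_0 by (simp add: power2_commute[of "g q"])
qed (simp add: energy_nonneg)

text \<open>
  Vertex values will be compared with one value per cell, the mean over this cell, instead of with
  each other.
\<close>

lemma energy_0_le_deviation:
  fixes g :: "'a \<Rightarrow> real"
  shows "E 0 g \<le> 2 * real (card (V 0)) * (\<Sum>p\<in>V 0. (g p - c)\<^sup>2)"
proof -
  have "(\<Sum>p\<in>V 0. \<Sum>q\<in>V 0 - {p}. \<bar>g p - g q\<bar>\<^sup>2)
      \<le> (\<Sum>p\<in>V 0. \<Sum>q\<in>V 0. 2 * (g p - c)\<^sup>2 + 2 * (g q - c)\<^sup>2)"
  proof (intro sum_mono)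
    fix p
    have "(\<Sum>q\<in>V 0 - {p}. \<bar>g p - g q\<bar>\<^sup>2) \<le> (\<Sum>q\<in>V 0. \<bar>g p - g q\<bar>\<^sup>2)"
      by (intro sum_mono2 finite_V0) auto
    also have "\<dots> \<le> (\<Sum>q\<in>V 0. 2 * (g p - c)\<^sup>2 + 2 * (g q - c)\<^sup>2)"
    proof (rule sum_mono)
      fix q
      show "\<bar>g p - g q\<bar>\<^sup>2 \<le> 2 * (g p - c)\<^sup>2 + 2 * (g q - c)\<^sup>2"
        using sq_add_le[of "g p - c" "c - g q"] by (simp add: power2_commute[of c])
    qed
    finally show "(\<Sum>q\<in>V 0 - {p}. \<bar>g p - g q\<bar>\<^sup>2) \<le> (\<Sum>q\<in>V 0. 2 * (g p - c)\<^sup>2 + 2 * (g q - c)\<^sup>2)" .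
  qed
  also have "\<dots> = 4 * real (card (V 0)) * (\<Sum>p\<in>V 0. (g p - c)\<^sup>2)"
    by (simp add: sum.distrib sum_distrib_left[symmetric] algebra_simps)
  finally show ?thesis unfolding energy_0 by simp
qed

lemma trace_le:
  assumes tr: "is_trace N F K n r" and pq: "p \<in> V 0" "q \<in> V 0" "p \<noteq> q"
  shows "(v p - v q)\<^sup>2 \<le> r p q * E n v"
proof -
  have pos: "\<And>p q. p \<in> V 0 \<Longrightarrow> q \<in> V 0 \<Longrightarrow> p \<noteq> q \<Longrightarrow> 0 < r p q \<and> r p q = r q p"
    and min: "is_minimum {energy N F K n w | w. \<forall>x\<in>V 0. w x = v x}
              ((1/2) * (\<Sum>p\<in>V 0. \<Sum>q\<in>V 0 - {p}. 1 / r p q * \<bar>v p - v q\<bar>\<^sup>2))"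
    using tr unfolding is_trace_def Let_def by auto
  define f where "f x y = (if x \<in> V 0 \<and> y \<in> V 0 \<and> x \<noteq> y then 1 / r x y * \<bar>v x - v y\<bar>\<^sup>2 else 0)" for x y
  have "0 \<le> f x y" for x y using pos[of x y] by (auto simp: f_def)
  from two_summands_le_double_sum[of "V 0" p q f, OF finite_V0 pq this]
  have "f p q + f q p \<le> (\<Sum>p\<in>V 0. \<Sum>q\<in>V 0 - {p}. 1 / r p q * \<bar>v p - v q\<bar>\<^sup>2)"
  proof -
    have "(\<Sum>x\<in>V 0. \<Sum>y\<in>V 0 - {x}. f x y) = (\<Sum>p\<in>V 0. \<Sum>q\<in>V 0 - {p}. 1 / r p q * \<bar>v p - v q\<bar>\<^sup>2)"
      by (intro sum.cong refl) (auto simp: f_def)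
    with \<open>f p q + f q p \<le> (\<Sum>x\<in>V 0. \<Sum>y\<in>V 0 - {x}. f x y)\<close> show ?thesis by simp
  qed
  also have "\<dots> \<le> 2 * E n v"
    using min unfolding is_minimum_def by force
  also have "f p q + f q p = 2 * ((v p - v q)\<^sup>2 / r p q)"
    using pq pos[OF pq] by (simp add: f_def power2_commute)
  finally show ?thesis using pos[OF pq] by (simp add: field_simps)
qed

text \<open>
  The trace gives \<open>\<bar>g\<^sub>k(p) - g\<^sub>k(q)\<bar>\<^sup>2 \<le> R\<^sub>k(p,q) E\<^sub>k[g\<^sub>k]\<close> for every pair, which tends to zero along
  pairs of rate at most \<open>Rs\<close>: the ratio \<open>\<theta> < 1 / Rs\<close> leaves room for the error \<open>\<epsilon>\<close> in the growth
  rate. Chains of such pairs join any two boundary points.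
\<close>

lemma trace_differences_vanish:
  fixes Rs :: real
  assumes tr: "\<And>n. is_trace N F K n (Rn n)"
    and gr: "\<And>p q. p \<in> V 0 \<Longrightarrow> q \<in> V 0 \<Longrightarrow> p \<noteq> q \<Longrightarrow> has_growth_rate (\<lambda>n. Rn n p q) (R p q)"
    and chain: "\<And>p q. p \<in> V 0 \<Longrightarrow> q \<in> V 0 \<Longrightarrow> p \<noteq> q \<Longrightarrow>
      \<exists>xs. xs \<noteq> [] \<and> hd xs = p \<and> last xs = q \<and> set xs \<subseteq> V 0 \<and>
        (\<forall>i. Suc i < length xs \<longrightarrow> xs ! i \<noteq> xs ! Suc i \<and> R (xs ! i) (xs ! Suc i) \<le> Rs)"
    and Rs: "1 < Rs" and lam: "0 < \<theta>" "Rs * \<theta> < 1" and C: "0 \<le> C"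
    and g: "\<And>k. E k (g k) \<le> C * \<theta> ^ k" and pq: "p \<in> V 0" "q \<in> V 0"
  shows "(\<lambda>k. g k p - g k q) \<longlonglongrightarrow> 0"
proof -
  \<comment> \<open>With this choice the ratio \<open>Rs powr (1 + \<epsilon>) * \<theta>\<close> is the square root of \<open>Rs * \<theta>\<close>.\<close>
  define \<epsilon> where "\<epsilon> = - ln (Rs * \<theta>) / (2 * ln Rs)"
  have lnRs: "0 < ln Rs" using Rs by simp
  have "ln (Rs * \<theta>) < 0" using lam Rs by simp
  then have \<epsilon>: "0 < \<epsilon>" using lnRs by (simp add: \<epsilon>_def divide_neg_pos)
  define \<kappa> where "\<kappa> = Rs powr (1 + \<epsilon>) * \<theta>"
  have "Rs powr (1 + \<epsilon>) * \<theta> = exp (\<epsilon> * ln Rs) * (Rs * \<theta>)"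
    unfolding powr_add using Rs by (simp add: powr_def[of Rs \<epsilon>])
  also have "\<dots> = exp (\<epsilon> * ln Rs + ln (Rs * \<theta>))" using Rs lam by (simp add: exp_add)
  also have "\<epsilon> * ln Rs = - ln (Rs * \<theta>) / 2" using lnRs by (simp add: \<epsilon>_def)
  also have "exp (- ln (Rs * \<theta>) / 2 + ln (Rs * \<theta>)) < 1" using \<open>ln (Rs * \<theta>) < 0\<close> by simp
  finally have \<kappa>: "0 < \<kappa>" "\<kappa> < 1" using lam Rs by (simp_all add: \<kappa>_def)
  have edge: "(\<lambda>k. g k p - g k q) \<longlonglongrightarrow> 0"
    if pq: "p \<in> V 0" "q \<in> V 0" "p \<noteq> q" and R: "R p q \<le> Rs" for p q
  proof -
    have R1: "1 < R p q" using gr[OF pq] by (simp add: has_growth_rate_def)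
    obtain n0 where n0: "\<And>n. n \<ge> n0 \<Longrightarrow> Rn n p q \<le> R p q powr ((1 + \<epsilon>) * real n)"
      using gr[OF pq] \<epsilon> unfolding has_growth_rate_def by blast
    have "\<forall>\<^sub>F k in sequentially. (g k p - g k q)\<^sup>2 \<le> C * \<kappa> ^ k"
      using eventually_ge_at_top[of n0]
    proof eventually_elim
      case (elim k)
      have rpos: "0 < Rn k p q" using gr[OF pq] by (simp add: has_growth_rate_def)
      have "(g k p - g k q)\<^sup>2 \<le> Rn k p q * E k (g k)" by (rule trace_le[OF tr pq])
      also have "\<dots> \<le> R p q powr ((1 + \<epsilon>) * real k) * (C * \<theta> ^ k)"
        using n0[OF elim] g energy_nonneg C lam rpos by (intro mult_mono) auto
      also have "\<dots> \<le> Rs powr ((1 + \<epsilon>) * real k) * (C * \<theta> ^ k)"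
        using R R1 \<epsilon> C lam by (intro mult_right_mono powr_mono2) auto
      also have "Rs powr ((1 + \<epsilon>) * real k) = (Rs powr (1 + \<epsilon>)) ^ k"
        using Rs by (simp add: powr_powr[symmetric] powr_realpow)
      finally show ?case by (simp add: \<kappa>_def power_mult_distrib mult_ac)
    qed
    moreover have "(\<lambda>k. C * \<kappa> ^ k) \<longlonglongrightarrow> 0"
      using \<kappa> by (intro tendsto_mult_right_zero LIMSEQ_power_zero) auto
    ultimately have "(\<lambda>k. (g k p - g k q)\<^sup>2) \<longlonglongrightarrow> 0"
      by (intro tendsto_sandwich[of "\<lambda>_. 0" "\<lambda>k. (g k p - g k q)\<^sup>2" sequentially "\<lambda>k. C * \<kappa> ^ k"]) auto
    then have "(\<lambda>k. sqrt ((g k p - g k q)\<^sup>2)) \<longlonglongrightarrow> sqrt 0" by (rule tendsto_real_sqrt)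
    then show ?thesis by (simp add: tendsto_rabs_zero_iff)
  qed
  show ?thesis
  proof (cases "p = q")
    case False
    from chain[OF pq False] obtain xs where xs: "xs \<noteq> []" "hd xs = p" "last xs = q" "set xs \<subseteq> V 0"
      "\<And>i. Suc i < length xs \<Longrightarrow> xs ! i \<noteq> xs ! Suc i \<and> R (xs ! i) (xs ! Suc i) \<le> Rs" by blast
    have "(\<lambda>k. g k p - g k (xs ! i)) \<longlonglongrightarrow> 0" if "i < length xs" for i
      using that
    proof (induction i)
      case 0 then show ?case using xs(1,2) by (simp add: hd_conv_nth)
    next
      case (Suc i)
      then have "(\<lambda>k. g k (xs ! i) - g k (xs ! Suc i)) \<longlonglongrightarrow> 0"
        using xs(4) xs(5)[OF Suc.prems] by (intro edge) auto
      from tendsto_add[OF _ this] Suc show ?case by force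
    qed
    from this[of "length xs - 1"] show ?thesis using xs(1,3) by (simp add: last_conv_nth)
  qed simp
qed

end

section \<open>Large exponents leave only constants\<close>

context pcf_ifs_measure
begin

text \<open>The double integral in the Besov seminorm, without its weight in \<open>r\<close>.\<close>

definition osc_int :: "('a \<Rightarrow> real) \<Rightarrow> real \<Rightarrow> ennreal" where
  "osc_int u r = (\<integral>\<^sup>+x. (\<integral>\<^sup>+y\<in>ball x r. ennreal (\<bar>u x - u y\<bar>\<^sup>2) \<partial>\<mu>) \<partial>\<mu>)"

lemma measurable_id_mu: "(\<lambda>x. x) \<in> borel_measurable \<mu>"
  by (intro continuous_on_borel_mu continuous_on_id)

lemma measurable_osc_integrand:
  assumes [measurable]: "u \<in> borel_measurable \<mu>"
  shows "(\<lambda>(x, y). ennreal (\<bar>u x - u y\<bar>\<^sup>2) * indicator (ball x r) y) \<in> borel_measurable (\<mu> \<Otimes>\<^sub>M \<mu>)"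
proof -
  note [measurable] = measurable_id_mu
  have "(\<lambda>(x, y). ennreal (\<bar>u x - u y\<bar>\<^sup>2) * indicator {..<r} (dist x y)) \<in> borel_measurable (\<mu> \<Otimes>\<^sub>M \<mu>)"
    by measurable
  moreover have "indicator (ball x r) y = (indicator {..<r} (dist x y) :: ennreal)" for x y :: 'a
    by (auto simp: indicator_def)
  ultimately show ?thesis by simp
qed

lemma osc_int_cells:
  assumes u[measurable]: "u \<in> borel_measurable \<mu>"
  shows "ennreal (real N ^ n * real N ^ k) * osc_int u r =
    (\<Sum>v\<in>W n. \<Sum>w\<in>W k. \<integral>\<^sup>+s. \<integral>\<^sup>+t. ennreal ((u (\<Phi> v s) - u (\<Phi> w t))\<^sup>2)
        * indicator (ball (\<Phi> v s) r) (\<Phi> w t) \<partial>\<mu> \<partial>\<mu>)"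
proof -
  define g where "g = (\<lambda>x y. ennreal (\<bar>u x - u y\<bar>\<^sup>2) * indicator (ball x r) y)"
  have g[measurable]: "(\<lambda>(x, y). g x y) \<in> borel_measurable (\<mu> \<Otimes>\<^sub>M \<mu>)"
    unfolding g_def by (rule measurable_osc_integrand[OF u])
  have gx: "g x \<in> borel_measurable \<mu>" if "x \<in> K" for x
    using g that by (simp add: space_mu measurable_Pair2[OF g, of x, simplified])
  have gw: "(\<lambda>(x, t). g x (\<Phi> w t)) \<in> borel_measurable (\<mu> \<Otimes>\<^sub>M \<mu>)" if w: "w \<in> W k" for w
  proof -
    have [measurable]: "\<Phi> w \<in> \<mu> \<rightarrow>\<^sub>M \<mu>" by (rule measurable_\<Phi>[OF w])
    have "(\<lambda>z. (fst z, \<Phi> w (snd z))) \<in> \<mu> \<Otimes>\<^sub>M \<mu> \<rightarrow>\<^sub>M \<mu> \<Otimes>\<^sub>M \<mu>" by measurable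
    from measurable_compose[OF this g] show ?thesis by (simp add: case_prod_beta)
  qed
  have G: "(\<lambda>x. \<integral>\<^sup>+y. g x y \<partial>\<mu>) \<in> borel_measurable \<mu>" by measurable
  have Gw: "(\<lambda>x. \<integral>\<^sup>+t. g x (\<Phi> w t) \<partial>\<mu>) \<in> borel_measurable \<mu>" if w: "w \<in> W k" for w
    using gw[OF w] by measurable
  have "osc_int u r = (\<integral>\<^sup>+x. \<integral>\<^sup>+y. g x y \<partial>\<mu> \<partial>\<mu>)" by (simp add: osc_int_def g_def)
  then have "ennreal (real N ^ n * real N ^ k) * osc_int u r
      = ennreal (real N ^ k) * (\<Sum>v\<in>W n. \<integral>\<^sup>+s. \<integral>\<^sup>+y. g (\<Phi> v s) y \<partial>\<mu> \<partial>\<mu>)"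
    unfolding sum_cells[OF G] by (simp add: ennreal_mult mult_ac)
  also have "\<dots> = (\<Sum>v\<in>W n. \<Sum>w\<in>W k. \<integral>\<^sup>+s. \<integral>\<^sup>+t. g (\<Phi> v s) (\<Phi> w t) \<partial>\<mu> \<partial>\<mu>)"
    unfolding sum_distrib_left
  proof (rule sum.cong[OF refl])
    fix v assume v: "v \<in> W n"
    have [measurable]: "\<Phi> v \<in> \<mu> \<rightarrow>\<^sub>M \<mu>" by (rule measurable_\<Phi>[OF v])
    have "ennreal (real N ^ k) * (\<integral>\<^sup>+s. \<integral>\<^sup>+y. g (\<Phi> v s) y \<partial>\<mu> \<partial>\<mu>)
        = (\<integral>\<^sup>+s. ennreal (real N ^ k) * (\<integral>\<^sup>+y. g (\<Phi> v s) y \<partial>\<mu>) \<partial>\<mu>)"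
      by (intro nn_integral_cmult[symmetric] measurable_compose[OF measurable_\<Phi>[OF v] G])
    also have "\<dots> = (\<integral>\<^sup>+s. (\<Sum>w\<in>W k. \<integral>\<^sup>+t. g (\<Phi> v s) (\<Phi> w t) \<partial>\<mu>) \<partial>\<mu>)"
      using \<Phi>_in_K[OF v] gx by (intro nn_integral_cong sum_cells[symmetric]) (auto simp: space_mu)
    also have "\<dots> = (\<Sum>w\<in>W k. \<integral>\<^sup>+s. \<integral>\<^sup>+t. g (\<Phi> v s) (\<Phi> w t) \<partial>\<mu> \<partial>\<mu>)"
      by (intro nn_integral_sum measurable_compose[OF measurable_\<Phi>[OF v] Gw])
    finally show "ennreal (real N ^ k) * (\<integral>\<^sup>+s. \<integral>\<^sup>+y. g (\<Phi> v s) y \<partial>\<mu> \<partial>\<mu>)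
        = (\<Sum>w\<in>W k. \<integral>\<^sup>+s. \<integral>\<^sup>+t. g (\<Phi> v s) (\<Phi> w t) \<partial>\<mu> \<partial>\<mu>)" .
  qed
  finally show ?thesis by (simp add: g_def)
qed

abbreviation pair_diff :: "('a \<Rightarrow> real) \<Rightarrow> nat list \<Rightarrow> nat list \<Rightarrow> ennreal" where
  "pair_diff u v w \<equiv> (\<integral>\<^sup>+s. \<integral>\<^sup>+t. ennreal ((u (\<Phi> v s) - u (\<Phi> w t))\<^sup>2) \<partial>\<mu> \<partial>\<mu>)"

text \<open>
  Pairs of cells that lie within distance \<open>r\<close> of each other contribute their full double integral.
\<close>

lemma osc_int_ge_pairs:
  assumes u: "u \<in> borel_measurable \<mu>" and P: "P \<subseteq> W n \<times> W k"
    and near: "\<And>v w s t. (v, w) \<in> P \<Longrightarrow> s \<in> K \<Longrightarrow> t \<in> K \<Longrightarrow> dist (\<Phi> v s) (\<Phi> w t) < r"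
  shows "(\<Sum>(v, w)\<in>P. pair_diff u v w)
    \<le> ennreal (real N ^ n * real N ^ k) * osc_int u r"
proof -
  define I where "I v w = (\<integral>\<^sup>+s. \<integral>\<^sup>+t. ennreal ((u (\<Phi> v s) - u (\<Phi> w t))\<^sup>2)
        * indicator (ball (\<Phi> v s) r) (\<Phi> w t) \<partial>\<mu> \<partial>\<mu>)" for v w
  have "(\<Sum>(v, w)\<in>P. pair_diff u v w) = (\<Sum>(v, w)\<in>P. I v w)"
    unfolding I_def using near
    by (intro sum.cong refl) (auto simp: space_mu indicator_def intro!: nn_integral_cong)
  also have "\<dots> \<le> (\<Sum>(v, w)\<in>W n \<times> W k. I v w)"
    using P by (intro sum_mono2) auto
  also have "\<dots> = ennreal (real N ^ n * real N ^ k) * osc_int u r"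
    unfolding osc_int_cells[OF u] I_def by (simp add: sum.cartesian_product)
  finally show ?thesis .
qed

text \<open>
  The seminorm controls the radii below 1. For larger radii the double integral is at most
  \<open>4 \<integral> u\<^sup>2\<close> while the power of \<open>r\<close> is at least 1, so a larger constant serves all radii, and hence
  all levels, including those whose cells are large.
\<close>

lemma osc_int_bound:
  assumes u: "u \<in> besov \<alpha> \<mu> \<sigma>" and \<sigma>: "0 < \<sigma>"
  obtains A where "0 \<le> A" "\<And>r. 0 < r \<Longrightarrow> osc_int u r \<le> ennreal (A * r powr (\<alpha> + 2 * \<sigma>))"
proof -
  have L2: "u \<in> L2 \<mu>" and semi: "besov_seminorm_sq \<alpha> \<mu> \<sigma> u < \<infinity>" using u by (auto simp: besov_def)
  then have m[measurable]: "u \<in> borel_measurable \<mu>" by (simp add: L2_def)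
  obtain A1 where A1: "0 \<le> A1" "besov_seminorm_sq \<alpha> \<mu> \<sigma> u = ennreal A1"
    using semi by (auto simp: less_top_ennreal)
  have fin: "(\<integral>\<^sup>+x. ennreal ((u x)\<^sup>2) \<partial>\<mu>) < \<infinity>"
    using L2 unfolding L2_def by (auto simp: integrable_iff_bounded)
  then obtain A2 where A2: "0 \<le> A2" "(\<integral>\<^sup>+x. ennreal ((u x)\<^sup>2) \<partial>\<mu>) = ennreal A2"
    by (auto simp: less_top_ennreal)
  have small: "osc_int u r \<le> ennreal (A1 * r powr (\<alpha> + 2 * \<sigma>))" if r: "0 < r" "r < 1" for r
  proof -
    have "ennreal (r powr (- \<alpha> - 2 * \<sigma>)) * osc_int u r \<le> ennreal A1"
      unfolding A1(2)[symmetric] besov_seminorm_sq_def osc_int_def using r by (intro SUP_upper) auto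
    then have "ennreal (r powr (\<alpha> + 2 * \<sigma>)) * (ennreal (r powr (- \<alpha> - 2 * \<sigma>)) * osc_int u r)
        \<le> ennreal (r powr (\<alpha> + 2 * \<sigma>)) * ennreal A1"
      by (rule mult_left_mono) simp
    moreover have one: "r powr (\<alpha> + 2 * \<sigma>) * r powr (- \<alpha> - 2 * \<sigma>) = 1"
      using r by (simp add: powr_add[symmetric])
    from one have "ennreal (r powr (\<alpha> + 2 * \<sigma>)) * (ennreal (r powr (- \<alpha> - 2 * \<sigma>)) * osc_int u r) = osc_int u r"
      by (simp add: mult.assoc[symmetric] ennreal_mult[symmetric])
    moreover have "ennreal (r powr (\<alpha> + 2 * \<sigma>)) * ennreal A1 = ennreal (A1 * r powr (\<alpha> + 2 * \<sigma>))"
      using A1(1) by (subst mult.commute) (simp add: ennreal_mult)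
    ultimately show ?thesis by simp
  qed
  have "osc_int u r \<le> ennreal (4 * A2)" for r
  proof -
    have "osc_int u r \<le> (\<integral>\<^sup>+x. \<integral>\<^sup>+y. ennreal (2 * (u x)\<^sup>2) + ennreal (2 * (u y)\<^sup>2) \<partial>\<mu> \<partial>\<mu>)"
      unfolding osc_int_def
    proof (intro nn_integral_mono)
      fix x y
      have "\<bar>u x - u y\<bar>\<^sup>2 \<le> 2 * (u x)\<^sup>2 + 2 * (u y)\<^sup>2" using sq_add_le[of "u x" "- u y"] by simp
      then have "ennreal (\<bar>u x - u y\<bar>\<^sup>2) \<le> ennreal (2 * (u x)\<^sup>2) + ennreal (2 * (u y)\<^sup>2)"
        by (simp add: ennreal_plus[symmetric] del: ennreal_plus)
      then show "ennreal (\<bar>u x - u y\<bar>\<^sup>2) * indicator (ball x r) y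
          \<le> ennreal (2 * (u x)\<^sup>2) + ennreal (2 * (u y)\<^sup>2)"
        by (auto simp: indicator_def)
    qed
    also have "\<dots> = ennreal 2 * ennreal A2 + ennreal 2 * ennreal A2"
      by (simp add: nn_integral_add nn_integral_cmult ennreal_mult emeasure_space_1 A2(2))
    also have "ennreal 2 * ennreal A2 = ennreal (2 * A2)"
      by (rule ennreal_mult[symmetric]) (use A2(1) in auto)
    also have "ennreal (2 * A2) + ennreal (2 * A2) = ennreal (4 * A2)"
      using A2(1) by (subst ennreal_plus[symmetric]) auto
    finally show ?thesis .
  qed
  note large = this
  define A where "A = max A1 (4 * A2)"
  have "osc_int u r \<le> ennreal (A * r powr (\<alpha> + 2 * \<sigma>))" if r: "0 < r" for r
  proof (cases "r < 1")
    case True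
    have "A1 * r powr (\<alpha> + 2 * \<sigma>) \<le> A * r powr (\<alpha> + 2 * \<sigma>)" by (intro mult_right_mono) (auto simp: A_def)
    then show ?thesis using small[OF r True] by (meson ennreal_leI order_trans)
  next
    case False
    then have "1 \<le> r powr (\<alpha> + 2 * \<sigma>)" using \<sigma> \<alpha>_pos by (simp add: ge_one_powr_ge_zero)
    then have "4 * A2 * 1 \<le> A * r powr (\<alpha> + 2 * \<sigma>)" using A1 A2 by (intro mult_mono) (auto simp: A_def)
    then show ?thesis using large[of r] by (metis mult_1_right ennreal_leI order_trans)
  qed
  moreover have "0 \<le> A" using A1 by (simp add: A_def)
  ultimately show thesis using that by blast
qed

text \<open>
  The mean is taken in one variable after the other; each step is \<open>sq_integral_diff_le\<close>.
\<close>

lemma mean_diff_le: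
  assumes u: "u \<in> L2 \<mu>" and v: "v \<in> W n" and w: "w \<in> W k"
  shows "ennreal (((\<integral>s. u (\<Phi> v s) \<partial>\<mu>) - (\<integral>t. u (\<Phi> w t) \<partial>\<mu>))\<^sup>2)
    \<le> pair_diff u v w"
proof -
  note uv = L2_\<Phi>[OF u v] and uw = L2_\<Phi>[OF u w]
  have "ennreal (((\<integral>s. u (\<Phi> v s) \<partial>\<mu>) - (\<integral>t. u (\<Phi> w t) \<partial>\<mu>))\<^sup>2)
      \<le> (\<integral>\<^sup>+s. ennreal ((u (\<Phi> v s) - (\<integral>t. u (\<Phi> w t) \<partial>\<mu>))\<^sup>2) \<partial>\<mu>)"
    using uv L2_integrable[OF uv] by (intro sq_integral_diff_le) (auto simp: L2_def)
  also have "\<dots> \<le> pair_diff u v w"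
  proof (rule nn_integral_mono)
    fix s
    have "ennreal (((\<integral>t. u (\<Phi> w t) \<partial>\<mu>) - u (\<Phi> v s))\<^sup>2) \<le> (\<integral>\<^sup>+t. ennreal ((u (\<Phi> w t) - u (\<Phi> v s))\<^sup>2) \<partial>\<mu>)"
      using uw L2_integrable[OF uw] by (intro sq_integral_diff_le) (auto simp: L2_def)
    then show "ennreal ((u (\<Phi> v s) - (\<integral>t. u (\<Phi> w t) \<partial>\<mu>))\<^sup>2) \<le> (\<integral>\<^sup>+t. ennreal ((u (\<Phi> v s) - u (\<Phi> w t))\<^sup>2) \<partial>\<mu>)"
      by (simp add: power2_commute)
  qed
  finally show ?thesis .
qed

text \<open>
  Fixing one address per point makes the cells \<open>pre n x\<close> that represent a point decrease with \<open>n\<close>,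
  even at vertices, which may have several addresses.
\<close>

definition addr :: "'a \<Rightarrow> nat \<Rightarrow> nat" where
  "addr x = (SOME w. w \<in> inf_words N \<and> code w = x)"

definition pre :: "nat \<Rightarrow> 'a \<Rightarrow> nat list" where
  "pre n x = map (addr x) [0..<n]"

lemma addr: assumes "x \<in> K" shows "addr x \<in> inf_words N \<and> code (addr x) = x"
proof -
  have "\<exists>w. w \<in> inf_words N \<and> code w = x" using address_exists[OF assms] by blast
  then show ?thesis unfolding addr_def by (rule someI_ex)
qed

lemma pre_in_W: "x \<in> K \<Longrightarrow> pre n x \<in> W n"
  unfolding pre_def using addr[of x] by (intro prefix_word) simp

lemma in_cell_pre: "x \<in> K \<Longrightarrow> x \<in> cell (pre n x)"
  unfolding pre_def using addr[of x] code_in_cell[of "addr x" n] by auto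

lemma pre_Suc: "pre (Suc n) x = pre n x @ [addr x n]"
  by (simp add: pre_def)

text \<open>
  Write \<open>a v\<close> for the mean of \<open>u\<close> over the cell of \<open>v\<close> and \<open>\<theta> = \<rho>\<^bsup>2\<sigma> - \<alpha>\<^esup>\<close>. The squared differences of
  the means over meeting cells of level \<open>n\<close> sum to at most \<open>B \<theta>\<^sup>n\<close>, and so do the mean square deviations
  inside the cells. The first sum bounds the energy of the vertex function \<open>f n\<close>; by hypothesis the
  differences of \<open>f n\<close> over each fixed cell then vanish in the limit, hence over any two vertices by
  connectedness. The mean over a cell of level \<open>n\<close> is within a multiple of \<open>\<theta>\<^bsup>n/2\<^esup>\<close> of the limit of \<open>f\<close> at its
  vertices, by telescoping, so any two means of level \<open>n\<close> are that close, and the variance of \<open>u\<close> is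
  at most a multiple of \<open>\<theta>\<^sup>n\<close> for every \<open>n\<close>.
\<close>

lemma besov_imp_constant:
  assumes u: "u \<in> besov \<alpha> \<mu> \<sigma>" and \<sigma>: "0 < \<sigma>" and less_1: "\<rho> powr (2 * \<sigma> - \<alpha>) < 1"
    and decay: "\<And>g C p q. 0 \<le> C \<Longrightarrow> (\<And>k. E k (g k) \<le> C * (\<rho> powr (2 * \<sigma> - \<alpha>)) ^ k) \<Longrightarrow>
      p \<in> V 0 \<Longrightarrow> q \<in> V 0 \<Longrightarrow> (\<lambda>k. g k p - g k q) \<longlonglongrightarrow> 0"
  shows "\<exists>c. AE x in \<mu>. u x = c"
proof -
  define \<theta> where "\<theta> = \<rho> powr (2 * \<sigma> - \<alpha>)"
  have \<theta>: "0 < \<theta>" "\<theta> < 1" using rho_pos less_1 by (simp_all add: \<theta>_def)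
  define \<kappa> where "\<kappa> = sqrt \<theta>"
  have \<kappa>: "0 < \<kappa>" "\<kappa> < 1" "\<kappa>\<^sup>2 = \<theta>" using \<theta> by (simp_all add: \<kappa>_def)
  have \<kappa>\<theta>: "\<theta> ^ n = (\<kappa> ^ n)\<^sup>2" for n unfolding \<kappa>(3)[symmetric] by (simp add: power_mult[symmetric] mult.commute)
  have L2: "u \<in> L2 \<mu>" using u by (simp add: besov_def)
  then have m[measurable]: "u \<in> borel_measurable \<mu>" by (simp add: L2_def)
  obtain A where A: "0 \<le> A" "\<And>r. 0 < r \<Longrightarrow> osc_int u r \<le> ennreal (A * r powr (\<alpha> + 2 * \<sigma>))"
    using osc_int_bound[OF u \<sigma>] by metis
  \<comment> \<open>The radius \<open>L * \<rho> ^ n\<close> exceeds the distance of any two points in meeting cells of level \<open>n\<close>.\<close>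
  define L where "L = 2 * diameter K + 1"
  have L: "0 < L" using diameter_K_nonneg by (simp add: L_def)
  define B where "B = A * L powr (\<alpha> + 2 * \<sigma>)"
  have B: "0 \<le> B" using A by (simp add: B_def)
  define a where "a v = (\<integral>s. u (\<Phi> v s) \<partial>\<mu>)" for v
  have osc: "ennreal (real N ^ n * real N ^ n) * osc_int u (L * \<rho> ^ n) \<le> ennreal (B * \<theta> ^ n)" for n
  proof -
    have "osc_int u (L * \<rho> ^ n) \<le> ennreal (A * (L * \<rho> ^ n) powr (\<alpha> + 2 * \<sigma>))"
      using L rho_pos by (intro A) simp
    then have "ennreal (real N ^ n * real N ^ n) * osc_int u (L * \<rho> ^ n)
        \<le> ennreal (real N ^ n * real N ^ n) * ennreal (A * (L * \<rho> ^ n) powr (\<alpha> + 2 * \<sigma>))"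
      by (rule mult_left_mono) simp
    also have "\<dots> = ennreal (real N ^ n * real N ^ n * (A * (L * \<rho> ^ n) powr (\<alpha> + 2 * \<sigma>)))"
      using A by (intro ennreal_mult[symmetric]) auto
    also have "real N ^ n * real N ^ n * (A * (L * \<rho> ^ n) powr (\<alpha> + 2 * \<sigma>)) = B * \<theta> ^ n"
    proof -
      have "real N = \<rho> powr (- \<alpha>)" by (simp add: powr_minus rho_powr_\<alpha>)
      then have "real N * real N * \<rho> powr (\<alpha> + 2 * \<sigma>) = \<theta>"
        by (simp add: \<theta>_def powr_add[symmetric])
      then have "\<theta> ^ n = real N ^ n * real N ^ n * (\<rho> powr (\<alpha> + 2 * \<sigma>)) ^ n"
        by (metis power_mult_distrib)
      then show ?thesis by (simp add: B_def powr_mult rho_power_powr)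
    qed
    finally show ?thesis .
  qed
  \<comment> \<open>Points of two meeting cells of level \<open>n\<close> have distance at most twice the diameter of a cell.\<close>
  have near: "dist (\<Phi> v s) (\<Phi> w t) < L * \<rho> ^ n"
    if "v \<in> W n" "w \<in> W n" "adj v w" "s \<in> K" "t \<in> K" for n v w s t
  proof -
    obtain z where z: "z \<in> cell v" "z \<in> cell w" using \<open>adj v w\<close> by (auto simp: adj_def)
    have "dist (\<Phi> v s) z \<le> \<rho> ^ n * diameter K" "dist z (\<Phi> w t) \<le> \<rho> ^ n * diameter K"
      using that z by (auto intro: dist_cell)
    moreover have "dist (\<Phi> v s) (\<Phi> w t) \<le> dist (\<Phi> v s) z + dist z (\<Phi> w t)" by (rule dist_triangle)
    moreover have "0 < \<rho> ^ n" using rho_pos by simp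
    ultimately show ?thesis by (simp add: L_def algebra_simps)
  qed
  have adj_sum: "(\<Sum>v\<in>W n. \<Sum>w\<in>{w \<in> W n. adj v w}. (a v - a w)\<^sup>2) \<le> B * \<theta> ^ n" for n
  proof -
    define P where "P = (SIGMA v:W n. {w \<in> W n. adj v w})"
    have "ennreal (\<Sum>v\<in>W n. \<Sum>w\<in>{w \<in> W n. adj v w}. (a v - a w)\<^sup>2) = (\<Sum>(v, w)\<in>P. ennreal ((a v - a w)\<^sup>2))"
      by (simp add: P_def sum.Sigma sum_nonneg case_prod_beta)
    also have "\<dots> \<le> (\<Sum>(v, w)\<in>P. pair_diff u v w)"
      unfolding a_def by (intro sum_mono) (auto simp: P_def intro: mean_diff_le[OF L2])
    also have "\<dots> \<le> ennreal (real N ^ n * real N ^ n) * osc_int u (L * \<rho> ^ n)"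
      by (rule osc_int_ge_pairs[OF m]) (auto simp: P_def intro: near)
    also have "\<dots> \<le> ennreal (B * \<theta> ^ n)" by (rule osc)
    finally show ?thesis using B \<theta> by (simp add: ennreal_le_iff)
  qed
  have adj_le: "(a v - a w)\<^sup>2 \<le> B * \<theta> ^ n" if "v \<in> W n" "w \<in> W n" "adj v w" for v w n
  proof -
    have "(a v - a w)\<^sup>2 \<le> (\<Sum>w\<in>{w \<in> W n. adj v w}. (a v - a w)\<^sup>2)"
      using that by (intro member_le_sum[of w _ "\<lambda>w. (a v - a w)\<^sup>2"]) auto
    also have "\<dots> \<le> (\<Sum>v\<in>W n. \<Sum>w\<in>{w \<in> W n. adj v w}. (a v - a w)\<^sup>2)"
      using that by (intro member_le_sum[of v _ "\<lambda>v. \<Sum>w\<in>{w \<in> W n. adj v w}. (a v - a w)\<^sup>2"]) (auto intro: sum_nonneg)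
    finally show ?thesis using adj_sum[of n] by linarith
  qed
  have child_le: "(a v - a (v @ [i]))\<^sup>2 \<le> N * B * \<theta> ^ n" if "v \<in> W n" "i \<in> {1..N}" for v i n
  proof -
    have vi: "v @ [i] \<in> W (n + 1)" using that by (intro append_in_words) auto
    have "ennreal ((a v - a (v @ [i]))\<^sup>2)
        \<le> (\<Sum>(v, w)\<in>{(v, v @ [i])}. pair_diff u v w)"
      unfolding a_def using mean_diff_le[OF L2 that(1) vi] by simp
    also have "\<dots> \<le> ennreal (real N ^ n * real N ^ (n + 1)) * osc_int u (L * \<rho> ^ n)"
    proof (rule osc_int_ge_pairs[OF m])
      show "{(v, v @ [i])} \<subseteq> W n \<times> W (n + 1)" using that vi by simp
      fix v' w' s t assume "(v', w') \<in> {(v, v @ [i])}" "s \<in> K" "t \<in> K"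
      then show "dist (\<Phi> v' s) (\<Phi> w' t) < L * \<rho> ^ n"
        using near[of v n v s "F i t"] that F_in_K[of i t] by simp
    qed
    also have "\<dots> = ennreal N * (ennreal (real N ^ n * real N ^ n) * osc_int u (L * \<rho> ^ n))"
      by (simp add: ennreal_mult mult_ac)
    also have "\<dots> \<le> ennreal N * ennreal (B * \<theta> ^ n)" by (rule mult_left_mono[OF osc]) simp
    also have "\<dots> = ennreal (N * (B * \<theta> ^ n))" using B \<theta> by (intro ennreal_mult[symmetric]) auto
    finally show ?thesis using B \<theta> by (simp add: ennreal_le_iff mult.assoc)
  qed
  have mean_sum: "(\<Sum>v\<in>W n. \<integral>\<^sup>+s. ennreal ((u (\<Phi> v s) - a v)\<^sup>2) \<partial>\<mu>) \<le> ennreal (B * \<theta> ^ n)" for n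
  proof -
    define P where "P = (\<lambda>v. (v, v)) ` W n"
    have "(\<Sum>v\<in>W n. \<integral>\<^sup>+s. ennreal ((u (\<Phi> v s) - a v)\<^sup>2) \<partial>\<mu>)
        \<le> (\<Sum>v\<in>W n. pair_diff u v v)"
    proof (intro sum_mono nn_integral_mono)
      fix v s assume v: "v \<in> W n"
      have "ennreal ((a v - u (\<Phi> v s))\<^sup>2) \<le> (\<integral>\<^sup>+t. ennreal ((u (\<Phi> v t) - u (\<Phi> v s))\<^sup>2) \<partial>\<mu>)"
        unfolding a_def using L2_\<Phi>[OF L2 v] L2_integrable[OF L2_\<Phi>[OF L2 v]]
        by (intro sq_integral_diff_le) (auto simp: L2_def)
      then show "ennreal ((u (\<Phi> v s) - a v)\<^sup>2) \<le> (\<integral>\<^sup>+t. ennreal ((u (\<Phi> v s) - u (\<Phi> v t))\<^sup>2) \<partial>\<mu>)"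
        by (simp add: power2_commute)
    qed
    also have "\<dots> = (\<Sum>(v, w)\<in>P. pair_diff u v w)"
      unfolding P_def by (subst sum.reindex) (auto simp: inj_on_def)
    also have "\<dots> \<le> ennreal (real N ^ n * real N ^ n) * osc_int u (L * \<rho> ^ n)"
      by (rule osc_int_ge_pairs[OF m]) (auto simp: P_def intro: near)
    also have "\<dots> \<le> ennreal (B * \<theta> ^ n)" by (rule osc)
    finally show ?thesis .
  qed
  define f where "f n x = a (pre n x)" for n x
  have in_adj: "adj w (pre n x)" if "x \<in> K" "x \<in> cell w" for w n x
    using in_cell_pre[OF that(1), of n] that(2) by (auto simp: adj_def)
  define M where "M = real (card (V 0))"
  define C1 where "C1 = 2 * M * (M * B)"
  have C1: "0 \<le> C1" using B by (simp add: C1_def M_def)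
  have energy_f: "E n (f n) \<le> C1 * \<theta> ^ n" for n
  proof -
    have "E n (f n) = (\<Sum>w\<in>W n. E 0 (\<lambda>p. f n (\<Phi> w p)))" using energy_split[of n 0] by simp
    also have "\<dots> \<le> (\<Sum>w\<in>W n. 2 * M * (\<Sum>p\<in>V 0. (f n (\<Phi> w p) - a w)\<^sup>2))"
      unfolding M_def by (intro sum_mono energy_0_le_deviation)
    also have "\<dots> \<le> (\<Sum>w\<in>W n. 2 * M * (\<Sum>p\<in>V 0. \<Sum>v\<in>{v \<in> W n. adj w v}. (a w - a v)\<^sup>2))"
    proof (intro sum_mono mult_left_mono)
      fix w p assume w: "w \<in> W n" and p: "p \<in> V 0"
      then have x: "\<Phi> w p \<in> K" "\<Phi> w p \<in> cell w" using V0_subset_K \<Phi>_in_K by auto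
      have "(a w - a (pre n (\<Phi> w p)))\<^sup>2 \<le> (\<Sum>v\<in>{v \<in> W n. adj w v}. (a w - a v)\<^sup>2)"
        using in_adj[OF x] pre_in_W[OF x(1)] by (intro member_le_sum[of _ _ "\<lambda>v. (a w - a v)\<^sup>2"]) auto
      then show "(f n (\<Phi> w p) - a w)\<^sup>2 \<le> (\<Sum>v\<in>{v \<in> W n. adj w v}. (a w - a v)\<^sup>2)"
        by (simp add: f_def power2_commute)
    qed (simp add: M_def)
    also have "\<dots> = 2 * M * (M * (\<Sum>w\<in>W n. \<Sum>v\<in>{v \<in> W n. adj w v}. (a w - a v)\<^sup>2))"
      by (simp add: M_def sum_distrib_left)
    also have "\<dots> \<le> 2 * M * (M * (B * \<theta> ^ n))"
      using adj_sum by (intro mult_left_mono) (auto simp: M_def)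
    finally show ?thesis by (simp add: C1_def mult_ac)
  qed
  \<comment> \<open>The sum of a geometric series of steps from one level to the next.\<close>
  define C2 where "C2 = sqrt (N * B) / (1 - \<kappa>)"
  have tele: "\<bar>f n x - f (n + k) x\<bar> \<le> C2 * \<kappa> ^ n" if x: "x \<in> K" for x n k
  proof -
    have step: "\<bar>f n x - f (Suc n) x\<bar> \<le> sqrt (N * B) * \<kappa> ^ n" for n
    proof -
      have "addr x n \<in> {1..N}" using addr[OF x] by (auto simp: inf_words_def)
      then have "(f n x - f (Suc n) x)\<^sup>2 \<le> N * B * \<theta> ^ n"
        unfolding f_def pre_Suc by (intro child_le pre_in_W x)
      also have "\<dots> = (sqrt (N * B) * \<kappa> ^ n)\<^sup>2" using B by (simp add: power_mult_distrib \<kappa>\<theta>)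
      finally have "\<bar>f n x - f (Suc n) x\<bar> \<le> \<bar>sqrt (N * B) * \<kappa> ^ n\<bar>" by (simp add: abs_le_square_iff)
      then show ?thesis using B \<kappa> by simp
    qed
    have "\<bar>f n x - f (n + k) x\<bar> \<le> C2 * (\<kappa> ^ n - \<kappa> ^ (n + k))"
    proof (induction k)
      case (Suc k)
      have "C2 * (\<kappa> ^ (n + k) - \<kappa> ^ (n + Suc k)) = sqrt (N * B) * \<kappa> ^ (n + k)"
        using \<kappa> by (simp add: C2_def field_simps)
      with Suc step[of "n + k"] show ?case by (simp add: algebra_simps)
    qed simp
    also have "\<dots> \<le> C2 * \<kappa> ^ n" using \<kappa> B by (intro mult_left_mono) (auto simp: C2_def)
    finally show ?thesis .
  qed
  have limit: "(\<lambda>n. f n x - f n y) \<longlonglongrightarrow> 0" if xy: "x \<in> V m" "y \<in> V m" for x y m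
  proof (rule vertices_chain[where Q = "\<lambda>x y. (\<lambda>n. f n x - f n y) \<longlonglongrightarrow> 0" and n = m, OF _ _ _ _ xy])
    fix x y assume "(\<lambda>n. f n x - f n y) \<longlonglongrightarrow> 0"
    from tendsto_minus[OF this] show "(\<lambda>n. f n y - f n x) \<longlonglongrightarrow> 0" by simp
  next
    fix x y z assume "(\<lambda>n. f n x - f n y) \<longlonglongrightarrow> 0" "(\<lambda>n. f n y - f n z) \<longlonglongrightarrow> 0"
    from tendsto_add[OF this] show "(\<lambda>n. f n x - f n z) \<longlonglongrightarrow> 0" by simp
  next
    fix w p q assume w: "w \<in> W m" and pq: "p \<in> V 0" "q \<in> V 0"
    have "(\<lambda>k. f (m + k) (\<Phi> w p) - f (m + k) (\<Phi> w q)) \<longlonglongrightarrow> 0"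
    proof (rule decay[of "C1 * \<theta> ^ m" "\<lambda>k p. f (m + k) (\<Phi> w p)" p q, OF _ _ pq])
      show "0 \<le> C1 * \<theta> ^ m" using C1 \<theta> by simp
      fix k
      have "E k (\<lambda>p. f (m + k) (\<Phi> w p)) \<le> E (m + k) (f (m + k))" by (rule energy_subcell_le[OF w])
      also have "\<dots> \<le> C1 * \<theta> ^ (m + k)" by (rule energy_f)
      finally show "E k (\<lambda>p. f (m + k) (\<Phi> w p)) \<le> C1 * \<theta> ^ m * (\<rho> powr (2 * \<sigma> - \<alpha>)) ^ k"
        by (simp add: power_add \<theta>_def mult.assoc)
    qed
    then show "(\<lambda>n. f n (\<Phi> w p) - f n (\<Phi> w q)) \<longlonglongrightarrow> 0"
      unfolding add.commute[of m] by (rule LIMSEQ_offset)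
  qed simp
  define C3 where "C3 = 2 * (sqrt B + C2)"
  have a_close: "\<bar>a v - a w\<bar> \<le> C3 * \<kappa> ^ n" if v: "v \<in> W n" and w: "w \<in> W n" for v w n
  proof -
    obtain p where p: "p \<in> V 0" using V0_nonempty by blast
    define x y where "x = \<Phi> v p" and "y = \<Phi> w p"
    have xy: "x \<in> V n" "y \<in> V n" using V_eq[of n] v w p by (auto simp: x_def y_def)
    have pt: "\<bar>a v - f (n + k) x\<bar> \<le> (sqrt B + C2) * \<kappa> ^ n"
      if "v \<in> W n" "x = \<Phi> v p" for v x k
    proof -
      have x: "x \<in> K" "x \<in> cell v" using that p V0_subset_K \<Phi>_in_K by auto
      have "(a v - f n x)\<^sup>2 \<le> B * \<theta> ^ n"
        unfolding f_def using in_adj[OF x] pre_in_W[OF x(1)] that by (intro adj_le) auto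
      also have "\<dots> = (sqrt B * \<kappa> ^ n)\<^sup>2" using B by (simp add: power_mult_distrib \<kappa>\<theta>)
      finally have "\<bar>a v - f n x\<bar> \<le> \<bar>sqrt B * \<kappa> ^ n\<bar>" by (simp add: abs_le_square_iff)
      moreover have "\<bar>sqrt B * \<kappa> ^ n\<bar> = sqrt B * \<kappa> ^ n" using B \<kappa> by simp
      ultimately show ?thesis using tele[OF x(1), of n k] by (simp add: distrib_right)
    qed
    have "\<bar>a v - a w\<bar> \<le> C3 * \<kappa> ^ n + \<bar>f (n + k) x - f (n + k) y\<bar>" for k
      using pt[OF v x_def, of k] pt[OF w y_def, of k] unfolding C3_def by (simp add: algebra_simps)
    moreover have "(\<lambda>k. C3 * \<kappa> ^ n + \<bar>f (n + k) x - f (n + k) y\<bar>) \<longlonglongrightarrow> C3 * \<kappa> ^ n + 0"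
      using LIMSEQ_ignore_initial_segment[OF limit[OF xy], of n]
      unfolding add.commute[of n] by (intro tendsto_add tendsto_const tendsto_rabs_zero)
    ultimately show ?thesis by (intro LIMSEQ_le_const) auto
  qed
  \<comment> \<open>The mean value minimises the deviation, so comparison with the mean of one cell is enough.\<close>
  define c where "c = (\<integral>x. u x \<partial>\<mu>)"
  have bound: "(\<integral>\<^sup>+x. ennreal ((u x - c)\<^sup>2) \<partial>\<mu>) \<le> ennreal ((2 * B + 2 * C3\<^sup>2) * \<theta> ^ n)" for n
  proof -
    have Nn: "(of_nat (N ^ n) :: ennreal) = ennreal (real N ^ n)"
      by (simp only: ennreal_of_nat_eq_real_of_nat of_nat_power)
    obtain w0 where w0: "w0 \<in> W n" using K_cells[of n] K_nonempty by blast
    have "(\<integral>\<^sup>+x. ennreal ((u x - c)\<^sup>2) \<partial>\<mu>) \<le> (\<integral>\<^sup>+x. ennreal ((u x - a w0)\<^sup>2) \<partial>\<mu>)"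
      unfolding c_def using L2 L2_integrable[OF L2] by (intro sq_deviation_minimal) (auto simp: L2_def)
    also have "\<dots> = ennreal (1 / real N ^ n) * (\<Sum>v\<in>W n. \<integral>\<^sup>+s. ennreal ((u (\<Phi> v s) - a w0)\<^sup>2) \<partial>\<mu>)"
      by (intro nn_integral_cells) measurable
    also have "\<dots> \<le> ennreal (1 / real N ^ n) *
        (\<Sum>v\<in>W n. ennreal 2 * (\<integral>\<^sup>+s. ennreal ((u (\<Phi> v s) - a v)\<^sup>2) \<partial>\<mu>) + ennreal (2 * C3\<^sup>2 * \<theta> ^ n))"
    proof (intro mult_left_mono sum_mono)
      fix v assume v: "v \<in> W n"
      have [measurable]: "(\<lambda>s. u (\<Phi> v s)) \<in> borel_measurable \<mu>" using L2_\<Phi>[OF L2 v] by (simp add: L2_def)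
      have "(\<integral>\<^sup>+s. ennreal ((u (\<Phi> v s) - a w0)\<^sup>2) \<partial>\<mu>)
          \<le> (\<integral>\<^sup>+s. ennreal 2 * ennreal ((u (\<Phi> v s) - a v)\<^sup>2) + ennreal (2 * C3\<^sup>2 * \<theta> ^ n) \<partial>\<mu>)"
      proof (rule nn_integral_mono)
        fix s
        have "(a v - a w0)\<^sup>2 \<le> (C3 * \<kappa> ^ n)\<^sup>2" using a_close[OF v w0] by (metis abs_ge_zero power2_abs power_mono)
        then have q: "(a v - a w0)\<^sup>2 \<le> C3\<^sup>2 * \<theta> ^ n" by (simp add: power_mult_distrib \<kappa>\<theta>)
        have "(u (\<Phi> v s) - a w0)\<^sup>2 \<le> 2 * (u (\<Phi> v s) - a v)\<^sup>2 + 2 * (a v - a w0)\<^sup>2"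
          using sq_add_le[of "u (\<Phi> v s) - a v" "a v - a w0"] by simp
        with q have "(u (\<Phi> v s) - a w0)\<^sup>2 \<le> 2 * (u (\<Phi> v s) - a v)\<^sup>2 + 2 * C3\<^sup>2 * \<theta> ^ n" by simp
        then have "ennreal ((u (\<Phi> v s) - a w0)\<^sup>2) \<le> ennreal (2 * (u (\<Phi> v s) - a v)\<^sup>2 + 2 * C3\<^sup>2 * \<theta> ^ n)"
          by (rule ennreal_leI)
        also have "\<dots> = ennreal 2 * ennreal ((u (\<Phi> v s) - a v)\<^sup>2) + ennreal (2 * C3\<^sup>2 * \<theta> ^ n)"
          using \<theta> by (simp add: ennreal_mult)
        finally show "ennreal ((u (\<Phi> v s) - a w0)\<^sup>2)
          \<le> ennreal 2 * ennreal ((u (\<Phi> v s) - a v)\<^sup>2) + ennreal (2 * C3\<^sup>2 * \<theta> ^ n)" .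
      qed
      also have "\<dots> = ennreal 2 * (\<integral>\<^sup>+s. ennreal ((u (\<Phi> v s) - a v)\<^sup>2) \<partial>\<mu>) + ennreal (2 * C3\<^sup>2 * \<theta> ^ n)"
        by (subst nn_integral_add) (auto simp: nn_integral_cmult emeasure_space_1)
      finally show "(\<integral>\<^sup>+s. ennreal ((u (\<Phi> v s) - a w0)\<^sup>2) \<partial>\<mu>)
        \<le> ennreal 2 * (\<integral>\<^sup>+s. ennreal ((u (\<Phi> v s) - a v)\<^sup>2) \<partial>\<mu>) + ennreal (2 * C3\<^sup>2 * \<theta> ^ n)" .
    qed simp
    also have "\<dots> = ennreal (1 / real N ^ n) *
        (ennreal 2 * (\<Sum>v\<in>W n. \<integral>\<^sup>+s. ennreal ((u (\<Phi> v s) - a v)\<^sup>2) \<partial>\<mu>) + ennreal (real N ^ n) * ennreal (2 * C3\<^sup>2 * \<theta> ^ n))"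
      unfolding sum.distrib sum_distrib_left[symmetric] sum_constant card_words Nn ..
    also have "\<dots> \<le> ennreal (1 / real N ^ n) *
        (ennreal 2 * ennreal (B * \<theta> ^ n) + ennreal (real N ^ n) * ennreal (2 * C3\<^sup>2 * \<theta> ^ n))"
      by (intro mult_left_mono add_right_mono mean_sum) auto
    also have "\<dots> = ennreal (1 / real N ^ n * (2 * (B * \<theta> ^ n) + real N ^ n * (2 * C3\<^sup>2 * \<theta> ^ n)))"
    proof -
      have "ennreal p * (ennreal 2 * ennreal x + ennreal z * ennreal y) = ennreal (p * (2 * x + z * y))"
        if "0 \<le> p" "0 \<le> x" "0 \<le> y" "0 \<le> z" for p x y z :: real
      proof -
        have "ennreal 2 * ennreal x = ennreal (2 * x)" "ennreal z * ennreal y = ennreal (z * y)"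
          by (rule ennreal_mult[symmetric], use that in simp_all)+
        moreover have "ennreal (2 * x) + ennreal (z * y) = ennreal (2 * x + z * y)"
          using that by (intro ennreal_plus[symmetric]) auto
        ultimately show ?thesis using that by (metis ennreal_mult add_nonneg_nonneg mult_nonneg_nonneg zero_le_numeral)
      qed
      then show ?thesis using B \<theta> by simp
    qed
    also have "\<dots> \<le> ennreal ((2 * B + 2 * C3\<^sup>2) * \<theta> ^ n)"
    proof (rule ennreal_leI)
      have "1 \<le> real N ^ n" using N_ge_2 by simp
      then have "1 / real N ^ n \<le> 1" using N_pos by (simp add: divide_le_eq_1)
      then have "1 / real N ^ n * (2 * (B * \<theta> ^ n)) \<le> 1 * (2 * (B * \<theta> ^ n))"
        using B \<theta> by (intro mult_right_mono) auto
      then show "1 / real N ^ n * (2 * (B * \<theta> ^ n) + real N ^ n * (2 * C3\<^sup>2 * \<theta> ^ n)) \<le> (2 * B + 2 * C3\<^sup>2) * \<theta> ^ n"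
        using N_pos by (simp add: field_simps)
    qed
    finally show ?thesis .
  qed
  have "(\<lambda>n. (2 * B + 2 * C3\<^sup>2) * \<theta> ^ n) \<longlonglongrightarrow> 0"
    using \<theta> by (intro tendsto_mult_right_zero LIMSEQ_power_zero) auto
  then have "(\<lambda>n. ennreal ((2 * B + 2 * C3\<^sup>2) * \<theta> ^ n)) \<longlonglongrightarrow> ennreal 0" by (rule tendsto_ennrealI)
  then have "(\<integral>\<^sup>+x. ennreal ((u x - c)\<^sup>2) \<partial>\<mu>) \<le> ennreal 0"
    using bound by (intro LIMSEQ_le_const) auto
  then have "AE x in \<mu>. ennreal ((u x - c)\<^sup>2) = 0"
    using m by (subst nn_integral_0_iff_AE[symmetric]) auto
  then have "AE x in \<mu>. u x = c" by eventually_elim simp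
  then show ?thesis by blast
qed

end

section \<open>Compatible relations\<close>

text \<open>Membership in \<open>V (Suc n)\<close> is used as a whole here, not as a union over the first letter.\<close>

declare vertices.simps(2) [simp del]

locale pcf_ifs_rel = pcf_ifs N \<rho> b F K
  for N :: nat and \<rho> :: real and b :: "nat \<Rightarrow> 'a::euclidean_space"
    and F :: "nat \<Rightarrow> 'a \<Rightarrow> 'a" and K :: "'a set" +
  fixes S :: "('a \<times> 'a) set"
  assumes compat: "compatible N F K S"
begin

abbreviation "T \<equiv> vertex_rel N F K S"
abbreviation "Ts \<equiv> all_vertices_rel N F K S"

lemma F_in_V: "i \<in> {1..N} \<Longrightarrow> x \<in> V n \<Longrightarrow> F i x \<in> V (Suc n)"
  unfolding vertices.simps(2) by blast

lemma equiv_V_total: "equiv A (A \<times> A)"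
  by (auto simp: equiv_def refl_on_def sym_def trans_def)

lemma equiv_T: "equiv (V n) (T n)"
proof (induction n)
  case 0
  then show ?case using compat by (simp add: compatible_def)
next
  case (Suc n)
  let ?\<U> = "{U. equiv (V (Suc n)) U \<and> T n \<subseteq> U \<and> (\<forall>(x, y)\<in>T n. \<forall>i\<in>{1..N}. (F i x, F i y) \<in> U)}"
  have sub: "T n \<subseteq> V n \<times> V n" using Suc by (auto simp: equiv_def)
  have "V (Suc n) \<times> V (Suc n) \<in> ?\<U>"
  proof -
    have "\<forall>(x, y)\<in>T n. \<forall>i\<in>{1..N}. (F i x, F i y) \<in> V (Suc n) \<times> V (Suc n)"
      using sub F_in_V by blast
    moreover have "T n \<subseteq> V (Suc n) \<times> V (Suc n)" using sub V_Suc_subset[of n] by blast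
    ultimately show ?thesis using equiv_V_total by blast
  qed
  then have ne: "?\<U> \<noteq> {}" by blast
  have "equiv (V (Suc n)) (\<Inter> ?\<U>)"
  proof (rule equivI)
    show "\<Inter> ?\<U> \<subseteq> V (Suc n) \<times> V (Suc n)" using \<open>V (Suc n) \<times> V (Suc n) \<in> ?\<U>\<close> by blast
    show "refl_on (V (Suc n)) (\<Inter> ?\<U>)" unfolding refl_on_def equiv_def by blast
    show "sym (\<Inter> ?\<U>)" unfolding sym_def equiv_def by blast
    show "trans (\<Inter> ?\<U>)" unfolding trans_def equiv_def by blast
  qed
  then show ?case by simp
qed

lemma T_subset: "T n \<subseteq> V n \<times> V n"
  using equiv_T[of n] by (auto simp: equiv_def)

lemma T_refl: "x \<in> V n \<Longrightarrow> (x, x) \<in> T n"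
  using equiv_T[of n] by (auto simp: equiv_def refl_on_def)

lemma T_sym: "(x, y) \<in> T n \<Longrightarrow> (y, x) \<in> T n"
  using equiv_T[of n] by (auto simp: equiv_def sym_def)

lemma T_trans: "(x, y) \<in> T n \<Longrightarrow> (y, z) \<in> T n \<Longrightarrow> (x, z) \<in> T n"
  using equiv_T[of n] by (auto simp: equiv_def trans_def)

lemma T_Suc_least:
  "equiv (V (Suc n)) U \<Longrightarrow> T n \<subseteq> U \<Longrightarrow>
    (\<And>x y i. (x, y) \<in> T n \<Longrightarrow> i \<in> {1..N} \<Longrightarrow> (F i x, F i y) \<in> U) \<Longrightarrow> T (Suc n) \<subseteq> U"
  unfolding vertex_rel.simps by (rule Inter_lower) blast

lemma T_Suc_subset: "T n \<subseteq> T (Suc n)"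
  unfolding vertex_rel.simps by blast

lemma T_mono: "m \<le> n \<Longrightarrow> T m \<subseteq> T n"
  using T_Suc_subset by (rule lift_Suc_mono_le)

lemma T_F: "(x, y) \<in> T n \<Longrightarrow> i \<in> {1..N} \<Longrightarrow> (F i x, F i y) \<in> T (Suc n)"
  unfolding vertex_rel.simps by blast

lemma T_\<Phi>: "(x, y) \<in> T m \<Longrightarrow> w \<in> W n \<Longrightarrow> (\<Phi> w x, \<Phi> w y) \<in> T (n + m)"
proof (induction n arbitrary: w)
  case (Suc n)
  then obtain i v where "w = i # v" "i \<in> {1..N}" "v \<in> W n" by (meson words_SucE)
  with Suc.IH[OF Suc.prems(1), of v] T_F show ?case by simp
qed simp

lemma T_subset_Ts: "T n \<subseteq> Ts"
  using T_subset[of n] by (auto simp: all_vertices_rel_def)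

lemma Ts_eq: "Ts = (\<Union>n. T n)"
  using T_subset by (auto simp: all_vertices_rel_def)

text \<open>
  The relation of level \<open>n + m\<close> is generated by its restriction to level \<open>n\<close> together with copies of
  level \<open>m\<close> inside the cells of level \<open>n\<close>. One step of the definition adds a letter in front of a
  word, so the induction trades letters between the outer and the inner level.
\<close>

lemma T_generated:
  assumes "equiv (V (n + m)) U" "T n \<subseteq> U"
    "\<And>w x y. w \<in> W n \<Longrightarrow> (x, y) \<in> T m \<Longrightarrow> (\<Phi> w x, \<Phi> w y) \<in> U"
  shows "T (n + m) \<subseteq> U"
  using assms
proof (induction n arbitrary: m U)
  case 0
  from 0(3)[of "[]"] show ?case by auto
next
  case (Suc n)
  note outer = Suc.IH
  from Suc.prems show ?case
  proof (induction m arbitrary: U)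
    case 0 then show ?case by simp
  next
    case (Suc m)
    define U1 where "U1 = U \<inter> (V (Suc n + m) \<times> V (Suc n + m))"
    have sub: "V (Suc n + m) \<subseteq> V (Suc n + Suc m)" by (rule V_mono) simp
    have "T (Suc n + m) \<subseteq> U1"
    proof (rule Suc.IH)
      show "equiv (V (Suc n + m)) U1"
        using Suc.prems(1) sub unfolding equiv_def U1_def refl_on_def sym_def trans_def by blast
      have "V (Suc n) \<subseteq> V (Suc n + m)" by (rule V_mono) simp
      then show "T (Suc n) \<subseteq> U1" using Suc.prems(2) T_subset[of "Suc n"] unfolding U1_def by blast
      fix w x y assume w: "w \<in> W (Suc n)" and xy: "(x, y) \<in> T m"
      then have "(\<Phi> w x, \<Phi> w y) \<in> U" using Suc.prems(3) T_Suc_subset by blast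
      moreover have "\<Phi> w x \<in> V (Suc n + m)" "\<Phi> w y \<in> V (Suc n + m)"
        using T_subset[of m] xy w by (blast intro: \<Phi>_in_V)+
      ultimately show "(\<Phi> w x, \<Phi> w y) \<in> U1" by (simp add: U1_def)
    qed
    then have i: "T (Suc n + m) \<subseteq> U" by (auto simp: U1_def)
    have ii: "(F i x, F i y) \<in> U" if xy: "(x, y) \<in> T (Suc n + m)" and ii: "i \<in> {1..N}" for x y i
    proof -
      define U2 where "U2 = {(x, y). x \<in> V (n + Suc m) \<and> y \<in> V (n + Suc m) \<and> (F i x, F i y) \<in> U}"
      have V2: "F i x \<in> V (Suc n + Suc m)" if "x \<in> V (n + Suc m)" for x
        using F_in_V[OF ii that] by (simp only: add_Suc)
      have "T (n + Suc m) \<subseteq> U2"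
      proof (rule outer)
        have refl: "(F i x, F i x) \<in> U" if "x \<in> V (n + Suc m)" for x
          using Suc.prems(1) V2[OF that] unfolding equiv_def refl_on_def by blast
        have "sym U" "trans U" using Suc.prems(1) by (auto simp: equiv_def)
        with refl show "equiv (V (n + Suc m)) U2"
          unfolding U2_def equiv_def refl_on_def sym_def trans_def by blast
        have "V n \<subseteq> V (n + Suc m)" by (rule V_mono) simp
        then show "T n \<subseteq> U2"
          using T_subset[of n] T_F[OF _ ii] Suc.prems(2) unfolding U2_def by blast
        fix w x y assume w: "w \<in> W n" and xy: "(x, y) \<in> T (Suc m)"
        have "i # w \<in> W (Suc n)" using w ii by simp
        from Suc.prems(3)[OF this xy] have "(F i (\<Phi> w x), F i (\<Phi> w y)) \<in> U" by simp
        moreover have "\<Phi> w x \<in> V (n + Suc m)" "\<Phi> w y \<in> V (n + Suc m)"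
          using T_subset[of "Suc m"] xy w by (blast intro: \<Phi>_in_V)+
        ultimately show "(\<Phi> w x, \<Phi> w y) \<in> U2" unfolding U2_def by blast
      qed
      with xy show ?thesis by (auto simp: U2_def)
    qed
    have "T (Suc (Suc n + m)) \<subseteq> U"
      by (rule T_Suc_least) (use Suc.prems(1) i ii in auto)
    then show ?case by simp
  qed
qed

lemma class_functions_add:
  assumes "v \<in> class_functions (T n)" "\<And>w. w \<in> W n \<Longrightarrow> (\<lambda>x. v (\<Phi> w x)) \<in> class_functions (T m)"
  shows "v \<in> class_functions (T (n + m))"
proof -
  define U where "U = {(x, y). x \<in> V (n + m) \<and> y \<in> V (n + m) \<and> v x = v y}"
  have "T (n + m) \<subseteq> U"
  proof (rule T_generated)
    show "equiv (V (n + m)) U"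
      unfolding U_def by (intro equivI) (auto simp: refl_on_def sym_def intro!: transI)
    have "V n \<subseteq> V (n + m)" by (rule V_mono) simp
    then show "T n \<subseteq> U" using T_subset[of n] assms(1) unfolding U_def class_functions_def by blast
    fix w x y assume w: "w \<in> W n" and xy: "(x, y) \<in> T m"
    have "\<Phi> w x \<in> V (n + m)" "\<Phi> w y \<in> V (n + m)"
      using T_subset[of m] xy w by (blast intro: \<Phi>_in_V)+
    moreover have "v (\<Phi> w x) = v (\<Phi> w y)" using assms(2)[OF w] xy unfolding class_functions_def by blast
    ultimately show "(\<Phi> w x, \<Phi> w y) \<in> U" by (simp add: U_def)
  qed
  then show ?thesis unfolding class_functions_def U_def by blast
qed

lemma class_functions_Ts: "v \<in> class_functions Ts \<longleftrightarrow> (\<forall>n. v \<in> class_functions (T n))"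
  unfolding Ts_eq class_functions_def by blast

lemma class_functions_antimono: "T1 \<subseteq> T2 \<Longrightarrow> v \<in> class_functions T2 \<Longrightarrow> v \<in> class_functions T1"
  unfolding class_functions_def by blast

lemma class_functions_cong:
  assumes "h \<in> class_functions (T n)" "\<And>x. x \<in> V n \<Longrightarrow> v x = h x"
  shows "v \<in> class_functions (T n)"
proof -
  have "v x = v y" if "(x, y) \<in> T n" for x y
  proof -
    have "x \<in> V n" "y \<in> V n" using T_subset[of n] that by blast+
    moreover have "h x = h y" using assms(1) that unfolding class_functions_def by blast
    ultimately show ?thesis using assms(2) by simp
  qed
  then show ?thesis unfolding class_functions_def by blast
qed

lemma class_functions_\<Phi>:
  "h \<in> class_functions (T n) \<Longrightarrow> w \<in> W n \<Longrightarrow> (\<lambda>x. h (\<Phi> w x)) \<in> class_functions S"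
  using T_\<Phi>[of _ _ 0 w n] unfolding class_functions_def by fastforce

text \<open>
  Functions on the copies of \<open>V\<^sub>*\<close> in the cells of level \<open>n\<close> fit together once they agree at the vertices of
  these cells, since different cells share nothing else.
\<close>

lemma glue_functions:
  fixes h :: "'a \<Rightarrow> real"
  assumes g: "\<And>w p. w \<in> W n \<Longrightarrow> p \<in> V 0 \<Longrightarrow> g w p = h (\<Phi> w p)"
  obtains v where "\<And>w y. w \<in> W n \<Longrightarrow> y \<in> Vs \<Longrightarrow> v (\<Phi> w y) = g w y" "\<And>x. x \<in> V n \<Longrightarrow> v x = h x"
proof -
  have unique: "g w y = g w' y'"
    if "w \<in> W n" "w' \<in> W n" "y \<in> Vs" "y' \<in> Vs" "\<Phi> w y = \<Phi> w' y'" for w w' y y'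
  proof (cases "w = w'")
    case True
    then show ?thesis using that \<Phi>_inj by auto
  next
    case False
    have K: "y \<in> K" "y' \<in> K" using that Vs_subset_K by auto
    have "y \<in> V 0" "y' \<in> V 0"
      using cells_meet_in_vertices[OF that(1,2) False K that(5)]
        cells_meet_in_vertices[OF that(2,1) False[symmetric] K(2,1) that(5)[symmetric]] by auto
    then show ?thesis using g that by simp
  qed
  define v where "v x = (THE z. \<exists>w\<in>W n. \<exists>y\<in>Vs. x = \<Phi> w y \<and> z = g w y)" for x
  have v: "v (\<Phi> w y) = g w y" if "w \<in> W n" "y \<in> Vs" for w y
    unfolding v_def using unique that by (intro the_equality) (blast, metis)
  moreover have "v x = h x" if "x \<in> V n" for x
  proof -
    obtain w p where "w \<in> W n" "p \<in> V 0" "x = \<Phi> w p" using \<open>x \<in> V n\<close> V_eq by blast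
    then show ?thesis using v g V_subset_Vs[of 0] by auto
  qed
  ultimately show thesis using that by blast
qed

text \<open>
  Inside each cell the data are again constant on classes of \<open>V\<^sub>0\<close>, so the same extension applies there;
  energies of cells add up, and \<open>T_generated\<close> shows that the result is constant on the classes of the
  deeper level.
\<close>

lemma one_step_extension:
  assumes ext: "\<And>u. u \<in> class_functions S \<Longrightarrow>
      \<exists>g\<in>class_functions (T m). (\<forall>x\<in>V 0. g x = u x) \<and> E m g \<le> \<kappa> * E 0 u"
    and h: "h \<in> class_functions (T n)"
  shows "\<exists>h'\<in>class_functions (T (n + m)). (\<forall>x\<in>V n. h' x = h x) \<and> E (n + m) h' \<le> \<kappa> * E n h"
proof -
  have "\<forall>w\<in>W n. \<exists>g. g \<in> class_functions (T m) \<and> (\<forall>x\<in>V 0. g x = h (\<Phi> w x)) \<and>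
      E m g \<le> \<kappa> * E 0 (\<lambda>x. h (\<Phi> w x))"
    using ext class_functions_\<Phi>[OF h] by blast
  then obtain g where "\<forall>w\<in>W n. g w \<in> class_functions (T m) \<and> (\<forall>x\<in>V 0. g w x = h (\<Phi> w x)) \<and>
      E m (g w) \<le> \<kappa> * E 0 (\<lambda>x. h (\<Phi> w x))"
    by (rule bchoice[THEN exE])
  then have g: "\<And>w. w \<in> W n \<Longrightarrow> g w \<in> class_functions (T m)"
      "\<And>w x. w \<in> W n \<Longrightarrow> x \<in> V 0 \<Longrightarrow> g w x = h (\<Phi> w x)"
      "\<And>w. w \<in> W n \<Longrightarrow> E m (g w) \<le> \<kappa> * E 0 (\<lambda>x. h (\<Phi> w x))" by auto
  obtain v where v: "\<And>w y. w \<in> W n \<Longrightarrow> y \<in> Vs \<Longrightarrow> v (\<Phi> w y) = g w y" "\<And>x. x \<in> V n \<Longrightarrow> v x = h x"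
    using glue_functions[of n g h] g(2) by blast
  have "v \<in> class_functions (T (n + m))"
  proof (rule class_functions_add)
    show "v \<in> class_functions (T n)"
      using h v(2) by (rule class_functions_cong)
    fix w assume w: "w \<in> W n"
    show "(\<lambda>x. v (\<Phi> w x)) \<in> class_functions (T m)"
      by (rule class_functions_cong[OF g(1)[OF w]]) (use v(1)[OF w] V_subset_Vs[of m] in auto)
  qed
  moreover have "E (n + m) v \<le> \<kappa> * E n h"
  proof -
    have "E (n + m) v = (\<Sum>w\<in>W n. E m (g w))"
      unfolding energy_split using v(1) V_subset_Vs[of m] by (intro sum.cong refl energy_cong) auto
    also have "\<dots> \<le> (\<Sum>w\<in>W n. \<kappa> * E 0 (\<lambda>x. h (\<Phi> w x)))" using g(3) by (rule sum_mono)
    also have "\<dots> = \<kappa> * E n h" using energy_split[of n 0 h] by (simp add: sum_distrib_left)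
    finally show ?thesis .
  qed
  ultimately show ?thesis using v(2) by blast
qed

lemma iterated_extension:
  assumes ext: "\<And>u. u \<in> class_functions S \<Longrightarrow>
      \<exists>g\<in>class_functions (T m). (\<forall>x\<in>V 0. g x = u x) \<and> E m g \<le> \<kappa> * E 0 u"
    and m: "0 < m" and \<kappa>: "0 \<le> \<kappa>" and u: "u \<in> class_functions S"
  obtains v where "v \<in> class_functions Ts" "\<And>x. x \<in> V 0 \<Longrightarrow> v x = u x"
    "\<And>k. E (m * k) v \<le> \<kappa> ^ k * E 0 u"
proof -
  have "\<exists>h. \<forall>k. (h k \<in> class_functions (T (m * k)) \<and> (k = 0 \<longrightarrow> h k = u)) \<and>
      (\<forall>x\<in>V (m * k). h (Suc k) x = h k x) \<and> E (m * Suc k) (h (Suc k)) \<le> \<kappa> * E (m * k) (h k)"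
  proof (rule dependent_nat_choice)
    show "\<exists>h. h \<in> class_functions (T (m * 0)) \<and> ((0::nat) = 0 \<longrightarrow> h = u)" using u by simp
    fix h k assume h: "h \<in> class_functions (T (m * k)) \<and> (k = 0 \<longrightarrow> h = u)"
    have "m * k + m = m * Suc k" by simp
    with one_step_extension[OF ext, of h "m * k"] h
    show "\<exists>h'. (h' \<in> class_functions (T (m * Suc k)) \<and> (Suc k = 0 \<longrightarrow> h' = u)) \<and>
      (\<forall>x\<in>V (m * k). h' x = h x) \<and> E (m * Suc k) h' \<le> \<kappa> * E (m * k) h"
      by (metis Suc_neq_Zero)
  qed
  then obtain h where h: "\<And>k. h k \<in> class_functions (T (m * k))" "h 0 = u"
      "\<And>k x. x \<in> V (m * k) \<Longrightarrow> h (Suc k) x = h k x"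
      "\<And>k. E (m * Suc k) (h (Suc k)) \<le> \<kappa> * E (m * k) (h k)" by blast
  define v where "v x = h (LEAST k. x \<in> V (m * k)) x" for x
  have stable: "h (k + j) x = h k x" if "x \<in> V (m * k)" for k j x
  proof (induction j)
    case (Suc j)
    have "V (m * k) \<subseteq> V (m * (k + j))" by (rule V_mono) simp
    then show ?case using h(3)[of x "k + j"] that Suc by auto
  qed simp
  have v: "v x = h k x" if x: "x \<in> V (m * k)" for k x
  proof -
    define l where "l = (LEAST k. x \<in> V (m * k))"
    have "x \<in> V (m * l)" unfolding l_def using x by (rule LeastI)
    moreover have "l \<le> k" unfolding l_def using x by (rule Least_le)
    ultimately show ?thesis using stable[of x l "k - l"] by (simp add: v_def l_def)
  qed
  have "v \<in> class_functions Ts"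
    unfolding class_functions_Ts
  proof
    fix n
    have "n \<le> m * n" using m by simp
    then have "T n \<subseteq> T (m * n)" by (rule T_mono)
    moreover have "v \<in> class_functions (T (m * n))"
      using h(1) v by (rule class_functions_cong)
    ultimately show "v \<in> class_functions (T n)" by (rule class_functions_antimono)
  qed
  moreover have "v x = u x" if "x \<in> V 0" for x using v[of x 0] that h(2) by simp
  moreover have "E (m * k) v \<le> \<kappa> ^ k * E 0 u" for k
  proof -
    have "E (m * k) v = E (m * k) (h k)" using v by (rule energy_cong)
    also have "\<dots> \<le> \<kappa> ^ k * E 0 u"
    proof (induction k)
      case (Suc k)
      have "E (m * Suc k) (h (Suc k)) \<le> \<kappa> * E (m * k) (h k)" by (rule h(4))
      also have "\<dots> \<le> \<kappa> * (\<kappa> ^ k * E 0 u)" using Suc \<kappa> by (rule mult_left_mono)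
      finally show ?case by simp
    qed (simp add: h(2))
    finally show ?thesis .
  qed
  ultimately show thesis using that by blast
qed

text \<open>
  The minimiser in the definition of the quotient trace is the required extension. Each class is
  represented by one of its points, so the sum over pairs of classes is at most \<open>E\<^sub>0\<close>.
\<close>

lemma quotient_trace_extension:
  assumes tr: "is_quotient_trace N F K S n r" and \<theta>: "0 < \<theta>"
    and small: "\<And>I J. I \<in> V 0 // S \<Longrightarrow> J \<in> V 0 // S \<Longrightarrow> I \<noteq> J \<Longrightarrow> ennreal \<theta> / r I J \<le> 1"
    and u: "u \<in> class_functions S"
  shows "\<exists>g\<in>class_functions (T n). (\<forall>x\<in>V 0. g x = u x) \<and> E n g \<le> (1 / \<theta>) * E 0 u"
proof -
  have eS: "equiv (V 0) S" using equiv_T[of 0] by simp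
  define c where "c J = (SOME x. x \<in> J)" for J :: "'a set"
  have c: "c J \<in> J" if "J \<in> V 0 // S" for J
    unfolding c_def using in_quotient_imp_non_empty[OF eS that] by (meson ex_in_conv someI_ex)
  have uc: "u (c J) = u x" if "J \<in> V 0 // S" "x \<in> J" for J x
    using in_quotient_imp_in_rel[OF eS that(1), of "c J" x] c[OF that(1)] that(2) u
    unfolding class_functions_def by blast
  have pos: "\<And>I J. I \<in> V 0 // S \<Longrightarrow> J \<in> V 0 // S \<Longrightarrow> I \<noteq> J \<Longrightarrow> 0 < r I J"
    and min: "is_minimum
              {energy N F K n v | v. v \<in> class_functions (vertex_rel N F K S n) \<and>
                                      (\<forall>J\<in>V 0 // S. \<forall>x\<in>J. v x = u (c J))}
              ((1/2) * (\<Sum>I\<in>V 0 // S. \<Sum>J\<in>V 0 // S - {I}. enn2real (1 / r I J) * \<bar>u (c I) - u (c J)\<bar>\<^sup>2))"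
    using tr unfolding is_quotient_trace_def Let_def by auto
  from min obtain g where g: "g \<in> class_functions (T n)" "\<And>J x. J \<in> V 0 // S \<Longrightarrow> x \<in> J \<Longrightarrow> g x = u (c J)"
    "E n g = (1/2) * (\<Sum>I\<in>V 0 // S. \<Sum>J\<in>V 0 // S - {I}. enn2real (1 / r I J) * \<bar>u (c I) - u (c J)\<bar>\<^sup>2)"
    unfolding is_minimum_def by auto
  have gu: "g x = u x" if "x \<in> V 0" for x
  proof -
    have J: "S `` {x} \<in> V 0 // S" "x \<in> S `` {x}"
      using that equiv_class_self[OF eS that] by (auto intro: quotientI)
    show ?thesis using g(2)[OF J] uc[OF J] by simp
  qed
  have r: "enn2real (1 / r I J) \<le> 1 / \<theta>" if "I \<in> V 0 // S" "J \<in> V 0 // S" "I \<noteq> J" for I J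
  proof -
    have le: "ennreal \<theta> * (1 / r I J) \<le> 1" using small[OF that] by (simp add: ennreal_times_divide)
    then have "1 / r I J \<noteq> \<infinity>" using \<theta> by (auto simp: ennreal_mult_top top_unique)
    then obtain z where z: "0 \<le> z" "1 / r I J = ennreal z" by (metis ennreal_cases infinity_ennreal_def)
    have "ennreal (\<theta> * z) \<le> ennreal 1" using le z \<theta> by (simp add: ennreal_mult)
    then have "\<theta> * z \<le> 1" by (subst (asm) ennreal_le_iff) auto
    then show ?thesis using z \<theta> by (simp add: field_simps)
  qed
  have "E n g \<le> (1/2) * (\<Sum>I\<in>V 0 // S. \<Sum>J\<in>V 0 // S - {I}. (1 / \<theta>) * \<bar>u (c I) - u (c J)\<bar>\<^sup>2)"
    unfolding g(3) using r by (intro mult_left_mono sum_mono mult_right_mono) auto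
  also have "\<dots> = (1 / \<theta>) * ((1/2) * (\<Sum>I\<in>V 0 // S. \<Sum>J\<in>V 0 // S - {I}. \<bar>u (c I) - u (c J)\<bar>\<^sup>2))"
    by (simp add: sum_distrib_left mult_ac)
  also have "\<dots> \<le> (1 / \<theta>) * E 0 u"
  proof (intro mult_left_mono)
    have inj: "inj_on c (V 0 // S)"
    proof (rule inj_onI)
      fix I J assume IJ: "I \<in> V 0 // S" "J \<in> V 0 // S" "c I = c J"
      then have "c I \<in> I \<inter> J" using c by (metis IntI)
      then show "I = J" using quotient_disj[OF eS IJ(1,2)] by blast
    qed
    have sub: "c ` (V 0 // S) \<subseteq> V 0"
      using c in_quotient_imp_subset[OF eS] by blast
    have "(\<Sum>I\<in>V 0 // S. \<Sum>J\<in>V 0 // S - {I}. \<bar>u (c I) - u (c J)\<bar>\<^sup>2)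
        = (\<Sum>p\<in>c ` (V 0 // S). \<Sum>q\<in>c ` (V 0 // S) - {p}. \<bar>u p - u q\<bar>\<^sup>2)"
    proof -
      have "(\<Sum>J\<in>V 0 // S - {I}. \<bar>u (c I) - u (c J)\<bar>\<^sup>2) = (\<Sum>q\<in>c ` (V 0 // S) - {c I}. \<bar>u (c I) - u q\<bar>\<^sup>2)"
        if "I \<in> V 0 // S" for I
      proof -
        have "c ` (V 0 // S) - {c I} = c ` (V 0 // S - {I})" using inj that by (auto simp: inj_on_def)
        then show ?thesis using inj by (simp add: sum.reindex inj_on_diff)
      qed
      then show ?thesis by (simp add: sum.reindex[OF inj])
    qed
    also have "\<dots> \<le> (\<Sum>p\<in>V 0. \<Sum>q\<in>c ` (V 0 // S) - {p}. \<bar>u p - u q\<bar>\<^sup>2)"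
      using sub finite_V0 by (intro sum_mono2) (auto intro: sum_nonneg)
    also have "\<dots> \<le> (\<Sum>p\<in>V 0. \<Sum>q\<in>V 0 - {p}. \<bar>u p - u q\<bar>\<^sup>2)"
      using sub finite_V0 by (intro sum_mono sum_mono2) auto
    finally show "(1/2) * (\<Sum>I\<in>V 0 // S. \<Sum>J\<in>V 0 // S - {I}. \<bar>u (c I) - u (c J)\<bar>\<^sup>2) \<le> E 0 u"
      unfolding energy_0 by simp
  qed (use \<theta> in simp)
  finally show ?thesis using g(1) gu by blast
qed

subsection \<open>Classes of small diameter\<close>

definition boundary_points :: "'a set" where
  "boundary_points = \<Union> (boundary_classes N F K S)"

lemma equiv_Ts: "equiv Vs Ts"
proof (rule equivI)
  show "Ts \<subseteq> Vs \<times> Vs" using V_subset_Vs by (auto simp: all_vertices_rel_def)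
  show "refl_on Vs Ts" using T_refl T_subset_Ts by (force simp: refl_on_def all_vertices_def)
  show "sym Ts" using T_sym unfolding Ts_eq sym_def by blast
  show "trans Ts"
  proof (rule transI)
    fix x y z assume "(x, y) \<in> Ts" "(y, z) \<in> Ts"
    then obtain m n where "(x, y) \<in> T m" "(y, z) \<in> T n" unfolding Ts_eq by blast
    then have "(x, y) \<in> T (m + n)" "(y, z) \<in> T (m + n)" using T_mono[of m "m + n"] T_mono[of n "m + n"] by auto
    then show "(x, z) \<in> Ts" using T_trans T_subset_Ts by blast
  qed
qed

text \<open>
  In particular there are only finitely many boundary classes.
\<close>

lemma boundary_classes_eq: "boundary_classes N F K S = (\<lambda>p. Ts `` {p}) ` V 0"
proof -
  have "J \<in> (\<lambda>p. Ts `` {p}) ` V 0" if J: "J \<in> Vs // Ts" "p \<in> J" "p \<in> V 0" for J p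
  proof -
    have "p \<in> Vs" using J(3) V_subset_Vs by blast
    then have "Ts `` {p} \<in> Vs // Ts" "p \<in> Ts `` {p}"
      using equiv_class_self[OF equiv_Ts] by (auto intro: quotientI)
    then have "J = Ts `` {p}" using quotient_disj[OF equiv_Ts J(1)] J(2) by blast
    then show ?thesis using J(3) by blast
  qed
  moreover have "Ts `` {p} \<in> Vs // Ts \<and> Ts `` {p} \<inter> V 0 \<noteq> {}" if "p \<in> V 0" for p
  proof -
    have "p \<in> Vs" using that V_subset_Vs by blast
    then have "Ts `` {p} \<in> Vs // Ts" "p \<in> Ts `` {p}"
      using equiv_class_self[OF equiv_Ts] by (auto intro: quotientI)
    then show ?thesis using that by blast
  qed
  ultimately show ?thesis unfolding boundary_classes_def by blast
qed

lemma boundary_points_iff: "x \<in> boundary_points \<longleftrightarrow> (\<exists>p\<in>V 0. (p, x) \<in> Ts)"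
  unfolding boundary_points_def boundary_classes_eq by blast

lemma boundary_points_subset: "boundary_points \<subseteq> Vs"
  using equiv_Ts by (auto simp: boundary_points_iff equiv_def)

lemma V0_subset_boundary_points: "V 0 \<subseteq> boundary_points"
proof
  fix x assume x: "x \<in> V 0"
  then have "(x, x) \<in> Ts" using T_refl[OF x] T_subset_Ts[of 0] by blast
  with x show "x \<in> boundary_points" unfolding boundary_points_iff by blast
qed

text \<open>
  Equivalences at a deeper level arise inside single cells of level \<open>m\<close> or pass through vertices of
  level \<open>m\<close>. A class that avoids the copies of the boundary classes cannot pass through such a vertex
  and stays in one cell.
\<close>

lemma class_in_one_cell:
  fixes m :: nat
  defines "Z \<equiv> (\<Union>w\<in>W m. \<Phi> w ` boundary_points)"
  assumes xy: "(x, y) \<in> T (m + k)" and x: "x \<notin> Z"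
  shows "\<exists>w\<in>W m. x \<in> cell w \<and> y \<in> cell w"
proof -
  define U where "U = {(x, y). x \<in> V (m + k) \<and> y \<in> V (m + k) \<and>
    (x \<in> Z \<and> y \<in> Z \<or> x \<notin> Z \<and> y \<notin> Z \<and> (\<exists>w\<in>W m. x \<in> cell w \<and> y \<in> cell w))}"
  have VmZ: "V m \<subseteq> Z" unfolding Z_def V_eq[of m] using V0_subset_boundary_points by blast
  have one: "v = w" if "v \<in> W m" "w \<in> W m" "y \<in> cell v" "y \<in> cell w" "y \<notin> Z" for v w y
  proof (rule ccontr)
    assume "v \<noteq> w"
    obtain s t where "s \<in> K" "t \<in> K" "y = \<Phi> v s" "\<Phi> v s = \<Phi> w t" using \<open>y \<in> cell v\<close> \<open>y \<in> cell w\<close> by auto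
    then have "s \<in> V 0" "y = \<Phi> v s" using cells_meet_in_vertices[OF that(1,2) \<open>v \<noteq> w\<close>] by auto
    then have "y \<in> V m" using V_eq[of m] that(1) by blast
    then show False using VmZ that(5) by blast
  qed
  have "T (m + k) \<subseteq> U"
  proof (rule T_generated)
    have ex: "\<exists>w\<in>W m. x \<in> cell w" if "x \<in> V (m + k)" for x using that V_subset_K K_cells[of m] by blast
    show "equiv (V (m + k)) U"
    proof (rule equivI)
      show "U \<subseteq> V (m + k) \<times> V (m + k)" unfolding U_def by blast
      show "refl_on (V (m + k)) U" unfolding refl_on_def U_def using ex by blast
      show "sym U" unfolding sym_def U_def by blast
      show "trans U"
      proof (rule transI)
        fix x y z assume xy: "(x, y) \<in> U" and yz: "(y, z) \<in> U"
        then have V: "x \<in> V (m + k)" "z \<in> V (m + k)" unfolding U_def by blast+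
        show "(x, z) \<in> U"
        proof (cases "y \<in> Z")
          case True
          then show ?thesis using xy yz V unfolding U_def by blast
        next
          case False
          obtain v where v: "v \<in> W m" "x \<in> cell v" "y \<in> cell v" "x \<notin> Z" using False xy unfolding U_def by blast
          obtain w where w: "w \<in> W m" "y \<in> cell w" "z \<in> cell w" "z \<notin> Z" using False yz unfolding U_def by blast
          from one[OF v(1) w(1) v(3) w(2) False] v w V show ?thesis unfolding U_def by blast
        qed
      qed
    qed
    have "V m \<subseteq> V (m + k)" by (rule V_mono) simp
    then show "T m \<subseteq> U" using T_subset[of m] VmZ unfolding U_def by blast
    fix w x y assume w: "w \<in> W m" and xy: "(x, y) \<in> T k"
    have V: "x \<in> V k" "y \<in> V k" using T_subset xy by auto
    then have Kxy: "x \<in> K" "y \<in> K" using V_subset_K by auto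
    have inZ: "\<Phi> w x \<in> Z \<longleftrightarrow> x \<in> boundary_points" if x: "x \<in> K" for x
    proof
      assume "\<Phi> w x \<in> Z"
      then obtain v z where v: "v \<in> W m" "z \<in> boundary_points" "\<Phi> w x = \<Phi> v z" unfolding Z_def by blast
      show "x \<in> boundary_points"
      proof (cases "v = w")
        case True then show ?thesis using v \<Phi>_inj[OF w] by simp
      next
        case False
        have "z \<in> K" using v(2) boundary_points_subset Vs_subset_K by blast
        then have "x \<in> V 0" using cells_meet_in_vertices[OF w v(1) False[symmetric] x _ v(3)] by blast
        then show ?thesis using V0_subset_boundary_points by blast
      qed
    qed (use w in \<open>auto simp: Z_def\<close>)
    have "x \<in> boundary_points \<longleftrightarrow> y \<in> boundary_points"
    proof -
      have "(x, y) \<in> Ts" using xy T_subset_Ts by blast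
      then show ?thesis unfolding boundary_points_iff
        using equiv_Ts by (meson equivE symE transE)
    qed
    moreover have "\<Phi> w x \<in> V (m + k)" "\<Phi> w y \<in> V (m + k)" using V w \<Phi>_in_V by auto
    ultimately show "(\<Phi> w x, \<Phi> w y) \<in> U"
      using inZ Kxy w unfolding U_def by blast
  qed
  then show ?thesis using xy x unfolding U_def by blast
qed

end

section \<open>Functions of finite energy\<close>

context pcf_ifs
begin

text \<open>
  Connectedness of \<open>K\<close> makes the graph of cells connected, so the increments along a path of cells
  bound the difference of the values at any two vertices.
\<close>

lemma difference_le_energy:
  obtains c where "1 \<le> c" "\<And>h x y. x \<in> V n \<Longrightarrow> y \<in> V n \<Longrightarrow> (h x - h y)\<^sup>2 \<le> c * E n h"
proof -
  define Q where "Q x y \<longleftrightarrow> (\<exists>c\<ge>0. \<forall>h. (h x - h y)\<^sup>2 \<le> c * E n h)" for x y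
  have Q: "Q x y" if "x \<in> V n" "y \<in> V n" for x y
  proof (rule vertices_chain[where Q = Q and n = n, OF _ _ _ _ that])
    show "Q x x" for x unfolding Q_def by (auto intro!: exI[of _ 0])
    show "Q y x" if "Q x y" for x y using that unfolding Q_def by (simp add: power2_commute)
    show "Q x z" if xy: "Q x y" and yz: "Q y z" for x y z
    proof -
      obtain c d where c: "0 \<le> c" "\<And>h. (h x - h y)\<^sup>2 \<le> c * E n h"
        and d: "0 \<le> d" "\<And>h. (h y - h z)\<^sup>2 \<le> d * E n h" using xy yz unfolding Q_def by blast
      have "(h x - h z)\<^sup>2 \<le> (2 * c + 2 * d) * E n h" for h
        using sq_add_le[of "h x - h y" "h y - h z"] c(2)[of h] d(2)[of h] by (simp add: algebra_simps)
      then show ?thesis using c(1) d(1) unfolding Q_def by (intro exI[of _ "2 * c + 2 * d"]) auto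
    qed
    show "Q (\<Phi> w p) (\<Phi> w q)" if "w \<in> W n" "p \<in> V 0" "q \<in> V 0" for w p q
    proof -
      have "(h (\<Phi> w p) - h (\<Phi> w q))\<^sup>2 \<le> 1 * E n h" for h
        using edge_le_energy[OF that(2,3), of "\<lambda>x. h (\<Phi> w x)"] energy_subcell_le[OF that(1), of 0 h] by simp
      then show ?thesis unfolding Q_def by (intro exI[of _ 1]) auto
    qed
  qed
  then have "\<forall>z\<in>V n \<times> V n. \<exists>c. 0 \<le> c \<and> (\<forall>h. (h (fst z) - h (snd z))\<^sup>2 \<le> c * E n h)"
    unfolding Q_def by auto
  then obtain c where c: "\<forall>z\<in>V n \<times> V n. 0 \<le> c z \<and> (\<forall>h. (h (fst z) - h (snd z))\<^sup>2 \<le> c z * E n h)"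
    by (rule bchoice[THEN exE])
  define C where "C = 1 + (\<Sum>z\<in>V n \<times> V n. c z)"
  have fin: "finite (V n \<times> V n)" using finite_V by simp
  have "(h x - h y)\<^sup>2 \<le> C * E n h" if "x \<in> V n" "y \<in> V n" for h x y
  proof -
    have z: "(x, y) \<in> V n \<times> V n" using that by simp
    have "c (x, y) \<le> (\<Sum>z\<in>V n \<times> V n. c z)" using c z fin by (intro member_le_sum) auto
    then have "c (x, y) * E n h \<le> C * E n h" unfolding C_def by (intro mult_right_mono energy_nonneg) simp
    moreover have "(h x - h y)\<^sup>2 \<le> c (x, y) * E n h" using bspec[OF c z] by simp
    ultimately show ?thesis by linarith
  qed
  moreover have "0 \<le> (\<Sum>z\<in>V n \<times> V n. c z)" using c by (intro sum_nonneg) auto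
  then have "1 \<le> C" unfolding C_def by simp
  ultimately show thesis using that by blast
qed

text \<open>
  A vertex of level \<open>m k\<close> is reached from \<open>p\<close> through the copies of \<open>p\<close> in the decreasing cells that
  contain it; each step moves within one cell and costs the energy of the next multiple of \<open>m\<close>.
\<close>

lemma telescoping_oscillation:
  obtains c where "0 \<le> c"
    "\<And>g p x k. p \<in> V 0 \<Longrightarrow> x \<in> V (m * k) \<Longrightarrow> \<bar>g x - g p\<bar> \<le> c * (\<Sum>j\<le>k. sqrt (E (m * j) g))"
proof -
  obtain c where c: "1 \<le> c" "\<And>h x y. x \<in> V m \<Longrightarrow> y \<in> V m \<Longrightarrow> (h x - h y)\<^sup>2 \<le> c * E m h"
    using difference_le_energy[of m] by metis
  have "\<bar>g x - g p\<bar> \<le> sqrt c * (\<Sum>j\<le>k. sqrt (E (m * j) g))" if p: "p \<in> V 0" and "x \<in> V (m * k)" for g p x k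
    using that(2)
  proof (induction k arbitrary: x)
    case 0
    have "(g x - g p)\<^sup>2 \<le> E 0 g" using edge_le_energy 0 p by simp
    also have "\<dots> \<le> c * E 0 g" using c(1) energy_nonneg[of 0 g] by (simp add: mult_le_cancel_right1)
    finally have "sqrt ((g x - g p)\<^sup>2) \<le> sqrt (c * E 0 g)" by (rule real_sqrt_le_mono)
    then show ?case by (simp add: real_sqrt_mult)
  next
    case (Suc k)
    have "x \<in> V (m * k + m)" using Suc.prems by (simp add: add.commute)
    then obtain w y where wy: "w \<in> W (m * k)" "y \<in> V m" "x = \<Phi> w y" unfolding V_add by blast
    have pm: "p \<in> V m" using p V_mono[of 0 m] by auto
    have "(g (\<Phi> w y) - g (\<Phi> w p))\<^sup>2 \<le> c * E m (\<lambda>x. g (\<Phi> w x))"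
      using c(2)[OF wy(2) pm, of "\<lambda>x. g (\<Phi> w x)"] by simp
    also have "\<dots> \<le> c * E (m * k + m) g"
      using c(1) energy_subcell_le[OF wy(1)] by (intro mult_left_mono) auto
    finally have "sqrt ((g x - g (\<Phi> w p))\<^sup>2) \<le> sqrt (c * E (m * k + m) g)"
      unfolding wy(3) by (rule real_sqrt_le_mono)
    then have "\<bar>g x - g (\<Phi> w p)\<bar> \<le> sqrt c * sqrt (E (m * Suc k) g)"
      by (simp add: real_sqrt_mult add.commute)
    moreover have "\<Phi> w p \<in> V (m * k)" using \<Phi>_in_V[OF wy(1) p] by simp
    from Suc.IH[OF this] have "\<bar>g (\<Phi> w p) - g p\<bar> \<le> sqrt c * (\<Sum>j\<le>k. sqrt (E (m * j) g))" .
    ultimately show ?case by (simp add: algebra_simps)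
  qed
  moreover have "0 \<le> sqrt c" using c(1) by simp
  ultimately show thesis using that by blast
qed

text \<open>
  The oscillation on a cell is bounded by a sum of square roots of energies of increasing level, which decay
  geometrically. Weights \<open>t ^ j\<close> that grow more slowly let the Cauchy--Schwarz inequality bring
  the squares inside, and then the energies of the cells of one level add up.
\<close>

lemma oscillation_bound:
  assumes m: "0 < m" and \<theta>: "1 < \<theta>" and v: "\<And>k. E (m * k) v \<le> C / \<theta> ^ (m * k)"
  obtains B C' where "\<And>w. 0 \<le> B w" "0 \<le> C'"
    "\<And>n w x y. w \<in> W (m * n) \<Longrightarrow> x \<in> Vs \<Longrightarrow> y \<in> Vs \<Longrightarrow> (v (\<Phi> w x) - v (\<Phi> w y))\<^sup>2 \<le> B w"
    "\<And>n. (\<Sum>w\<in>W (m * n). B w) \<le> C' / \<theta> ^ (m * n)"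
proof -
  obtain c where c: "0 \<le> c"
    "\<And>g p x k. p \<in> V 0 \<Longrightarrow> x \<in> V (m * k) \<Longrightarrow> \<bar>g x - g p\<bar> \<le> c * (\<Sum>j\<le>k. sqrt (E (m * j) g))"
    using telescoping_oscillation[of m] by metis
  have C: "0 \<le> C" using v[of 0] energy_nonneg[of 0 v] by simp
  define s where "s = \<theta> ^ m"
  have s: "1 < s" unfolding s_def using \<theta> m by (simp add: one_less_power)
  have ths: "\<theta> ^ (m * k) = s ^ k" for k by (simp add: s_def power_mult)
  \<comment> \<open>Energies decay like \<open>1 / s ^ j\<close>; the weight \<open>t\<^sup>2\<close> is the square root of \<open>s\<close>, so both factors converge.\<close>
  define t where "t = sqrt (sqrt s)"
  have t: "1 < t" using s by (simp add: t_def)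
  have t2: "t\<^sup>2 * t\<^sup>2 = s" using s by (simp add: t_def)
  define G where "G = 1 / (1 - 1 / t\<^sup>2)"
  have t2': "0 < 1 / t\<^sup>2" "1 / t\<^sup>2 < 1" using t by (auto simp: one_less_power)
  have G: "(\<lambda>j. (1 / t\<^sup>2) ^ j) sums G" unfolding G_def using t2' by (intro geometric_sums) simp
  have G0: "0 \<le> G" unfolding G_def using t2' by simp
  define e where "e w j = (t\<^sup>2) ^ j * E (m * j) (\<lambda>x. v (\<Phi> w x))" for w j
  have e0: "0 \<le> e w j" for w j unfolding e_def using t by (intro mult_nonneg_nonneg energy_nonneg) auto
  have weight: "(t\<^sup>2) ^ j * (C / s ^ (n + j)) = C / s ^ n * (1 / t\<^sup>2) ^ j" for n j
  proof -
    have "s ^ j = (t\<^sup>2) ^ j * (t\<^sup>2) ^ j" unfolding t2[symmetric] by (rule power_mult_distrib)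
    moreover have "0 < (t\<^sup>2) ^ j" using t by simp
    ultimately show ?thesis using s by (simp add: power_add power_one_over field_simps)
  qed
  have e_sum: "(\<Sum>w\<in>W (m * n). e w j) \<le> C / s ^ n * (1 / t\<^sup>2) ^ j" for n j
  proof -
    have "(\<Sum>w\<in>W (m * n). e w j) = (t\<^sup>2) ^ j * E (m * (n + j)) v"
      unfolding e_def sum_distrib_left[symmetric] by (simp add: energy_split distrib_left)
    also have "\<dots> \<le> (t\<^sup>2) ^ j * (C / s ^ (n + j))"
      using v[of "n + j"] t unfolding ths by (intro mult_left_mono) auto
    finally show ?thesis unfolding weight .
  qed
  have e_le: "e w j \<le> C / s ^ n * (1 / t\<^sup>2) ^ j" if "w \<in> W (m * n)" for w n j
  proof -
    have "e w j \<le> (\<Sum>w\<in>W (m * n). e w j)" using that e0 by (intro member_le_sum) auto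
    then show ?thesis using e_sum[where n = n and j = j] by linarith
  qed
  have geo: "summable (\<lambda>j. C / s ^ n * (1 / t\<^sup>2) ^ j)" for n
    using G by (intro summable_mult) (rule sums_summable)
  have e_summable: "summable (e w)" if "w \<in> W (m * n)" for w n
    using e_le[OF that] e0 by (intro summable_comparison_test'[OF geo[of n], of 0]) auto
  define A where "A w = (\<Sum>j. e w j)" for w
  \<comment> \<open>Only words of length divisible by \<open>m\<close> matter; the maximum makes all other values nonnegative.\<close>
  define B where "B w = max 0 (4 * c\<^sup>2 * G * A w)" for w
  have A0: "0 \<le> A w" if "w \<in> W (m * n)" for w n
    unfolding A_def using e_summable[OF that] e0 by (intro suminf_nonneg)
  have B_eq: "B w = 4 * c\<^sup>2 * G * A w" if "w \<in> W (m * n)" for w n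
    unfolding B_def using A0[OF that] G0 by simp
  define C' where "C' = 4 * c\<^sup>2 * G * (C * G)"
  obtain p where p: "p \<in> V 0" using V0_nonempty by blast
  have one: "\<bar>v (\<Phi> w x) - v (\<Phi> w p)\<bar> \<le> c * sqrt (G * A w)" if w: "w \<in> W (m * n)" and x: "x \<in> Vs" for w n x
  proof -
    obtain k0 where "x \<in> V k0" using x by (auto simp: all_vertices_def)
    then have "x \<in> V (m * k0)" using V_mono[of k0 "m * k0"] m by auto
    from c(2)[OF p this, of "\<lambda>x. v (\<Phi> w x)"]
    have "\<bar>v (\<Phi> w x) - v (\<Phi> w p)\<bar> \<le> c * (\<Sum>j\<le>k0. sqrt (E (m * j) (\<lambda>x. v (\<Phi> w x))))" .
    also have "\<dots> \<le> c * sqrt (G * A w)"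
    proof (intro mult_left_mono c(1) real_le_rsqrt)
      have "(\<Sum>j\<le>k0. sqrt (E (m * j) (\<lambda>x. v (\<Phi> w x))))
          = (\<Sum>j\<le>k0. (1 / t) ^ j * (t ^ j * sqrt (E (m * j) (\<lambda>x. v (\<Phi> w x)))))"
        using t by (intro sum.cong refl) (simp add: power_one_over)
      also have "\<dots>\<^sup>2 \<le> (\<Sum>j\<le>k0. ((1 / t) ^ j)\<^sup>2) * (\<Sum>j\<le>k0. (t ^ j * sqrt (E (m * j) (\<lambda>x. v (\<Phi> w x))))\<^sup>2)"
        by (rule Cauchy_Schwarz_ineq_sum)
      also have "(\<Sum>j\<le>k0. ((1 / t) ^ j)\<^sup>2) = (\<Sum>j\<le>k0. (1 / t\<^sup>2) ^ j)"
        by (simp add: power_one_over power_mult[symmetric] mult.commute)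
      also have "(\<Sum>j\<le>k0. (t ^ j * sqrt (E (m * j) (\<lambda>x. v (\<Phi> w x))))\<^sup>2) = (\<Sum>j\<le>k0. e w j)"
        unfolding e_def by (simp add: power_mult_distrib energy_nonneg power_mult[symmetric] mult.commute)
      also have "(\<Sum>j\<le>k0. (1 / t\<^sup>2) ^ j) * (\<Sum>j\<le>k0. e w j) \<le> G * A w"
      proof (intro mult_mono)
        have "(\<Sum>j\<le>k0. (1 / t\<^sup>2) ^ j) \<le> (\<Sum>j. (1 / t\<^sup>2) ^ j)"
          using G t2' by (intro sum_le_suminf) (auto intro: sums_summable)
        then show "(\<Sum>j\<le>k0. (1 / t\<^sup>2) ^ j) \<le> G" using sums_unique[OF G] by simp
        show "(\<Sum>j\<le>k0. e w j) \<le> A w"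
          unfolding A_def using e_summable[OF w] e0 by (intro sum_le_suminf) auto
      qed (use G0 e0 in \<open>auto intro: sum_nonneg\<close>)
      finally show "(\<Sum>j\<le>k0. sqrt (E (m * j) (\<lambda>x. v (\<Phi> w x))))\<^sup>2 \<le> G * A w" .
    qed
    finally show ?thesis .
  qed
  have "(v (\<Phi> w x) - v (\<Phi> w y))\<^sup>2 \<le> B w" if w: "w \<in> W (m * n)" and xy: "x \<in> Vs" "y \<in> Vs" for n w x y
  proof -
    have "\<bar>v (\<Phi> w x) - v (\<Phi> w y)\<bar> \<le> 2 * c * sqrt (G * A w)"
      using one[OF w xy(1)] one[OF w xy(2)] by linarith
    then have "\<bar>v (\<Phi> w x) - v (\<Phi> w y)\<bar>\<^sup>2 \<le> (2 * c * sqrt (G * A w))\<^sup>2" by (rule power_mono) simp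
    also have "\<dots> = B w" using G0 A0[OF w] B_eq[OF w] by (simp add: power_mult_distrib)
    finally show ?thesis by simp
  qed
  moreover have "(\<Sum>w\<in>W (m * n). B w) \<le> C' / \<theta> ^ (m * n)" for n
  proof -
    have "(\<Sum>w\<in>W (m * n). A w) = (\<Sum>j. \<Sum>w\<in>W (m * n). e w j)"
      unfolding A_def using e_summable by (intro suminf_sum[symmetric])
    also have "\<dots> \<le> (\<Sum>j. C / s ^ n * (1 / t\<^sup>2) ^ j)"
      using e_sum e_summable geo by (intro suminf_le summable_sum) auto
    also have "\<dots> = C / s ^ n * G" using sums_unique[OF sums_mult[OF G]] by simp
    finally have "4 * c\<^sup>2 * G * (\<Sum>w\<in>W (m * n). A w) \<le> 4 * c\<^sup>2 * G * (C / s ^ n * G)"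
      using G0 by (intro mult_left_mono) auto
    then show ?thesis using B_eq by (simp add: sum_distrib_left ths C'_def mult_ac cong: sum.cong)
  qed
  moreover have "0 \<le> B w" for w by (simp add: B_def)
  moreover have "0 \<le> C'" using C G0 by (simp add: C'_def)
  ultimately show thesis using that by blast
qed

lemma closure_Vs: "closure Vs = K"
proof
  show "closure Vs \<subseteq> K" using Vs_subset_K compact_K by (intro closure_minimal compact_imp_closed)
  show "K \<subseteq> closure Vs"
  proof
    fix x assume x: "x \<in> K"
    show "x \<in> closure Vs"
      unfolding closure_approachable
    proof (intro allI impI)
      fix e :: real assume "0 < e"
      then have "\<forall>\<^sub>F n in sequentially. \<rho> ^ n * diameter K < e"
        using power_rho_tendsto_0 by (intro order_tendstoD) auto
      then obtain n where n: "\<rho> ^ n * diameter K < e" by (auto simp: eventually_sequentially)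
      obtain w y where w: "w \<in> W n" "y \<in> K" "x = \<Phi> w y" using in_cellE[OF x] by metis
      obtain p where p: "p \<in> V 0" using V0_nonempty by blast
      have "dist (\<Phi> w p) x \<le> \<rho> ^ n * diameter K"
        using w p V0_subset_K by (intro dist_cell[OF w(1)]) auto
      moreover have "\<Phi> w p \<in> Vs" using \<Phi>_in_Vs[OF w(1)] p V_subset_Vs by blast
      ultimately show "\<exists>y\<in>Vs. dist y x < e" using n by (meson le_less_trans)
    qed
  qed
qed

text \<open>
  Two vertices at distance below the separation constant of a level lie in meeting cells, which share
  a vertex, so the oscillation bounds give uniform continuity on the dense set \<open>V\<^sub>*\<close>. Bounds on a
  cell pass to the limit.
\<close>

lemma continuous_extension:
  fixes v :: "'a \<Rightarrow> real"
  assumes m: "0 < m" and \<theta>: "1 < \<theta>" and C: "0 \<le> C" and B: "\<And>w. 0 \<le> B w"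
    and osc: "\<And>n w x y. w \<in> W (m * n) \<Longrightarrow> x \<in> Vs \<Longrightarrow> y \<in> Vs \<Longrightarrow> (v (\<Phi> w x) - v (\<Phi> w y))\<^sup>2 \<le> B w"
    and sum: "\<And>n. (\<Sum>w\<in>W (m * n). B w) \<le> C / \<theta> ^ (m * n)"
  obtains u where "continuous_on K u" "\<And>x. x \<in> Vs \<Longrightarrow> u x = v x"
    "\<And>n w x y. w \<in> W (m * n) \<Longrightarrow> x \<in> K \<Longrightarrow> y \<in> K \<Longrightarrow> (u (\<Phi> w x) - u (\<Phi> w y))\<^sup>2 \<le> B w"
    "\<And>n w lo hi x. w \<in> W n \<Longrightarrow> (\<And>x. x \<in> Vs \<Longrightarrow> lo \<le> v (\<Phi> w x) \<and> v (\<Phi> w x) \<le> hi) \<Longrightarrow> x \<in> K \<Longrightarrow>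
       lo \<le> u (\<Phi> w x) \<and> u (\<Phi> w x) \<le> hi"
proof -
  obtain c where c: "0 < c" "\<And>n v w x y. v \<in> W n \<Longrightarrow> w \<in> W n \<Longrightarrow> \<not> adj v w \<Longrightarrow>
      x \<in> cell v \<Longrightarrow> y \<in> cell w \<Longrightarrow> c * \<rho> ^ n \<le> dist x y"
    using cells_separated by metis
  have "uniformly_continuous_on Vs v"
    unfolding uniformly_continuous_on_def
  proof (intro allI impI)
    fix e :: real assume e: "0 < e"
    have "(\<lambda>n. C * (1 / \<theta> ^ m) ^ n) \<longlonglongrightarrow> 0"
      using \<theta> m by (intro tendsto_mult_right_zero LIMSEQ_power_zero) (simp add: one_less_power)
    then have "\<forall>\<^sub>F n in sequentially. C * (1 / \<theta> ^ m) ^ n < (e / 2)\<^sup>2"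
      using e by (intro order_tendstoD) auto
    then obtain n where n: "C * (1 / \<theta> ^ m) ^ n < (e / 2)\<^sup>2" by (auto simp: eventually_sequentially)
    have Bn: "B w < (e / 2)\<^sup>2" if "w \<in> W (m * n)" for w
    proof -
      have "B w \<le> (\<Sum>w\<in>W (m * n). B w)" using that B by (intro member_le_sum) auto
      also have "\<dots> \<le> C / \<theta> ^ (m * n)" by (rule sum)
      also have "\<dots> = C * (1 / \<theta> ^ m) ^ n" by (simp add: power_mult power_one_over)
      finally show ?thesis using n by linarith
    qed
    have small: "\<bar>v (\<Phi> w x) - v (\<Phi> w y)\<bar> < e / 2" if "w \<in> W (m * n)" "x \<in> Vs" "y \<in> Vs" for w x y
    proof -
      have "\<bar>v (\<Phi> w x) - v (\<Phi> w y)\<bar>\<^sup>2 < (e / 2)\<^sup>2"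
        unfolding power2_abs using osc[OF that] Bn[OF that(1)] by (rule order_le_less_trans)
      then show ?thesis by (rule power_less_imp_less_base) (use e in simp)
    qed
    have "dist (v x') (v x) < e" if x: "x \<in> Vs" "x' \<in> Vs" and d: "dist x' x < c * \<rho> ^ (m * n)" for x x'
    proof -
      have ex: "\<exists>w z. w \<in> W (m * n) \<and> z \<in> Vs \<and> x = \<Phi> w z" if x: "x \<in> Vs" for x
      proof -
        obtain k where "x \<in> V k" using x by (auto simp: all_vertices_def)
        then have "x \<in> V (m * n + k)" using V_mono[of k "m * n + k"] by auto
        then show ?thesis unfolding V_add using V_subset_Vs by blast
      qed
      obtain w z w' z' where w: "w \<in> W (m * n)" "z \<in> Vs" "x = \<Phi> w z"
          and w': "w' \<in> W (m * n)" "z' \<in> Vs" "x' = \<Phi> w' z'"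
        using ex[OF x(1)] ex[OF x(2)] by blast
      have "adj w w'"
      proof (rule ccontr)
        assume "\<not> adj w w'"
        from c(2)[OF w(1) w'(1) this, of x x'] show False
          using d w w' Vs_subset_K by (auto simp: dist_commute)
      qed
      then obtain p q where pq: "p \<in> V 0" "q \<in> V 0" "\<Phi> w p = \<Phi> w' q"
        using adj_vertex[OF w(1) w'(1)] by blast
      then have Vs: "p \<in> Vs" "q \<in> Vs" using V_subset_Vs by blast+
      have "\<bar>v x - v (\<Phi> w p)\<bar> < e / 2" "\<bar>v x' - v (\<Phi> w p)\<bar> < e / 2"
        using small[OF w(1,2) Vs(1)] small[OF w'(1,2) Vs(2)] w(3) w'(3) pq(3) by simp_all
      then show ?thesis unfolding dist_real_def by linarith
    qed
    moreover have "0 < c * \<rho> ^ (m * n)" using c(1) rho_pos by simp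
    ultimately show "\<exists>d>0. \<forall>x\<in>Vs. \<forall>x'\<in>Vs. dist x' x < d \<longrightarrow> dist (v x') (v x) < e" by blast
  qed
  then obtain u where u: "uniformly_continuous_on (closure Vs) u" "\<And>x. x \<in> Vs \<Longrightarrow> v x = u x"
    using uniformly_continuous_on_extension_on_closure by metis
  have cont: "continuous_on K u" using uniformly_continuous_imp_continuous[OF u(1)] by (simp add: closure_Vs)
  have lim: "\<exists>X. (\<forall>k. X k \<in> Vs) \<and> (\<forall>n. \<forall>w\<in>W n. (\<lambda>k. v (\<Phi> w (X k))) \<longlonglongrightarrow> u (\<Phi> w x))" if x: "x \<in> K" for x
  proof -
    have "x \<in> closure Vs" using x by (simp only: closure_Vs)
    then obtain X where X: "\<And>k. X k \<in> Vs" "X \<longlonglongrightarrow> x"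
      unfolding closure_sequential by blast
    have "(\<lambda>k. v (\<Phi> w (X k))) \<longlonglongrightarrow> u (\<Phi> w x)" if w: "w \<in> W n" for n w
    proof -
      have "continuous_on K (\<lambda>x. u (\<Phi> w x))"
        using continuous_on_compose2[OF cont continuous_\<Phi>[OF w, of K]] \<Phi>_in_K[OF w] by blast
      then have "(\<lambda>k. u (\<Phi> w (X k))) \<longlonglongrightarrow> u (\<Phi> w x)"
        using X x Vs_subset_K unfolding continuous_on_sequentially comp_def by blast
      moreover have "u (\<Phi> w (X k)) = v (\<Phi> w (X k))" for k using u(2) \<Phi>_in_Vs[OF w X(1)] by simp
      ultimately show ?thesis by simp
    qed
    with X(1) show ?thesis by blast
  qed
  have "(u (\<Phi> w x) - u (\<Phi> w y))\<^sup>2 \<le> B w" if w: "w \<in> W (m * n)" and xy: "x \<in> K" "y \<in> K" for n w x y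
  proof -
    obtain X Y where X: "\<And>k. X k \<in> Vs" "(\<lambda>k. v (\<Phi> w (X k))) \<longlonglongrightarrow> u (\<Phi> w x)"
        and Y: "\<And>k. Y k \<in> Vs" "(\<lambda>k. v (\<Phi> w (Y k))) \<longlonglongrightarrow> u (\<Phi> w y)"
      using lim[OF xy(1)] lim[OF xy(2)] w by blast
    have "(\<lambda>k. (v (\<Phi> w (X k)) - v (\<Phi> w (Y k)))\<^sup>2) \<longlonglongrightarrow> (u (\<Phi> w x) - u (\<Phi> w y))\<^sup>2"
      by (intro tendsto_intros X Y)
    then show ?thesis using osc[OF w X(1) Y(1)] by (intro LIMSEQ_le_const2) auto
  qed
  moreover have "lo \<le> u (\<Phi> w x) \<and> u (\<Phi> w x) \<le> hi"
    if w: "w \<in> W n" and lohi: "\<And>x. x \<in> Vs \<Longrightarrow> lo \<le> v (\<Phi> w x) \<and> v (\<Phi> w x) \<le> hi" and x: "x \<in> K" for n w lo hi x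
  proof -
    obtain X where X: "\<And>k. X k \<in> Vs" "(\<lambda>k. v (\<Phi> w (X k))) \<longlonglongrightarrow> u (\<Phi> w x)"
      using lim[OF x] w by blast
    have "lo \<le> u (\<Phi> w x)" using X(2) lohi X(1) by (intro LIMSEQ_le_const) auto
    moreover have "u (\<Phi> w x) \<le> hi" using X(2) lohi X(1) by (intro LIMSEQ_le_const2) auto
    ultimately show ?thesis ..
  qed
  ultimately show thesis using that cont u(2) by metis
qed

end

context pcf_ifs_measure
begin

text \<open>
  Points at distance less than \<open>c \<rho>\<^sup>n\<close> lie in the same or in two meeting cells of level \<open>n\<close>, and every
  cell meets boundedly many others.
\<close>

lemma oscillation_imp_besov:
  assumes m: "0 < m" and \<theta>: "1 < \<theta>" and C: "0 \<le> C" and B: "\<And>w. 0 \<le> B w"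
    and u: "continuous_on K u"
    and osc: "\<And>n w x y. w \<in> W (m * n) \<Longrightarrow> x \<in> K \<Longrightarrow> y \<in> K \<Longrightarrow> (u (\<Phi> w x) - u (\<Phi> w y))\<^sup>2 \<le> B w"
    and sum: "\<And>n. (\<Sum>w\<in>W (m * n). B w) \<le> C / \<theta> ^ (m * n)"
    and \<sigma>: "0 < \<sigma>" "1 \<le> \<theta> * \<rho> powr (2 * \<sigma> - \<alpha>)"
  shows "u \<in> besov \<alpha> \<mu> \<sigma>"
proof -
  obtain c where c: "0 < c" "\<And>n v w x y. v \<in> W n \<Longrightarrow> w \<in> W n \<Longrightarrow> \<not> adj v w \<Longrightarrow>
      x \<in> cell v \<Longrightarrow> y \<in> cell w \<Longrightarrow> c * \<rho> ^ n \<le> dist x y"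
    using cells_separated by metis
  define \<beta> where "\<beta> = \<alpha> + 2 * \<sigma>"
  have \<beta>: "0 < \<beta>" using \<sigma> \<alpha>_pos by (simp add: \<beta>_def)
  define M where "M = real (card shifts)"
  define D where "D = 4 * M * C * (1 / (c * \<rho> ^ m)) powr \<beta>"
  have meas: "u \<in> borel_measurable \<mu>" using u by (rule continuous_on_borel_mu)
  have level: "osc_int u r \<le> ennreal (4 * M * C * (\<rho> ^ (m * n)) powr \<beta>)" if n: "n = 0 \<or> r \<le> c * \<rho> ^ (m * n)" for n r
  proof -
    define l where "l = m * n"
    have pair: "(\<integral>\<^sup>+s. \<integral>\<^sup>+t. ennreal ((u (\<Phi> v s) - u (\<Phi> w t))\<^sup>2) * indicator (ball (\<Phi> v s) r) (\<Phi> w t) \<partial>\<mu> \<partial>\<mu>)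
        \<le> (if adj v w then ennreal (2 * B v + 2 * B w) else 0)" if vw: "v \<in> W l" "w \<in> W l" for v w
    proof -
      have "ennreal ((u (\<Phi> v s) - u (\<Phi> w t))\<^sup>2) * indicator (ball (\<Phi> v s) r) (\<Phi> w t)
          \<le> (if adj v w then ennreal (2 * B v + 2 * B w) else 0)" if st: "s \<in> K" "t \<in> K" for s t
      proof (cases "adj v w")
        case True
        then obtain p q where pq: "p \<in> V 0" "q \<in> V 0" "\<Phi> v p = \<Phi> w q" using adj_vertex[OF vw] by blast
        then have K: "p \<in> K" "q \<in> K" using V0_subset_K by auto
        have "(u (\<Phi> v s) - u (\<Phi> w t))\<^sup>2 \<le> 2 * (u (\<Phi> v s) - u (\<Phi> v p))\<^sup>2 + 2 * (u (\<Phi> w q) - u (\<Phi> w t))\<^sup>2"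
          using sq_add_le[of "u (\<Phi> v s) - u (\<Phi> v p)" "u (\<Phi> w q) - u (\<Phi> w t)"] pq(3) by simp
        also have "\<dots> \<le> 2 * B v + 2 * B w"
          using osc[of v n s p] osc[of w n q t] vw st K by (simp add: l_def)
        finally show ?thesis using True by (auto simp: indicator_def intro: ennreal_leI)
      next
        case False
        have "n \<noteq> 0"
        proof
          assume "n = 0"
          then have "v = w" using vw by (simp add: l_def)
          with False show False by simp
        qed
        then have "r \<le> dist (\<Phi> v s) (\<Phi> w t)" using c(2)[OF vw False, of "\<Phi> v s" "\<Phi> w t"] st n by (simp add: l_def)
        then show ?thesis by (simp add: indicator_def)
      qed
      then have "(\<integral>\<^sup>+s. \<integral>\<^sup>+t. ennreal ((u (\<Phi> v s) - u (\<Phi> w t))\<^sup>2) * indicator (ball (\<Phi> v s) r) (\<Phi> w t) \<partial>\<mu> \<partial>\<mu>)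
          \<le> (\<integral>\<^sup>+s. \<integral>\<^sup>+t. (if adj v w then ennreal (2 * B v + 2 * B w) else 0) \<partial>\<mu> \<partial>\<mu>)"
        by (intro nn_integral_mono) (auto simp: space_mu)
      then show ?thesis by (simp add: emeasure_space_1)
    qed
    have sums: "(\<Sum>v\<in>W l. \<Sum>w\<in>W l. if adj v w then 2 * B v + 2 * B w else 0) \<le> 4 * M * (\<Sum>w\<in>W l. B w)"
    proof -
      have half: "(\<Sum>v\<in>W l. \<Sum>w\<in>W l. if adj v w then 2 * B v else 0) \<le> 2 * M * (\<Sum>v\<in>W l. B v)"
        unfolding sum_distrib_left
      proof (rule sum_mono)
        fix v assume v: "v \<in> W l"
        have "(\<Sum>w\<in>W l. if adj v w then 2 * B v else 0) = real (card {w \<in> W l. adj v w}) * (2 * B v)"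
          by (simp add: sum.If_cases Int_def)
        also have "\<dots> \<le> M * (2 * B v)"
          using card_adj[OF v] B[of v] unfolding M_def by (intro mult_right_mono) auto
        finally show "(\<Sum>w\<in>W l. if adj v w then 2 * B v else 0) \<le> 2 * M * B v" by simp
      qed
      have "(\<Sum>v\<in>W l. \<Sum>w\<in>W l. if adj v w then 2 * B w else 0) = (\<Sum>w\<in>W l. \<Sum>v\<in>W l. if adj w v then 2 * B w else 0)"
        by (subst sum.swap) (auto intro!: sum.cong dest: adj_sym)
      with half have half': "(\<Sum>v\<in>W l. \<Sum>w\<in>W l. if adj v w then 2 * B w else 0) \<le> 2 * M * (\<Sum>v\<in>W l. B v)" by simp
      have "(\<Sum>v\<in>W l. \<Sum>w\<in>W l. if adj v w then 2 * B v + 2 * B w else 0)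
          = (\<Sum>v\<in>W l. \<Sum>w\<in>W l. if adj v w then 2 * B v else 0) + (\<Sum>v\<in>W l. \<Sum>w\<in>W l. if adj v w then 2 * B w else 0)"
        unfolding sum.distrib[symmetric] by (intro sum.cong refl) auto
      with half half' show ?thesis by linarith
    qed
    have "ennreal (real N ^ l * real N ^ l) * osc_int u r
        \<le> (\<Sum>v\<in>W l. \<Sum>w\<in>W l. if adj v w then ennreal (2 * B v + 2 * B w) else 0)"
      unfolding osc_int_cells[OF meas] by (intro sum_mono pair)
    also have "\<dots> = (\<Sum>v\<in>W l. \<Sum>w\<in>W l. ennreal (if adj v w then 2 * B v + 2 * B w else 0))"
      by (intro sum.cong refl) auto
    also have "\<dots> = ennreal (\<Sum>v\<in>W l. \<Sum>w\<in>W l. if adj v w then 2 * B v + 2 * B w else 0)"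
      using B by (simp add: sum_nonneg)
    also have "\<dots> \<le> ennreal (4 * M * (C / \<theta> ^ l))"
    proof (rule ennreal_leI)
      have "4 * M * (\<Sum>w\<in>W l. B w) \<le> 4 * M * (C / \<theta> ^ l)"
        unfolding l_def using sum by (intro mult_left_mono) (auto simp: M_def)
      with sums show "(\<Sum>v\<in>W l. \<Sum>w\<in>W l. if adj v w then 2 * B v + 2 * B w else 0) \<le> 4 * M * (C / \<theta> ^ l)" by linarith
    qed
    finally have "ennreal (1 / (real N ^ l * real N ^ l)) * (ennreal (real N ^ l * real N ^ l) * osc_int u r)
        \<le> ennreal (1 / (real N ^ l * real N ^ l)) * ennreal (4 * M * (C / \<theta> ^ l))"
      by (rule mult_left_mono) simp
    moreover have "ennreal (1 / (real N ^ l * real N ^ l)) * (ennreal (real N ^ l * real N ^ l) * osc_int u r) = osc_int u r"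
      using N_pos by (simp add: mult.assoc[symmetric] ennreal_mult[symmetric])
    moreover have "ennreal (1 / (real N ^ l * real N ^ l)) * ennreal (4 * M * (C / \<theta> ^ l))
        = ennreal (1 / (real N ^ l * real N ^ l) * (4 * M * (C / \<theta> ^ l)))"
      using C \<theta> by (intro ennreal_mult[symmetric]) (auto simp: M_def)
    ultimately have "osc_int u r \<le> ennreal (1 / (real N ^ l * real N ^ l) * (4 * M * (C / \<theta> ^ l)))" by simp
    also have "\<dots> \<le> ennreal (4 * M * C * (\<rho> ^ l) powr \<beta>)"
    proof (rule ennreal_leI)
      have "\<rho> powr \<beta> = \<rho> powr \<alpha> * \<rho> powr \<alpha> * \<rho> powr (2 * \<sigma> - \<alpha>)"
        by (simp add: \<beta>_def powr_add[symmetric])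
      also have "\<dots> = 1 / (real N * real N) * \<rho> powr (2 * \<sigma> - \<alpha>)" by (simp add: rho_powr_\<alpha>)
      finally have "1 / (real N * real N) * (1 / \<theta>) \<le> \<rho> powr \<beta>"
        using \<sigma>(2) \<theta> N_pos by (simp add: field_simps)
      then have "(1 / (real N * real N) * (1 / \<theta>)) ^ l \<le> (\<rho> powr \<beta>) ^ l"
        using \<theta> by (intro power_mono) auto
      then have "4 * M * C * (1 / (real N * real N) * (1 / \<theta>)) ^ l \<le> 4 * M * C * (\<rho> ^ l) powr \<beta>"
        unfolding rho_power_powr using C by (intro mult_left_mono) (auto simp: M_def)
      then show "1 / (real N ^ l * real N ^ l) * (4 * M * (C / \<theta> ^ l)) \<le> 4 * M * C * (\<rho> ^ l) powr \<beta>"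
        by (simp add: power_mult_distrib power_divide mult_ac)
    qed
    finally show ?thesis by (simp add: l_def)
  qed
  have bound: "osc_int u r \<le> ennreal (D * r powr \<beta>)" if r: "0 < r" for r
  proof -
    \<comment> \<open>At level 0 there is a single cell and the bound holds for every radius.\<close>
    obtain n where n: "n = 0 \<or> r \<le> c * \<rho> ^ (m * n)" "\<rho> ^ (m * n) \<le> r / (c * \<rho> ^ m)"
    proof (cases "r / c < 1")
      case True
      have "0 < \<rho> ^ m" "\<rho> ^ m < 1" using rho_pos rho_less_1 m by (simp_all add: power_Suc_less_one power_less_one_iff)
      then obtain n where "(\<rho> ^ m) ^ Suc n \<le> r / c" "r / c < (\<rho> ^ m) ^ n"
        using power_bracket[of "\<rho> ^ m" "r / c"] True r c by auto
      then show ?thesis using that[of n] c(1) rho_pos by (simp add: power_mult field_simps)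
    next
      case False
      have "\<rho> ^ m \<le> 1" using rho_pos rho_less_1 by (simp add: power_le_one)
      then have "c * \<rho> ^ m \<le> c" using c(1) by simp
      also have "c \<le> r" using False c(1) by (simp add: field_simps)
      finally show ?thesis using that[of 0] c(1) rho_pos by simp
    qed
    have "4 * M * C * (\<rho> ^ (m * n)) powr \<beta> \<le> 4 * M * C * (r / (c * \<rho> ^ m)) powr \<beta>"
      using n(2) \<beta> C rho_pos by (intro mult_left_mono powr_mono2) (auto simp: M_def)
    also have "(r / (c * \<rho> ^ m)) powr \<beta> = (1 / (c * \<rho> ^ m)) powr \<beta> * r powr \<beta>"
      by (simp add: powr_mult[symmetric])
    also have "4 * M * C * \<dots> = D * r powr \<beta>" by (simp add: D_def)
    finally show ?thesis using level[OF n(1)] by (meson ennreal_leI order_trans)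
  qed
  have "besov_seminorm_sq \<alpha> \<mu> \<sigma> u \<le> ennreal D"
    unfolding besov_seminorm_sq_def osc_int_def[symmetric]
  proof (rule SUP_least)
    fix r :: real assume r: "r \<in> {0<..<1}"
    have D: "0 \<le> D" using C by (simp add: D_def M_def)
    have "ennreal (r powr (- \<alpha> - 2 * \<sigma>)) * osc_int u r \<le> ennreal (r powr (- \<alpha> - 2 * \<sigma>)) * ennreal (D * r powr \<beta>)"
      using bound r by (intro mult_left_mono) auto
    also have "\<dots> = ennreal (r powr (- \<alpha> - 2 * \<sigma>) * (D * r powr \<beta>))"
      using D by (intro ennreal_mult[symmetric]) auto
    also have "r powr (- \<alpha> - 2 * \<sigma>) * (D * r powr \<beta>) = D * (r powr (- \<alpha> - 2 * \<sigma>) * r powr \<beta>)" by simp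
    also have "r powr (- \<alpha> - 2 * \<sigma>) * r powr \<beta> = 1"
      using r by (simp add: powr_add[symmetric] \<beta>_def)
    finally show "ennreal (r powr (- \<alpha> - 2 * \<sigma>)) * osc_int u r \<le> ennreal D" by simp
  qed
  then have "besov_seminorm_sq \<alpha> \<mu> \<sigma> u < \<infinity>" by (simp add: order_le_less_trans)
  then show ?thesis using continuous_in_L2[OF u] by (simp add: besov_def)
qed

end

section \<open>Density\<close>

context pcf_ifs_measure
begin

lemma L2_add: "f \<in> L2 \<mu> \<Longrightarrow> g \<in> L2 \<mu> \<Longrightarrow> (\<lambda>x. f x + g x) \<in> L2 \<mu>"
proof -
  assume f: "f \<in> L2 \<mu>" and g: "g \<in> L2 \<mu>"
  then have m[measurable]: "f \<in> borel_measurable \<mu>" "g \<in> borel_measurable \<mu>" by (auto simp: L2_def)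
  have "integrable \<mu> (\<lambda>x. 2 * (f x)\<^sup>2 + 2 * (g x)\<^sup>2)" using f g by (auto simp: L2_def)
  then have "integrable \<mu> (\<lambda>x. (f x + g x)\<^sup>2)"
    by (rule Bochner_Integration.integrable_bound) (use sq_add_le in auto)
  then show ?thesis by (simp add: L2_def)
qed

lemma L2_cmult: "f \<in> L2 \<mu> \<Longrightarrow> (\<lambda>x. c * f x) \<in> L2 \<mu>"
  by (auto simp: L2_def power_mult_distrib)

lemma L2_diff: "f \<in> L2 \<mu> \<Longrightarrow> g \<in> L2 \<mu> \<Longrightarrow> (\<lambda>x. f x - g x) \<in> L2 \<mu>"
  using L2_add[of f "\<lambda>x. (- 1) * g x"] L2_cmult[of g "- 1"] by simp

abbreviation sq_dist :: "('a \<Rightarrow> real) \<Rightarrow> ('a \<Rightarrow> real) \<Rightarrow> real" where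
  "sq_dist f g \<equiv> (\<integral>x. (f x - g x)\<^sup>2 \<partial>\<mu>)"

lemma L2_integral_triangle:
  assumes "f \<in> L2 \<mu>" "g \<in> L2 \<mu>" "h \<in> L2 \<mu>"
  shows "sq_dist f h \<le> 2 * sq_dist f g + 2 * sq_dist g h"
proof -
  have i: "integrable \<mu> (\<lambda>x. (f x - h x)\<^sup>2)" "integrable \<mu> (\<lambda>x. (f x - g x)\<^sup>2)" "integrable \<mu> (\<lambda>x. (g x - h x)\<^sup>2)"
    using L2_diff[OF assms(1,3)] L2_diff[OF assms(1,2)] L2_diff[OF assms(2,3)] by (auto simp: L2_def)
  have "sq_dist f h \<le> (\<integral>x. 2 * (f x - g x)\<^sup>2 + 2 * (g x - h x)\<^sup>2 \<partial>\<mu>)"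
  proof (rule integral_mono)
    show "(f x - h x)\<^sup>2 \<le> 2 * (f x - g x)\<^sup>2 + 2 * (g x - h x)\<^sup>2" for x
      using sq_add_le[of "f x - g x" "g x - h x"] by simp
  qed (use i in auto)
  also have "\<dots> = 2 * sq_dist f g + 2 * sq_dist g h" using i by simp
  finally show ?thesis .
qed

definition approximable :: "('a \<Rightarrow> real) \<Rightarrow> bool" where
  "approximable f \<longleftrightarrow> f \<in> L2 \<mu> \<and> (\<forall>\<epsilon>>0. \<exists>g. continuous_on K g \<and> sq_dist f g < \<epsilon>)"

text \<open>
  Inner regularity for the set and for its complement yields two disjoint compact sets that
  exhaust \<open>K\<close> up to small measure; a Urysohn function separates them.
\<close>

lemma approximable_indicator:
  assumes A: "A \<in> sets \<mu>" shows "approximable (indicator A)"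
proof -
  define \<nu> where "\<nu> = distr \<mu> borel (\<lambda>x. x)"
  have em: "emeasure \<nu> B = emeasure \<mu> (B \<inter> K)" if "B \<in> sets borel" for B
    unfolding \<nu>_def using measurable_id_mu that by (subst emeasure_distr) (auto simp: space_mu)
  have A_borel: "A \<in> sets borel"
  proof -
    have "A \<in> sets (restrict_space borel K)" using A unfolding sets_mu .
    then obtain B where "B \<in> sets borel" "A = K \<inter> B" unfolding sets_restrict_space by blast
    then show ?thesis using K_borel by blast
  qed
  have inner: "\<exists>C\<subseteq>B. compact C \<and> measure \<mu> ((B - C) \<inter> K) < \<delta>" if B: "B \<in> sets borel" and \<delta>: "0 < \<delta>" for B \<delta>
  proof -
    have "emeasure \<nu> (space \<nu>) \<noteq> \<infinity>"
      using em[of UNIV] emeasure_space_1 by (simp add: \<nu>_def space_mu)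
    then have "emeasure \<nu> B = (SUP C \<in> {C. C \<subseteq> B \<and> compact C}. emeasure \<nu> C)"
      using B by (intro inner_regular) (auto simp: \<nu>_def)
    then have sup: "(SUP C \<in> {C. C \<subseteq> B \<and> compact C}. emeasure \<nu> C) = ennreal (measure \<mu> (B \<inter> K))"
      using em[OF B] by (simp add: emeasure_eq_measure)
    have "\<exists>C. C \<subseteq> B \<and> compact C \<and> measure \<mu> (B \<inter> K) < measure \<mu> (C \<inter> K) + \<delta>"
    proof (cases "measure \<mu> (B \<inter> K) < \<delta>")
      case True
      then show ?thesis by (intro exI[of _ "{}"]) simp
    next
      case False
      then have "ennreal (measure \<mu> (B \<inter> K) - \<delta>) < (SUP C \<in> {C. C \<subseteq> B \<and> compact C}. emeasure \<nu> C)"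
        unfolding sup using \<delta> by (intro ennreal_lessI) auto
      then obtain C where C: "C \<subseteq> B" "compact C" "ennreal (measure \<mu> (B \<inter> K) - \<delta>) < emeasure \<nu> C"
        unfolding less_SUP_iff by blast
      have "emeasure \<nu> C = ennreal (measure \<mu> (C \<inter> K))"
        using em[of C] C(2) by (simp add: emeasure_eq_measure borel_compact)
      with C(3) False have "measure \<mu> (B \<inter> K) - \<delta> < measure \<mu> (C \<inter> K)" by (simp add: ennreal_less_iff)
      with C show ?thesis by (intro exI[of _ C]) auto
    qed
    then obtain C where C: "C \<subseteq> B" "compact C" "measure \<mu> (B \<inter> K) < measure \<mu> (C \<inter> K) + \<delta>" by blast
    have "(B - C) \<inter> K = B \<inter> K - C \<inter> K" by blast
    then have "measure \<mu> ((B - C) \<inter> K) = measure \<mu> (B \<inter> K) - measure \<mu> (C \<inter> K)"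
    proof (simp only:, intro finite_measure_Diff in_sets_mu)
      show "C \<inter> K \<subseteq> B \<inter> K" using C(1) by blast
    qed (use B C(2) borel_compact in auto)
    with C show ?thesis by (intro exI[of _ C]) auto
  qed
  have L2: "indicator A \<in> L2 \<mu>"
    using A by (intro L2_bounded[of _ 1]) (auto simp: indicator_def)
  have "\<exists>g. continuous_on K g \<and> (\<integral>x. (indicator A x - g x)\<^sup>2 \<partial>\<mu>) < \<epsilon>" if \<epsilon>: "0 < \<epsilon>" for \<epsilon> :: real
  proof -
    obtain C where C: "C \<subseteq> A" "compact C" "measure \<mu> ((A - C) \<inter> K) < \<epsilon> / 2"
      using inner[OF A_borel, of "\<epsilon> / 2"] \<epsilon> by auto
    obtain D where D: "D \<subseteq> - A" "compact D" "measure \<mu> ((- A - D) \<inter> K) < \<epsilon> / 2"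
      using inner[of "- A" "\<epsilon> / 2"] A_borel \<epsilon> by auto
    obtain g :: "'a \<Rightarrow> real" where g: "continuous_on UNIV g" "\<And>x. g x \<in> closed_segment 1 0"
        "\<And>x. x \<in> C \<Longrightarrow> g x = 1" "\<And>x. x \<in> D \<Longrightarrow> g x = 0"
      using Urysohn_local[of UNIV C D "1::real" 0] C D by (auto simp: compact_imp_closed)
    have g01: "0 \<le> g x \<and> g x \<le> 1" for x using g(2)[of x] by (simp add: closed_segment_eq_real_ivl)
    have gK: "continuous_on K g" using g(1) continuous_on_subset by blast
    define X where "X = (A - C) \<inter> K \<union> (- A - D) \<inter> K"
    have sets: "(A - C) \<inter> K \<in> sets \<mu>" "(- A - D) \<inter> K \<in> sets \<mu>"
      using A_borel C D borel_compact[of C] borel_compact[of D] by (auto intro!: in_sets_mu sets.Diff)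
    then have X: "X \<in> sets \<mu>" by (simp add: X_def)
    have "(\<integral>x. (indicator A x - g x)\<^sup>2 \<partial>\<mu>) \<le> (\<integral>x. indicator X x \<partial>\<mu>)"
    proof (rule integral_mono)
      show "integrable \<mu> (\<lambda>x. (indicator A x - g x)\<^sup>2)"
        using L2_diff[OF L2 continuous_in_L2[OF gK]] by (simp add: L2_def)
      show "integrable \<mu> (indicat_real X)" using X by (simp add: emeasure_eq_measure)
      fix x assume "x \<in> space \<mu>"
      then have x: "x \<in> K" by (simp add: space_mu)
      have "\<bar>indicator A x - g x\<bar>\<^sup>2 \<le> 1\<^sup>2" using g01[of x] by (intro power_mono) (auto simp: indicator_def)
      then have le1: "(indicator A x - g x)\<^sup>2 \<le> 1" by simp
      show "(indicator A x - g x)\<^sup>2 \<le> indicat_real X x"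
      proof (cases "x \<in> X")
        case False
        then have "x \<in> A \<and> x \<in> C \<or> x \<notin> A \<and> x \<in> D" using x by (auto simp: X_def)
        then show ?thesis using g(3,4) by auto
      qed (use le1 in simp)
    qed
    also have "\<dots> = measure \<mu> X" using X by simp
    also have "\<dots> \<le> measure \<mu> ((A - C) \<inter> K) + measure \<mu> ((- A - D) \<inter> K)"
      unfolding X_def using sets by (intro measure_subadditive) (auto simp: emeasure_eq_measure)
    also have "\<dots> < \<epsilon>" using C(3) D(3) by simp
    finally show ?thesis using gK by blast
  qed
  with L2 show ?thesis by (simp add: approximable_def)
qed

lemma approximable_add:
  assumes f: "approximable f" and f': "approximable f'" shows "approximable (\<lambda>x. f x + f' x)"
  unfolding approximable_def
proof (intro conjI allI impI)
  show L2: "(\<lambda>x. f x + f' x) \<in> L2 \<mu>" using f f' L2_add by (auto simp: approximable_def)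
  fix \<epsilon> :: real assume \<epsilon>: "0 < \<epsilon>"
  have "0 < \<epsilon> / 4" using \<epsilon> by simp
  then obtain g g' where g: "continuous_on K g" "sq_dist f g < \<epsilon> / 4"
      and g': "continuous_on K g'" "sq_dist f' g' < \<epsilon> / 4"
    using f f' unfolding approximable_def by blast
  have L: "f \<in> L2 \<mu>" "f' \<in> L2 \<mu>" "g \<in> L2 \<mu>" "g' \<in> L2 \<mu>"
    using f f' g(1) g'(1) continuous_in_L2 by (auto simp: approximable_def)
  have "(\<integral>x. (f x + f' x - (g x + g' x))\<^sup>2 \<partial>\<mu>)
      \<le> 2 * (\<integral>x. (f x + f' x - (g x + f' x))\<^sup>2 \<partial>\<mu>) + 2 * (\<integral>x. (g x + f' x - (g x + g' x))\<^sup>2 \<partial>\<mu>)"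
    by (intro L2_integral_triangle L2_add L)
  also have "\<dots> < \<epsilon>" using g(2) g'(2) by simp
  finally show "\<exists>h. continuous_on K h \<and> (\<integral>x. (f x + f' x - h x)\<^sup>2 \<partial>\<mu>) < \<epsilon>"
    using g(1) g'(1) by (intro exI[of _ "\<lambda>x. g x + g' x"]) (auto intro: continuous_on_add)
qed

lemma approximable_cmult:
  assumes f: "approximable f" shows "approximable (\<lambda>x. c * f x)"
  unfolding approximable_def
proof (intro conjI allI impI)
  show "(\<lambda>x. c * f x) \<in> L2 \<mu>" using f L2_cmult by (auto simp: approximable_def)
  fix \<epsilon> :: real assume \<epsilon>: "0 < \<epsilon>"
  have "0 < \<epsilon> / (c\<^sup>2 + 1)" using \<epsilon> by (simp add: add_nonneg_pos)
  then obtain g where g: "continuous_on K g" "sq_dist f g < \<epsilon> / (c\<^sup>2 + 1)"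
    using f unfolding approximable_def by blast
  have "(\<integral>x. (c * f x - c * g x)\<^sup>2 \<partial>\<mu>) = c\<^sup>2 * sq_dist f g"
    by (simp add: right_diff_distrib[symmetric] power_mult_distrib)
  also have "\<dots> \<le> c\<^sup>2 * (\<epsilon> / (c\<^sup>2 + 1))" using g(2) by (intro mult_left_mono) auto
  also have "\<dots> < \<epsilon>"
  proof -
    have "c\<^sup>2 * \<epsilon> < \<epsilon> * (c\<^sup>2 + 1)" using \<epsilon> by (simp add: algebra_simps)
    moreover have "0 < c\<^sup>2 + 1" by (simp add: add_nonneg_pos)
    ultimately show ?thesis by (simp add: pos_divide_less_eq)
  qed
  finally show "\<exists>h. continuous_on K h \<and> (\<integral>x. (c * f x - h x)\<^sup>2 \<partial>\<mu>) < \<epsilon>"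
    using g(1) by (intro exI[of _ "\<lambda>x. c * g x"]) (auto intro: continuous_on_mult_left)
qed

lemma approximable_sum:
  assumes "finite I" "\<And>i. i \<in> I \<Longrightarrow> approximable (f i)" shows "approximable (\<lambda>x. \<Sum>i\<in>I. f i x)"
  using assms
proof (induction rule: finite_induct)
  case empty
  have "(\<lambda>x. 0) \<in> L2 \<mu>" by (simp add: L2_def)
  then show ?case unfolding approximable_def by (auto intro!: exI[of _ "\<lambda>x. 0"])
next
  case (insert i I)
  then show ?case using approximable_add[of "f i"] by simp
qed

lemma approximable_simple_function:
  assumes f: "simple_function \<mu> (f :: 'a \<Rightarrow> real)"
  obtains f' where "approximable f'" "\<And>x. x \<in> K \<Longrightarrow> f x = f' x"
proof -
  define f' where "f' x = (\<Sum>y\<in>f ` K. y * indicator (f -` {y} \<inter> K) x)" for x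
  have fin: "finite (f ` K)" and s: "\<And>y. f -` {y} \<inter> K \<in> sets \<mu>"
    using simple_functionD[OF f] by (auto simp: space_mu)
  have "approximable f'"
    unfolding f'_def by (intro approximable_sum fin approximable_cmult approximable_indicator s)
  moreover have "f x = f' x" if x: "x \<in> K" for x
  proof -
    have "f' x = (\<Sum>y\<in>f ` K. if y = f x then y else 0)"
      unfolding f'_def using x by (intro sum.cong refl) (auto simp: indicator_def)
    also have "\<dots> = f x" using fin x by (simp add: sum.delta)
    finally show ?thesis by simp
  qed
  ultimately show thesis using that by blast
qed

lemma continuous_dense_in_L2:
  assumes f: "f \<in> L2 \<mu>" shows "approximable f"
  unfolding approximable_def
proof (intro conjI allI impI f)
  fix \<epsilon> :: real assume \<epsilon>: "0 < \<epsilon>"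
  have m[measurable]: "f \<in> borel_measurable \<mu>" and i: "integrable \<mu> (\<lambda>x. (f x)\<^sup>2)" using f by (auto simp: L2_def)
  obtain s where "\<forall>i. simple_function \<mu> (s i)" "\<forall>x\<in>space \<mu>. (\<lambda>i. s i x) \<longlonglongrightarrow> f x"
      "\<forall>i. \<forall>x\<in>space \<mu>. dist (s i x) 0 \<le> 2 * dist (f x) 0"
    using borel_measurable_implies_sequence_metric[OF m, of 0] by blast
  then have s: "\<And>i. simple_function \<mu> (s i)" "\<And>x. x \<in> space \<mu> \<Longrightarrow> (\<lambda>i. s i x) \<longlonglongrightarrow> f x"
      "\<And>i x. x \<in> space \<mu> \<Longrightarrow> \<bar>s i x\<bar> \<le> 2 * \<bar>f x\<bar>"
    by (auto simp: dist_real_def)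
  have [measurable]: "s i \<in> borel_measurable \<mu>" for i using s(1) by (rule borel_measurable_simple_function)
  have "(\<lambda>i. \<integral>x. (f x - s i x)\<^sup>2 \<partial>\<mu>) \<longlonglongrightarrow> (\<integral>x. 0 \<partial>\<mu>)"
  proof (rule integral_dominated_convergence[where w = "\<lambda>x. 9 * (f x)\<^sup>2"])
    show "AE x in \<mu>. (\<lambda>i. (f x - s i x)\<^sup>2) \<longlonglongrightarrow> 0"
    proof (rule AE_I2)
      fix x assume "x \<in> space \<mu>"
      from tendsto_power[OF tendsto_diff[OF tendsto_const s(2)[OF this]], of "f x" 2]
      show "(\<lambda>i. (f x - s i x)\<^sup>2) \<longlonglongrightarrow> 0" by simp
    qed
    show "AE x in \<mu>. norm ((f x - s i x)\<^sup>2) \<le> 9 * (f x)\<^sup>2" for i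
    proof (rule AE_I2)
      fix x assume "x \<in> space \<mu>"
      then have "\<bar>f x - s i x\<bar> \<le> 3 * \<bar>f x\<bar>" using s(3)[of x i] by linarith
      then have "\<bar>f x - s i x\<bar>\<^sup>2 \<le> (3 * \<bar>f x\<bar>)\<^sup>2" by (rule power_mono) simp
      then show "norm ((f x - s i x)\<^sup>2) \<le> 9 * (f x)\<^sup>2" by (simp add: power_mult_distrib)
    qed
  qed (use i in auto)
  then have "\<forall>\<^sub>F i in sequentially. (\<integral>x. (f x - s i x)\<^sup>2 \<partial>\<mu>) < \<epsilon> / 4"
    using \<epsilon> by (intro order_tendstoD) auto
  then obtain i where i: "(\<integral>x. (f x - s i x)\<^sup>2 \<partial>\<mu>) < \<epsilon> / 4" by (auto simp: eventually_sequentially)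
  obtain h where h: "approximable h" "\<And>x. x \<in> K \<Longrightarrow> s i x = h x"
    using approximable_simple_function[OF s(1)] by blast
  have fh: "sq_dist f h < \<epsilon> / 4"
    using i h(2) by (subst Bochner_Integration.integral_cong[of _ _ _ "\<lambda>x. (f x - s i x)\<^sup>2"]) (auto simp: space_mu)
  have "0 < \<epsilon> / 4" using \<epsilon> by simp
  then obtain g where g: "continuous_on K g" "sq_dist h g < \<epsilon> / 4"
    using h(1) unfolding approximable_def by blast
  have "sq_dist f g \<le> 2 * sq_dist f h + 2 * sq_dist h g"
    using f h(1) g(1) continuous_in_L2 by (intro L2_integral_triangle) (auto simp: approximable_def)
  also have "\<dots> < \<epsilon>" using fh g(2) by simp
  finally show "\<exists>g. continuous_on K g \<and> sq_dist f g < \<epsilon>" using g(1) by blast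
qed

lemma besov_antimono:
  assumes "\<sigma> \<le> \<sigma>'" shows "besov \<alpha> \<mu> \<sigma>' \<subseteq> besov \<alpha> \<mu> \<sigma>"
proof -
  have "besov_seminorm_sq \<alpha> \<mu> \<sigma> u \<le> besov_seminorm_sq \<alpha> \<mu> \<sigma>' u" for u
    unfolding besov_seminorm_sq_def
  proof (rule SUP_subset_mono[OF subset_refl])
    fix r :: real assume "r \<in> {0<..<1}"
    then have "r powr (- \<alpha> - 2 * \<sigma>) \<le> r powr (- \<alpha> - 2 * \<sigma>')" using assms by (intro powr_mono') auto
    then show "ennreal (r powr (- \<alpha> - 2 * \<sigma>)) * (\<integral>\<^sup>+x. (\<integral>\<^sup>+y\<in>ball x r. ennreal (\<bar>u x - u y\<bar>\<^sup>2) \<partial>\<mu>) \<partial>\<mu>)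
      \<le> ennreal (r powr (- \<alpha> - 2 * \<sigma>')) * (\<integral>\<^sup>+x. (\<integral>\<^sup>+y\<in>ball x r. ennreal (\<bar>u x - u y\<bar>\<^sup>2) \<partial>\<mu>) \<partial>\<mu>)"
      by (intro mult_right_mono ennreal_leI) auto
  qed
  then show ?thesis unfolding besov_def by (auto intro: le_less_trans)
qed

lemma dense_in_L2_mono:
  "dense_in_L2 \<mu> (besov \<alpha> \<mu> \<sigma>') \<Longrightarrow> \<sigma> \<le> \<sigma>' \<Longrightarrow> dense_in_L2 \<mu> (besov \<alpha> \<mu> \<sigma>)"
  using besov_antimono[of \<sigma> \<sigma>'] unfolding dense_in_L2_def by (auto simp: besov_def) blast

end

locale pcf_ifs_measure_rel =
  pcf_ifs_measure N \<rho> b F K \<mu> + pcf_ifs_rel N \<rho> b F K S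
  for N :: nat and \<rho> :: real and b :: "nat \<Rightarrow> 'a::euclidean_space"
    and F :: "nat \<Rightarrow> 'a \<Rightarrow> 'a" and K :: "'a set" and \<mu> :: "'a measure" and S :: "('a \<times> 'a) set"
begin

lemma finite_boundary_classes: "finite (boundary_classes N F K S)"
  unfolding boundary_classes_eq using finite_V0 by simp

text \<open>
  There are finitely many boundary classes, so the closure of their union is the union of their
  closures, each of dimension less than that of \<open>K\<close>.
\<close>

lemma emeasure_closure_boundary_points:
  assumes dim: "Max ((\<lambda>J. hausdorff_dim (closure J)) ` boundary_classes N F K S) < hausdorff_dim K"
  shows "emeasure \<mu> (closure boundary_points) = 0"
proof -
  have sub: "closure J \<subseteq> K" if "J \<in> boundary_classes N F K S" for J
  proof -
    have "J \<subseteq> Vs" using that boundary_points_subset by (auto simp: boundary_points_def)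
    then show ?thesis using closure_Vs closure_mono by blast
  qed
  have zero: "emeasure \<mu> (closure J) = 0" if J: "J \<in> boundary_classes N F K S" for J
  proof (rule emeasure_0_if_dim_less)
    have "hausdorff_dim (closure J) \<le> Max ((\<lambda>J. hausdorff_dim (closure J)) ` boundary_classes N F K S)"
      using J finite_boundary_classes by (intro Max_ge) auto
    then show "hausdorff_dim (closure J) < hausdorff_dim K" using dim by linarith
  qed (use sub[OF J] in auto)
  have closed: "closed (\<Union>J\<in>boundary_classes N F K S. closure J)"
    using finite_boundary_classes by (intro closed_UN) auto
  have "closure boundary_points \<subseteq> (\<Union>J\<in>boundary_classes N F K S. closure J)"
    unfolding boundary_points_def using closed closure_subset by (intro closure_minimal) blast+
  then have "emeasure \<mu> (closure boundary_points) \<le> emeasure \<mu> (\<Union>J\<in>boundary_classes N F K S. closure J)"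
    using closed sub by (intro emeasure_mono closed_in_sets_mu) auto
  moreover have "emeasure \<mu> (\<Union>J\<in>boundary_classes N F K S. closure J) \<le> (\<Sum>J\<in>boundary_classes N F K S. emeasure \<mu> (closure J))"
    using finite_boundary_classes sub closed_in_sets_mu by (intro emeasure_subadditive_finite) auto
  ultimately show ?thesis using zero by simp
qed

lemma energy_truncate: "E n (\<lambda>x. max lo (min hi (v x))) \<le> E n v"
  by (rule energy_mono) (auto simp: max_def min_def)

text \<open>
  Boundary data on the cells of one level, compatible with the relation, extend cell by cell.
  Truncating each extension at the extreme boundary values of its cell keeps the energy bound and
  yields a maximum principle.
\<close>

lemma besov_extension:
  assumes m: "0 < m" and \<theta>: "1 < \<theta>" and \<sigma>: "0 < \<sigma>" "1 \<le> \<theta> * \<rho> powr (2 * \<sigma> - \<alpha>)"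
    and ext: "\<And>u. u \<in> class_functions S \<Longrightarrow>
      \<exists>v. (\<forall>x\<in>V 0. v x = u x) \<and> (\<exists>C. \<forall>k. E (m * k) v \<le> C / \<theta> ^ (m * k))"
    and h: "h \<in> class_functions (T (m * n))"
  obtains u where "u \<in> besov \<alpha> \<mu> \<sigma>" "continuous_on K u"
    "\<And>w x lo hi. w \<in> W (m * n) \<Longrightarrow> x \<in> K \<Longrightarrow> (\<And>p. p \<in> V 0 \<Longrightarrow> lo \<le> h (\<Phi> w p) \<and> h (\<Phi> w p) \<le> hi) \<Longrightarrow>
       lo \<le> u (\<Phi> w x) \<and> u (\<Phi> w x) \<le> hi"
proof -
  define lo where "lo w = Min ((\<lambda>p. h (\<Phi> w p)) ` V 0)" for w
  define hi where "hi w = Max ((\<lambda>p. h (\<Phi> w p)) ` V 0)" for w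
  have lohi: "lo w \<le> h (\<Phi> w p)" "h (\<Phi> w p) \<le> hi w" if "p \<in> V 0" for w p
    using that finite_V0 by (auto simp: lo_def hi_def)
  have le: "lo w \<le> hi w" for w using lohi V0_nonempty by (meson ex_in_conv order_trans)
  have "\<forall>w\<in>W (m * n). \<exists>gC. (\<forall>p\<in>V 0. fst gC p = h (\<Phi> w p)) \<and> (\<forall>k. E (m * k) (fst gC) \<le> snd gC / \<theta> ^ (m * k))
      \<and> (\<forall>x. lo w \<le> fst gC x \<and> fst gC x \<le> hi w)"
  proof
    fix w assume w: "w \<in> W (m * n)"
    obtain v C where v: "\<And>p. p \<in> V 0 \<Longrightarrow> v p = h (\<Phi> w p)" "\<And>k. E (m * k) v \<le> C / \<theta> ^ (m * k)"
      using ext[OF class_functions_\<Phi>[OF h w]] by blast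
    define g where "g x = max (lo w) (min (hi w) (v x))" for x
    have "E (m * k) g \<le> C / \<theta> ^ (m * k)" for k
      unfolding g_def using energy_truncate v(2) order_trans by blast
    moreover have "g p = h (\<Phi> w p)" if "p \<in> V 0" for p using lohi[OF that, of w] v(1)[OF that] by (simp add: g_def)
    moreover have "lo w \<le> g x \<and> g x \<le> hi w" for x using le[of w] by (simp add: g_def)
    ultimately show "\<exists>gC. (\<forall>p\<in>V 0. fst gC p = h (\<Phi> w p)) \<and> (\<forall>k. E (m * k) (fst gC) \<le> snd gC / \<theta> ^ (m * k))
      \<and> (\<forall>x. lo w \<le> fst gC x \<and> fst gC x \<le> hi w)"
      by (intro exI[of _ "(g, C)"]) simp
  qed
  then obtain gC where "\<forall>w\<in>W (m * n). (\<forall>p\<in>V 0. fst (gC w) p = h (\<Phi> w p)) \<and>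
      (\<forall>k. E (m * k) (fst (gC w)) \<le> snd (gC w) / \<theta> ^ (m * k)) \<and> (\<forall>x. lo w \<le> fst (gC w) x \<and> fst (gC w) x \<le> hi w)"
    by (rule bchoice[THEN exE])
  moreover define g where "g w = fst (gC w)" for w
  moreover define Cw where "Cw w = snd (gC w)" for w
  ultimately have g: "\<And>w p. w \<in> W (m * n) \<Longrightarrow> p \<in> V 0 \<Longrightarrow> g w p = h (\<Phi> w p)"
      "\<And>w k. w \<in> W (m * n) \<Longrightarrow> E (m * k) (g w) \<le> Cw w / \<theta> ^ (m * k)"
      "\<And>w x. w \<in> W (m * n) \<Longrightarrow> lo w \<le> g w x \<and> g w x \<le> hi w" by auto
  obtain v where v: "\<And>w y. w \<in> W (m * n) \<Longrightarrow> y \<in> Vs \<Longrightarrow> v (\<Phi> w y) = g w y" "\<And>x. x \<in> V (m * n) \<Longrightarrow> v x = h x"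
    using glue_functions[of "m * n" g h] g(1) by blast
  define C where "C = (\<Sum>w\<in>W (m * n). Cw w) * \<theta> ^ (m * n)"
  \<comment> \<open>Below level \<open>m * n\<close> no estimate is available, but only finitely many energies are concerned.\<close>
  define C0 where "C0 = \<bar>C\<bar> + (\<Sum>k<n. E (m * k) v * \<theta> ^ (m * k))"
  have E_nonneg: "0 \<le> E (m * k) v * \<theta> ^ (m * k)" for k using energy_nonneg \<theta> by simp
  have energy: "E (m * k) v \<le> C0 / \<theta> ^ (m * k)" for k
  proof -
    have "E (m * k) v * \<theta> ^ (m * k) \<le> C0"
    proof (cases "k < n")
      case True
      then have "E (m * k) v * \<theta> ^ (m * k) \<le> (\<Sum>k<n. E (m * k) v * \<theta> ^ (m * k))"
        using E_nonneg by (intro member_le_sum[of k _ "\<lambda>k. E (m * k) v * \<theta> ^ (m * k)"]) auto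
      then show ?thesis by (simp add: C0_def)
    next
      case False
      then obtain j where k: "k = n + j" using le_Suc_ex not_less by blast
      have "E (m * k) v = (\<Sum>w\<in>W (m * n). E (m * j) (\<lambda>x. v (\<Phi> w x)))"
        unfolding k distrib_left by (rule energy_split)
      also have "\<dots> = (\<Sum>w\<in>W (m * n). E (m * j) (g w))"
        using v(1) V_subset_Vs by (intro sum.cong refl energy_cong) blast
      also have "\<dots> \<le> (\<Sum>w\<in>W (m * n). Cw w / \<theta> ^ (m * j))" using g(2) by (rule sum_mono)
      also have "\<dots> = (\<Sum>w\<in>W (m * n). Cw w) / \<theta> ^ (m * j)" by (simp add: sum_divide_distrib)
      finally have "E (m * k) v * \<theta> ^ (m * k) \<le> (\<Sum>w\<in>W (m * n). Cw w) / \<theta> ^ (m * j) * \<theta> ^ (m * k)"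
        using \<theta> by (intro mult_right_mono) auto
      also have "\<dots> = C" using \<theta> by (simp add: C_def k distrib_left power_add)
      also have "C \<le> C0" unfolding C0_def using E_nonneg by (simp add: sum_nonneg add_increasing2)
      finally show ?thesis .
    qed
    then show ?thesis using \<theta> by (simp add: field_simps)
  qed
  obtain B C' where B: "\<And>w. 0 \<le> B w" "0 \<le> C'"
    "\<And>n w x y. w \<in> W (m * n) \<Longrightarrow> x \<in> Vs \<Longrightarrow> y \<in> Vs \<Longrightarrow> (v (\<Phi> w x) - v (\<Phi> w y))\<^sup>2 \<le> B w"
    "\<And>n. (\<Sum>w\<in>W (m * n). B w) \<le> C' / \<theta> ^ (m * n)"
    using oscillation_bound[OF m \<theta> energy] by metis
  obtain u where u: "continuous_on K u" "\<And>x. x \<in> Vs \<Longrightarrow> u x = v x"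
    "\<And>n w x y. w \<in> W (m * n) \<Longrightarrow> x \<in> K \<Longrightarrow> y \<in> K \<Longrightarrow> (u (\<Phi> w x) - u (\<Phi> w y))\<^sup>2 \<le> B w"
    "\<And>n w lo hi x. w \<in> W n \<Longrightarrow> (\<And>x. x \<in> Vs \<Longrightarrow> lo \<le> v (\<Phi> w x) \<and> v (\<Phi> w x) \<le> hi) \<Longrightarrow> x \<in> K \<Longrightarrow>
       lo \<le> u (\<Phi> w x) \<and> u (\<Phi> w x) \<le> hi"
  proof (rule continuous_extension[OF m \<theta> B(2,1,3,4)])
    fix u assume u: "continuous_on K u" "\<And>x. x \<in> Vs \<Longrightarrow> u x = v x"
      "\<And>n w x y. w \<in> W (m * n) \<Longrightarrow> x \<in> K \<Longrightarrow> y \<in> K \<Longrightarrow> (u (\<Phi> w x) - u (\<Phi> w y))\<^sup>2 \<le> B w"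
      "\<And>n w lo hi x. w \<in> W n \<Longrightarrow> (\<And>x. x \<in> Vs \<Longrightarrow> lo \<le> v (\<Phi> w x) \<and> v (\<Phi> w x) \<le> hi) \<Longrightarrow> x \<in> K \<Longrightarrow>
         lo \<le> u (\<Phi> w x) \<and> u (\<Phi> w x) \<le> hi"
    show thesis by (rule that[OF u])
  qed
  have "u \<in> besov \<alpha> \<mu> \<sigma>"
    by (rule oscillation_imp_besov[OF m \<theta> B(2,1) u(1) u(3) B(4) \<sigma>])
  moreover have "l \<le> u (\<Phi> w x) \<and> u (\<Phi> w x) \<le> r"
    if w: "w \<in> W (m * n)" and x: "x \<in> K" and lr: "\<And>p. p \<in> V 0 \<Longrightarrow> l \<le> h (\<Phi> w p) \<and> h (\<Phi> w p) \<le> r" for w x l r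
  proof -
    have "lo w \<le> v (\<Phi> w y) \<and> v (\<Phi> w y) \<le> hi w" if "y \<in> Vs" for y using v(1)[OF w that] g(3)[OF w] by simp
    from u(4)[OF w this x] have "lo w \<le> u (\<Phi> w x) \<and> u (\<Phi> w x) \<le> hi w" .
    moreover have "l \<le> lo w" "hi w \<le> r" unfolding lo_def hi_def using lr finite_V0 V0_nonempty by auto
    ultimately show ?thesis by linarith
  qed
  ultimately show thesis using that u(1) by blast
qed

text \<open>
  A continuous function is copied to the classes of a fine level by evaluating it at one
  representative per class. Classes inside one small cell do little harm, and the vertices of all
  other classes lie in a compact null set, the union \<open>Z\<close> of the copies of the boundary classes.
\<close>

lemma besov_dense:
  assumes m: "0 < m" and \<theta>: "1 < \<theta>" and \<sigma>: "0 < \<sigma>" "1 \<le> \<theta> * \<rho> powr (2 * \<sigma> - \<alpha>)"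
    and ext: "\<And>u. u \<in> class_functions S \<Longrightarrow>
      \<exists>v. (\<forall>x\<in>V 0. v x = u x) \<and> (\<exists>C. \<forall>k. E (m * k) v \<le> C / \<theta> ^ (m * k))"
    and null: "emeasure \<mu> (closure boundary_points) = 0"
  shows "dense_in_L2 \<mu> (besov \<alpha> \<mu> \<sigma>)"
proof -
  have cont: "\<exists>u\<in>besov \<alpha> \<mu> \<sigma>. sq_dist f u < \<epsilon>" if f: "continuous_on K f" and \<epsilon>: "0 < \<epsilon>" for f \<epsilon>
  proof -
    have "bounded (f ` K)" using f compact_K by (intro compact_imp_bounded compact_continuous_image)
    then obtain M where M: "\<And>x. x \<in> K \<Longrightarrow> \<bar>f x\<bar> \<le> M" unfolding bounded_iff by auto
    then have M0: "0 \<le> M" using K_nonempty by (meson abs_ge_zero ex_in_conv order_trans)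
    \<comment> \<open>The error is at most \<open>2 * \<eta>\<close> off a set of measure at most \<open>\<delta>\<close>, and at most \<open>2 * M\<close> on it.\<close>
    define \<eta> where "\<eta> = sqrt (\<epsilon> / 8)"
    have \<eta>: "0 < \<eta>" "4 * \<eta>\<^sup>2 = \<epsilon> / 2" using \<epsilon> by (simp_all add: \<eta>_def)
    define \<delta> where "\<delta> = \<epsilon> / (8 * M\<^sup>2 + 1)"
    have M2: "0 < 8 * M\<^sup>2 + 1" by (simp add: add_nonneg_pos)
    have \<delta>: "0 < \<delta>" unfolding \<delta>_def using \<epsilon> M2 by (rule divide_pos_pos)
    have "\<delta> * (8 * M\<^sup>2 + 1) = \<epsilon>" using M2 by (simp add: \<delta>_def)
    then have \<delta>M: "4 * M\<^sup>2 * \<delta> < \<epsilon> / 2" using \<delta> by (simp add: algebra_simps)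
    have "uniformly_continuous_on K f" using f compact_K by (rule compact_uniformly_continuous)
    then obtain d where d: "0 < d" "\<And>x y. x \<in> K \<Longrightarrow> y \<in> K \<Longrightarrow> dist x y < d \<Longrightarrow> \<bar>f x - f y\<bar> < \<eta>"
      using \<eta>(1) unfolding uniformly_continuous_on_def dist_real_def by (metis dist_commute)
    have "\<forall>\<^sub>F l in sequentially. \<rho> ^ l * diameter K < d"
      using power_rho_tendsto_0 d(1) by (intro order_tendstoD) auto
    then obtain l where l: "\<And>j. l \<le> j \<Longrightarrow> \<rho> ^ j * diameter K < d" by (auto simp: eventually_sequentially)
    \<comment> \<open>Classes that avoid \<open>Z\<close> lie in one cell of level \<open>l\<close>, on which \<open>f\<close> varies by less than \<open>\<eta>\<close>.\<close>
    define Z where "Z = (\<Union>w\<in>W l. \<Phi> w ` closure boundary_points)"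
    have bK: "closure boundary_points \<subseteq> K"
      using closure_mono[OF boundary_points_subset] closure_Vs by blast
    have cb: "compact (closure boundary_points)"
      using bK compact_K by (metis Int_absorb2 closed_Int_compact closed_closure)
    have Z_image: "compact (\<Phi> w ` closure boundary_points)" if "w \<in> W l" for w
      using cb continuous_\<Phi>[OF that] by (intro compact_continuous_image)
    have "compact Z" unfolding Z_def using Z_image by (intro compact_UN) auto
    then have Z: "closed Z" by (rule compact_imp_closed)
    have ZK: "Z \<subseteq> K" unfolding Z_def using bK \<Phi>_in_K by blast
    have Zne: "Z \<noteq> {}"
    proof -
      obtain w where "w \<in> W l" using K_cells[of l] K_nonempty by blast
      moreover obtain p where "p \<in> V 0" using V0_nonempty by blast
      then have "p \<in> closure boundary_points" using V0_subset_boundary_points closure_subset by blast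
      ultimately show ?thesis unfolding Z_def by blast
    qed
    have Z0: "measure \<mu> Z = 0"
    proof -
      have "emeasure \<mu> Z \<le> (\<Sum>w\<in>W l. emeasure \<mu> (\<Phi> w ` closure boundary_points))"
        unfolding Z_def using Z_image bK \<Phi>_in_K
        by (intro emeasure_subadditive_finite) (auto intro!: closed_in_sets_mu compact_imp_closed)
      also have "\<dots> = 0" using emeasure_\<Phi>_image_0[OF closed_closure bK null] by simp
      finally show ?thesis by (simp add: measure_def)
    qed
    \<comment> \<open>A cell of level \<open>j\<close> that contains a point outside \<open>A j\<close> does not meet \<open>Z\<close>.\<close>
    define A where "A j = {x \<in> K. infdist x Z \<le> \<rho> ^ j * diameter K}" for j
    have A_closed: "closed (A j)" for j
    proof -
      have "A j = K \<inter> {x. infdist x Z \<le> \<rho> ^ j * diameter K}" by (auto simp: A_def)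
      moreover have "closed {x. infdist x Z \<le> \<rho> ^ j * diameter K}"
        by (intro closed_Collect_le continuous_intros)
      ultimately show ?thesis using compact_imp_closed[OF compact_K] by auto
    qed
    have A_sets: "A j \<in> sets \<mu>" for j using A_closed by (rule closed_in_sets_mu) (auto simp: A_def)
    have "decseq A"
    proof (rule decseq_SucI)
      fix j
      have "\<rho> ^ Suc j * diameter K \<le> \<rho> ^ j * diameter K"
        using rho_pos rho_less_1 diameter_K_nonneg by (intro mult_right_mono power_decreasing) auto
      then show "A (Suc j) \<subseteq> A j" by (auto simp: A_def)
    qed
    then have "(\<lambda>j. measure \<mu> (A j)) \<longlonglongrightarrow> measure \<mu> (\<Inter>j. A j)"
      using A_sets by (intro finite_Lim_measure_decseq) auto
    moreover have "(\<Inter>j. A j) = Z"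
    proof
      show "Z \<subseteq> (\<Inter>j. A j)" using ZK diameter_K_nonneg rho_pos by (auto simp: A_def)
      show "(\<Inter>j. A j) \<subseteq> Z"
      proof
        fix x assume x: "x \<in> (\<Inter>j. A j)"
        then have "infdist x Z \<le> \<rho> ^ j * diameter K" for j by (auto simp: A_def)
        then have "infdist x Z \<le> 0" by (intro LIMSEQ_le_const[OF power_rho_tendsto_0[of "diameter K"]]) auto
        then have "infdist x Z = 0" using infdist_nonneg[of x Z] by simp
        then show "x \<in> Z" using in_closed_iff_infdist_zero[OF Z Zne] by simp
      qed
    qed
    ultimately have "(\<lambda>j. measure \<mu> (A j)) \<longlonglongrightarrow> 0" using Z0 by simp
    then have "\<forall>\<^sub>F j in sequentially. measure \<mu> (A j) < \<delta>" using \<delta> by (intro order_tendstoD) auto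
    then obtain j0 where j0: "\<And>j. j0 \<le> j \<Longrightarrow> measure \<mu> (A j) < \<delta>" by (auto simp: eventually_sequentially)
    define n where "n = l + j0"
    have mn: "n \<le> m * n" using m by simp
    then have mnl: "l \<le> m * n" and mnj: "j0 \<le> m * n" unfolding n_def by linarith+
    define rep where "rep x = (SOME y. (x, y) \<in> T (m * n))" for x
    have rep: "(x, rep x) \<in> T (m * n)" if "x \<in> V (m * n)" for x
      unfolding rep_def using T_refl[OF that] by (rule someI)
    define h where "h x = f (rep x)" for x
    have "h \<in> class_functions (T (m * n))"
    proof -
      have "rep x = rep y" if "(x, y) \<in> T (m * n)" for x y
      proof -
        have "(x, z) \<in> T (m * n) \<longleftrightarrow> (y, z) \<in> T (m * n)" for z
          using that T_sym T_trans by blast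
        then show ?thesis unfolding rep_def by simp
      qed
      then show ?thesis unfolding class_functions_def h_def by auto
    qed
    then obtain u where u: "u \<in> besov \<alpha> \<mu> \<sigma>" "continuous_on K u"
      "\<And>w x lo hi. w \<in> W (m * n) \<Longrightarrow> x \<in> K \<Longrightarrow> (\<And>p. p \<in> V 0 \<Longrightarrow> lo \<le> h (\<Phi> w p) \<and> h (\<Phi> w p) \<le> hi) \<Longrightarrow>
         lo \<le> u (\<Phi> w x) \<and> u (\<Phi> w x) \<le> hi"
      using besov_extension[OF m \<theta> \<sigma> ext, of h n] by metis
    have \<Phi>V: "\<Phi> w p \<in> V (m * n)" if "w \<in> W (m * n)" "p \<in> V 0" for w p using \<Phi>_in_V[OF that] by simp
    have h_le: "\<bar>h x\<bar> \<le> M" if "x \<in> V (m * n)" for x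
      unfolding h_def using rep[OF that] T_subset[of "m * n"] V_subset_K[of "m * n"] by (intro M) blast
    have pointwise: "(f x - u x)\<^sup>2 \<le> 4 * \<eta>\<^sup>2 + 4 * M\<^sup>2 * indicator (A (m * n)) x" if x: "x \<in> K" for x
    proof -
      obtain w y where w: "w \<in> W (m * n)" "y \<in> K" "x = \<Phi> w y" using in_cellE[OF x] by metis
      show ?thesis
      proof (cases "x \<in> A (m * n)")
        case True
        have "- M \<le> u x \<and> u x \<le> M"
          unfolding w(3) by (rule u(3)[OF w(1,2)]) (use h_le \<Phi>V[OF w(1)] in \<open>auto simp: abs_le_iff minus_le_iff\<close>)
        then have "\<bar>f x - u x\<bar> \<le> 2 * M" using M[OF x] by linarith
        then have "\<bar>f x - u x\<bar>\<^sup>2 \<le> (2 * M)\<^sup>2" by (rule power_mono) simp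
        then show ?thesis using True by (simp add: power_mult_distrib add_increasing)
      next
        case False
        have "f x - 2 * \<eta> \<le> h (\<Phi> w p) \<and> h (\<Phi> w p) \<le> f x + 2 * \<eta>" if p: "p \<in> V 0" for p
        proof -
          define z where "z = \<Phi> w p"
          have zK: "z \<in> K" "z \<in> cell w" using p w V0_subset_K \<Phi>_in_K by (auto simp: z_def)
          have xz: "dist x z \<le> \<rho> ^ (m * n) * diameter K" using w zK by (intro dist_cell[OF w(1)]) auto
          have "z \<notin> Z"
          proof
            assume "z \<in> Z"
            then have "infdist x Z \<le> dist x z" by (rule infdist_le)
            then show False using False x xz by (simp add: A_def)
          qed
          then have "z \<notin> (\<Union>w\<in>W l. \<Phi> w ` boundary_points)" unfolding Z_def using closure_subset by blast
          moreover have "(z, rep z) \<in> T (l + (m * n - l))" using rep[OF \<Phi>V[OF w(1) p]] mnl by (simp add: z_def)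
          ultimately obtain v where v: "v \<in> W l" "z \<in> cell v" "rep z \<in> cell v"
            using class_in_one_cell[of z "rep z" l "m * n - l"] by blast
          have "dist (rep z) z < d" using dist_cell[OF v(1) v(3,2)] l[of l] by linarith
          moreover have "rep z \<in> K" using v(3) \<Phi>_in_K[OF v(1)] by auto
          ultimately have 1: "\<bar>h z - f z\<bar> < \<eta>" unfolding h_def by (intro d(2) zK(1))
          have "dist x z < d" using xz l[OF mnl] by linarith
          then have 2: "\<bar>f x - f z\<bar> < \<eta>" by (intro d(2) x zK(1))
          from 1 2 show ?thesis unfolding z_def[symmetric] by linarith
        qed
        from u(3)[OF w(1,2) this] have "\<bar>f x - u x\<bar> \<le> 2 * \<eta>" unfolding w(3)[symmetric] by linarith
        then have "\<bar>f x - u x\<bar>\<^sup>2 \<le> (2 * \<eta>)\<^sup>2" by (rule power_mono) simp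
        then show ?thesis using False by (simp add: power_mult_distrib)
      qed
    qed
    have int: "integrable \<mu> (\<lambda>x. (f x - u x)\<^sup>2)"
      using L2_diff[OF continuous_in_L2[OF f] continuous_in_L2[OF u(2)]] by (simp add: L2_def)
    have intA: "integrable \<mu> (indicat_real (A (m * n)))" using A_sets by (simp add: emeasure_eq_measure)
    have "sq_dist f u \<le> (\<integral>x. 4 * \<eta>\<^sup>2 + 4 * M\<^sup>2 * indicator (A (m * n)) x \<partial>\<mu>)"
      using int intA pointwise by (intro integral_mono) (auto simp: space_mu)
    also have "\<dots> = 4 * \<eta>\<^sup>2 + 4 * M\<^sup>2 * measure \<mu> (A (m * n))"
      using intA A_sets by (simp add: prob_space)
    also have "\<dots> \<le> 4 * \<eta>\<^sup>2 + 4 * M\<^sup>2 * \<delta>"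
      using j0[OF mnj] by (intro add_left_mono mult_left_mono) auto
    also have "\<dots> < \<epsilon>" using \<eta>(2) \<delta>M by linarith
    finally show ?thesis using u(1) by blast
  qed
  show ?thesis
    unfolding dense_in_L2_def
  proof (intro conjI ballI allI impI)
    show "besov \<alpha> \<mu> \<sigma> \<subseteq> L2 \<mu>" by (auto simp: besov_def)
    fix f and \<epsilon> :: real assume f: "f \<in> L2 \<mu>" and \<epsilon>: "0 < \<epsilon>"
    have e4: "0 < \<epsilon>\<^sup>2 / 4" using \<epsilon> by simp
    obtain g where g: "continuous_on K g" "sq_dist f g < \<epsilon>\<^sup>2 / 4"
      using continuous_dense_in_L2[OF f] e4 unfolding approximable_def by blast
    obtain u where u: "u \<in> besov \<alpha> \<mu> \<sigma>" "sq_dist g u < \<epsilon>\<^sup>2 / 4"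
      using cont[OF g(1) e4] by blast
    have "sq_dist f u \<le> 2 * sq_dist f g + 2 * sq_dist g u"
      using f g(1) u(1) continuous_in_L2 by (intro L2_integral_triangle) (auto simp: besov_def)
    also have "\<dots> < \<epsilon>\<^sup>2" using g(2) u(2) by linarith
    finally have "sqrt (sq_dist f u) < sqrt (\<epsilon>\<^sup>2)" by (rule real_sqrt_less_mono)
    then have "L2_norm \<mu> (\<lambda>x. f x - u x) < \<epsilon>" using \<epsilon> by (simp add: L2_norm_def)
    with u(1) show "\<exists>g\<in>besov \<alpha> \<mu> \<sigma>. L2_norm \<mu> (\<lambda>x. f x - g x) < \<epsilon>" by blast
  qed
qed

end

section \<open>The critical exponent\<close>

text \<open>
  The defining property of \<open>R_sharp\<close> depends only on the finitely many edges whose rate is at most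
  \<open>s\<close>, so its least element exists and is one of the rates.
\<close>

lemma R_sharp_attained:
  fixes R :: "'a \<Rightarrow> 'a \<Rightarrow> real"
  assumes fin: "finite A" and two: "2 \<le> card A"
  defines "chained \<equiv> \<lambda>s. \<forall>p\<in>A. \<forall>q\<in>A. p \<noteq> q \<longrightarrow>
     (\<exists>xs. xs \<noteq> [] \<and> hd xs = p \<and> last xs = q \<and> set xs \<subseteq> A \<and>
        (\<forall>i. Suc i < length xs \<longrightarrow> xs ! i \<noteq> xs ! Suc i \<and> R (xs ! i) (xs ! Suc i) \<le> s))"
  shows "chained (R_sharp A R)" "\<exists>p\<in>A. \<exists>q\<in>A. p \<noteq> q \<and> R_sharp A R = R p q"
proof -
  define Q where "Q = (\<lambda>(p, q). R p q) ` {(p, q). p \<in> A \<and> q \<in> A \<and> p \<noteq> q}"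
  have finQ: "finite Q" unfolding Q_def
    by (intro finite_imageI finite_subset[OF _ finite_cartesian_product[OF fin fin]]) auto
  obtain a c where ac: "a \<in> A" "c \<in> A" "a \<noteq> c"
    using two by (metis card_le_Suc0_iff_eq fin not_numeral_le_zero numeral_2_eq_2 not_less_eq_eq)
  have QI: "R p q \<in> Q" if "p \<in> A" "q \<in> A" "p \<noteq> q" for p q
    using that unfolding Q_def by force
  have top: "chained (Max Q)"
    unfolding chained_def
  proof (intro ballI impI)
    fix p q assume pq: "p \<in> A" "q \<in> A" "p \<noteq> q"
    show "\<exists>xs. xs \<noteq> [] \<and> hd xs = p \<and> last xs = q \<and> set xs \<subseteq> A \<and>
        (\<forall>i. Suc i < length xs \<longrightarrow> xs ! i \<noteq> xs ! Suc i \<and> R (xs ! i) (xs ! Suc i) \<le> Max Q)"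
      using pq QI[OF pq] finQ by (intro exI[of _ "[p, q]"]) auto
  qed
  have below: "\<exists>t\<in>Q. t \<le> s \<and> chained t" if s: "chained s" for s
  proof -
    define B where "B = {t \<in> Q. t \<le> s}"
    have finB: "finite B" using finQ by (simp add: B_def)
    have edge: "R (xs ! i) (xs ! Suc i) \<in> B"
      if "set xs \<subseteq> A" "Suc i < length xs" "xs ! i \<noteq> xs ! Suc i" "R (xs ! i) (xs ! Suc i) \<le> s" for xs i
    proof -
      have "xs ! i \<in> A" "xs ! Suc i \<in> A" using that(1,2) by (auto dest: nth_mem)
      then show ?thesis using QI that by (simp add: B_def)
    qed
    obtain xs where xs: "xs \<noteq> []" "hd xs = a" "last xs = c" "set xs \<subseteq> A"
      "\<And>i. Suc i < length xs \<Longrightarrow> xs ! i \<noteq> xs ! Suc i \<and> R (xs ! i) (xs ! Suc i) \<le> s"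
      using s ac unfolding chained_def by blast
    have "length xs \<noteq> 1" using xs(1-3) ac(3) by (metis hd_conv_nth last_conv_nth diff_self_eq_0)
    then have "Suc 0 < length xs" using xs(1) by (cases xs) auto
    then have "R (xs ! 0) (xs ! Suc 0) \<in> B" using edge[of xs 0] xs by blast
    then have "B \<noteq> {}" by blast
    then have max: "Max B \<in> B" using finB by (rule Max_in[rotated])
    have "chained (Max B)"
      unfolding chained_def
    proof (intro ballI impI)
      fix p q assume pq: "p \<in> A" "q \<in> A" "p \<noteq> q"
      obtain xs where xs: "xs \<noteq> []" "hd xs = p" "last xs = q" "set xs \<subseteq> A"
        "\<And>i. Suc i < length xs \<Longrightarrow> xs ! i \<noteq> xs ! Suc i \<and> R (xs ! i) (xs ! Suc i) \<le> s"
        using s pq unfolding chained_def by blast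
      have "xs ! i \<noteq> xs ! Suc i \<and> R (xs ! i) (xs ! Suc i) \<le> Max B" if "Suc i < length xs" for i
        using xs(5)[OF that] edge[OF xs(4) that] finB by auto
      with xs(1-4) show "\<exists>xs. xs \<noteq> [] \<and> hd xs = p \<and> last xs = q \<and> set xs \<subseteq> A \<and>
        (\<forall>i. Suc i < length xs \<longrightarrow> xs ! i \<noteq> xs ! Suc i \<and> R (xs ! i) (xs ! Suc i) \<le> Max B)" by blast
    qed
    with max show ?thesis by (auto simp: B_def)
  qed
  define C where "C = {t \<in> Q. chained t}"
  have finC: "finite C" using finQ by (simp add: C_def)
  have "C \<noteq> {}" using below[OF top] by (auto simp: C_def)
  then have min: "Min C \<in> C" using finC by (rule Min_in[rotated])
  have "R_sharp A R = Min C"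
    unfolding R_sharp_def chained_def[symmetric]
  proof (rule Least_equality)
    show "chained (Min C)" using min by (simp add: C_def)
    fix s assume "chained s"
    then obtain t where "t \<in> C" "t \<le> s" using below by (auto simp: C_def)
    then show "Min C \<le> s" using Min_le[OF finC] by (meson order_trans)
  qed
  with min show "chained (R_sharp A R)" "\<exists>p\<in>A. \<exists>q\<in>A. p \<noteq> q \<and> R_sharp A R = R p q"
    by (auto simp: C_def Q_def)
qed

context pcf_ifs_measure
begin

text \<open>The exponent at which \<open>\<rho> powr (2 * \<sigma> - \<alpha>)\<close> balances the rate \<open>Rs\<close> of the traces.\<close>

definition critical_exponent :: "real \<Rightarrow> real" where
  "critical_exponent Rs = (\<alpha> + ln Rs / \<bar>ln \<rho>\<bar>) / 2"

lemma rho_powr_critical_exponent: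
  assumes "1 < Rs" shows "\<rho> powr (2 * critical_exponent Rs - \<alpha>) = 1 / Rs"
proof -
  have "ln \<rho> < 0" using rho_pos rho_less_1 by simp
  moreover have "2 * critical_exponent Rs - \<alpha> = ln Rs / \<bar>ln \<rho>\<bar>"
    unfolding critical_exponent_def by (simp add: field_simps)
  ultimately have "(2 * critical_exponent Rs - \<alpha>) * ln \<rho> = - ln Rs" by simp
  then show ?thesis using rho_pos assms by (simp add: powr_def exp_minus inverse_eq_divide)
qed

lemma critical_exponent_gt: "1 < Rs \<Longrightarrow> \<alpha> / 2 < critical_exponent Rs"
  using rho_pos rho_less_1 by (simp add: critical_exponent_def divide_pos_neg)

text \<open>
  Beyond the critical exponent the decay ratio of the energies is less than \<open>1 / R\<^sup>#\<close>.
\<close>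

lemma sigma_sharp_le:
  assumes tr: "\<And>n. is_trace N F K n (Rn n)"
    and gr: "\<And>p q. p \<in> V 0 \<Longrightarrow> q \<in> V 0 \<Longrightarrow> p \<noteq> q \<Longrightarrow> has_growth_rate (\<lambda>n. Rn n p q) (R p q)"
    and Rs: "Rs = R_sharp (V 0) R" "1 < Rs"
  shows "sigma_sharp \<alpha> \<mu> \<le> ereal (critical_exponent Rs)"
  unfolding sigma_sharp_def
proof (rule SUP_least)
  fix \<sigma> assume "\<sigma> \<in> {\<sigma>. 0 < \<sigma> \<and> (\<exists>u\<in>besov \<alpha> \<mu> \<sigma>. \<not> (\<exists>c. AE x in \<mu>. u x = c))}"
  then obtain u where \<sigma>: "0 < \<sigma>" and u: "u \<in> besov \<alpha> \<mu> \<sigma>" and nc: "\<not> (\<exists>c. AE x in \<mu>. u x = c)" by blast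
  show "ereal \<sigma> \<le> ereal (critical_exponent Rs)"
  proof (rule ccontr)
    assume "\<not> ?thesis"
    then have "critical_exponent Rs < \<sigma>" by simp
    then have "\<rho> powr (2 * \<sigma> - \<alpha>) < \<rho> powr (2 * critical_exponent Rs - \<alpha>)"
      using rho_pos rho_less_1 by (intro powr_less_mono') auto
    then have lam: "\<rho> powr (2 * \<sigma> - \<alpha>) < 1 / Rs" using rho_powr_critical_exponent[OF Rs(2)] by simp
    then have less: "Rs * \<rho> powr (2 * \<sigma> - \<alpha>) < 1" using Rs(2) by (simp add: field_simps)
    have "1 / Rs < 1" using Rs(2) by simp
    with lam have less1: "\<rho> powr (2 * \<sigma> - \<alpha>) < 1" by linarith
    have "\<exists>c. AE x in \<mu>. u x = c"
    proof (rule besov_imp_constant[OF u \<sigma> less1])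
      fix g C p q assume C: "0 \<le> C" and g: "\<And>k. E k (g k) \<le> C * (\<rho> powr (2 * \<sigma> - \<alpha>)) ^ k"
        and pq: "p \<in> V 0" "q \<in> V 0"
      have chain: "\<exists>xs. xs \<noteq> [] \<and> hd xs = p \<and> last xs = q \<and> set xs \<subseteq> V 0 \<and>
        (\<forall>i. Suc i < length xs \<longrightarrow> xs ! i \<noteq> xs ! Suc i \<and> R (xs ! i) (xs ! Suc i) \<le> Rs)"
        if "p \<in> V 0" "q \<in> V 0" "p \<noteq> q" for p q
        using R_sharp_attained(1)[OF finite_V0 two_vertices, of R] that unfolding Rs(1) by blast
      have "0 < \<rho> powr (2 * \<sigma> - \<alpha>)" using rho_pos by simp
      from trace_differences_vanish[OF tr gr chain Rs(2) this less C g pq]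
      show "(\<lambda>k. g k p - g k q) \<longlonglongrightarrow> 0" by blast
    qed
    with nc show False by blast
  qed
qed

end

context pcf_ifs_measure_rel
begin

text \<open>
  It suffices to treat exponents close to the critical one. There \<open>\<theta> = (R\<^sup>#)\<^bsup>1 - \<epsilon>\<^esup>\<close> with small \<open>\<epsilon>\<close> still
  balances \<open>\<rho>\<^bsup>2\<sigma> - \<alpha>\<^esup>\<close>, and all quotient traces of some level are at least the corresponding power
  of \<open>\<theta>\<close>.
\<close>

lemma besov_dense_below_critical:
  assumes Rs: "1 < Rs"
    and qt: "\<And>n. is_quotient_trace N F K S n (Rq n)"
    and decay: "\<forall>\<^sub>F \<epsilon> in at_right 0. \<forall>I\<in>V 0 // S. \<forall>J\<in>V 0 // S. I \<noteq> J \<longrightarrow>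
           (\<lambda>n. ennreal (Rs powr ((1 - \<epsilon>) * real n)) / Rq n I J) \<longlonglongrightarrow> 0"
    and null: "emeasure \<mu> (closure boundary_points) = 0"
    and \<sigma>: "\<sigma> < critical_exponent Rs"
  shows "dense_in_L2 \<mu> (besov \<alpha> \<mu> \<sigma>)"
proof -
  define \<sigma>' where "\<sigma>' = max \<sigma> ((\<alpha> / 2 + critical_exponent Rs) / 2)"
  have \<sigma>': "\<sigma> \<le> \<sigma>'" "\<alpha> / 2 < \<sigma>'" "\<sigma>' < critical_exponent Rs"
    using critical_exponent_gt[OF Rs] \<sigma> unfolding \<sigma>'_def max_def by (auto split: if_splits)
  define r where "r = \<rho> powr (2 * \<sigma>' - \<alpha>)"
  have "\<rho> powr (2 * critical_exponent Rs - \<alpha>) < r"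
    unfolding r_def using \<sigma>'(3) rho_pos rho_less_1 by (intro powr_less_mono') auto
  then have r1: "1 / Rs < r" using rho_powr_critical_exponent[OF Rs] by simp
  have "r < \<rho> powr 0" unfolding r_def using \<sigma>'(2) rho_pos rho_less_1 by (intro powr_less_mono') auto
  then have r2: "r < 1" using rho_pos by simp
  have r0: "0 < r" using rho_pos by (simp add: r_def)
  have rRs: "1 / r < Rs" using r1 r0 Rs by (simp add: field_simps)
  have "((\<lambda>\<epsilon>. Rs powr (1 - \<epsilon>)) \<longlongrightarrow> Rs powr (1 - 0)) (at_right 0)"
    using Rs by (intro tendsto_intros) auto
  then have "\<forall>\<^sub>F \<epsilon> in at_right 0. 1 / r < Rs powr (1 - \<epsilon>)"
    using rRs Rs by (intro order_tendstoD) auto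
  from eventually_conj[OF this decay] have "\<exists>\<epsilon>. 1 / r < Rs powr (1 - \<epsilon>) \<and> (\<forall>I\<in>V 0 // S. \<forall>J\<in>V 0 // S. I \<noteq> J \<longrightarrow>
           (\<lambda>n. ennreal (Rs powr ((1 - \<epsilon>) * real n)) / Rq n I J) \<longlonglongrightarrow> 0)"
    by (rule eventually_happens'[rotated]) simp
  then obtain \<epsilon> where \<epsilon>: "1 / r < Rs powr (1 - \<epsilon>)"
    "\<And>I J. I \<in> V 0 // S \<Longrightarrow> J \<in> V 0 // S \<Longrightarrow> I \<noteq> J \<Longrightarrow>
           (\<lambda>n. ennreal (Rs powr ((1 - \<epsilon>) * real n)) / Rq n I J) \<longlonglongrightarrow> 0" by blast
  define \<theta> where "\<theta> = Rs powr (1 - \<epsilon>)"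
  have "1 < 1 / r" using r0 r2 by simp
  then have \<theta>: "1 < \<theta>" using \<epsilon>(1) by (simp add: \<theta>_def)
  have \<theta>r: "1 \<le> \<theta> * r" using \<epsilon>(1) r0 by (simp add: \<theta>_def field_simps)
  have \<theta>n: "Rs powr ((1 - \<epsilon>) * real n) = \<theta> ^ n" for n
    using Rs by (simp add: \<theta>_def powr_powr[symmetric] powr_realpow)
  have finq: "finite (V 0 // S)"
    using finite_V0 equiv_T[of 0] by (intro finite_quotient) (auto simp: equiv_def)
  have "\<forall>\<^sub>F n in sequentially. \<forall>I\<in>V 0 // S. \<forall>J\<in>V 0 // S. I \<noteq> J \<longrightarrow> ennreal (\<theta> ^ n) / Rq n I J \<le> 1"
  proof (intro eventually_ball_finite finq ballI)
    fix I J assume IJ: "I \<in> V 0 // S" "J \<in> V 0 // S"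
    show "\<forall>\<^sub>F n in sequentially. I \<noteq> J \<longrightarrow> ennreal (\<theta> ^ n) / Rq n I J \<le> 1"
    proof (cases "I = J")
      case False
      have "\<forall>\<^sub>F n in sequentially. ennreal (\<theta> ^ n) / Rq n I J < 1"
        using \<epsilon>(2)[OF IJ False] unfolding \<theta>n by (intro order_tendstoD) auto
      then show ?thesis by eventually_elim auto
    qed simp
  qed
  from eventually_conj[OF this eventually_gt_at_top[of 0]]
  obtain m where m: "0 < m" and small: "\<And>I J. I \<in> V 0 // S \<Longrightarrow> J \<in> V 0 // S \<Longrightarrow> I \<noteq> J \<Longrightarrow> ennreal (\<theta> ^ m) / Rq m I J \<le> 1"
    by (auto simp: eventually_sequentially)
  have step: "\<exists>g\<in>class_functions (T m). (\<forall>x\<in>V 0. g x = u x) \<and> E m g \<le> (1 / \<theta> ^ m) * E 0 u"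
    if "u \<in> class_functions S" for u
    using \<theta> small that by (intro quotient_trace_extension[OF qt]) auto
  have "dense_in_L2 \<mu> (besov \<alpha> \<mu> \<sigma>')"
  proof (rule besov_dense[OF m \<theta> _ _ _ null])
    show "0 < \<sigma>'" using \<sigma>'(2) \<alpha>_pos by linarith
    show "1 \<le> \<theta> * \<rho> powr (2 * \<sigma>' - \<alpha>)" using \<theta>r by (simp add: r_def)
    fix u assume u: "u \<in> class_functions S"
    have nn: "0 \<le> 1 / \<theta> ^ m" using \<theta> by simp
    obtain v where v: "\<And>x. x \<in> V 0 \<Longrightarrow> v x = u x" "\<And>k. E (m * k) v \<le> (1 / \<theta> ^ m) ^ k * E 0 u"
    proof (rule iterated_extension[OF step m nn u])
      fix v assume "\<And>x. x \<in> V 0 \<Longrightarrow> v x = u x" "\<And>k. E (m * k) v \<le> (1 / \<theta> ^ m) ^ k * E 0 u"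
      then show thesis by (rule that)
    qed
    have "E (m * k) v \<le> E 0 u / \<theta> ^ (m * k)" for k
      using v(2)[of k] by (simp add: power_one_over power_mult)
    with v(1) show "\<exists>v. (\<forall>x\<in>V 0. v x = u x) \<and> (\<exists>C. \<forall>k. E (m * k) v \<le> C / \<theta> ^ (m * k))" by blast
  qed
  then show ?thesis using \<sigma>'(1) by (rule dense_in_L2_mono)
qed

text \<open>
  Here \<open>\<theta> = R\<^sup>#\<close>, which balances \<open>\<rho>\<^bsup>2\<sigma> - \<alpha>\<^esup>\<close> exactly, and every level is admissible.
\<close>

lemma besov_dense_at_critical:
  assumes Rs: "1 < Rs"
    and ext: "\<forall>u\<in>class_functions S. \<exists>v\<in>class_functions Ts.
             (\<forall>x\<in>V 0. v x = u x) \<and> bdd_above (range (\<lambda>n. Rs ^ n * E n v))"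
    and null: "emeasure \<mu> (closure boundary_points) = 0"
  shows "dense_in_L2 \<mu> (besov \<alpha> \<mu> (critical_exponent Rs))"
proof (rule besov_dense[OF zero_less_one Rs _ _ _ null])
  show "0 < critical_exponent Rs" using critical_exponent_gt[OF Rs] \<alpha>_pos by linarith
  show "1 \<le> Rs * \<rho> powr (2 * critical_exponent Rs - \<alpha>)"
    unfolding rho_powr_critical_exponent[OF Rs] using Rs by simp
  fix u assume "u \<in> class_functions S"
  from bspec[OF ext this]
  obtain v where v: "\<forall>x\<in>V 0. v x = u x" "bdd_above (range (\<lambda>n. Rs ^ n * E n v))" by blast
  from v(2) obtain C where "\<And>n. Rs ^ n * E n v \<le> C" unfolding bdd_above_def by auto
  then have "E (1 * k) v \<le> C / Rs ^ (1 * k)" for k using Rs by (simp add: field_simps)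
  with v(1) show "\<exists>v. (\<forall>x\<in>V 0. v x = u x) \<and> (\<exists>C. \<forall>k. E (1 * k) v \<le> C / Rs ^ (1 * k))" by blast
qed

end

theorem proposition4p4:
  fixes N :: nat and \<rho> :: real and b :: "nat \<Rightarrow> real ^ 'd"
    and F :: "nat \<Rightarrow> real ^ 'd \<Rightarrow> real ^ 'd" and K :: "(real ^ 'd) set"
    and \<mu> :: "(real ^ 'd) measure"
    and Rn :: "nat \<Rightarrow> real ^ 'd \<Rightarrow> real ^ 'd \<Rightarrow> real" and R :: "real ^ 'd \<Rightarrow> real ^ 'd \<Rightarrow> real"
    and S :: "((real ^ 'd) \<times> (real ^ 'd)) set"
    and Rq :: "nat \<Rightarrow> (real ^ 'd) set \<Rightarrow> (real ^ 'd) set \<Rightarrow> ennreal"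
    and Rs \<alpha> :: real
  assumes "0 < \<rho>" "\<rho> < 1"
    and "\<And>i x. i \<in> {1..N} \<Longrightarrow> F i x = \<rho> *\<^sub>R (x - b i) + b i"
    and "self_similar_set N F K" "connected K" "pcf N F K" "2 \<le> card (vertices N F K 0)"
    and "self_similar_measure N F K \<mu>"
    and "\<alpha> = similarity_dim N \<rho>"
    and "\<And>n. is_trace N F K n (Rn n)"
    and "\<And>p q. p \<in> vertices N F K 0 \<Longrightarrow> q \<in> vertices N F K 0 \<Longrightarrow> p \<noteq> q \<Longrightarrow>
           has_growth_rate (\<lambda>n. Rn n p q) (R p q)"
    and "Rs = R_sharp (vertices N F K 0) R"
    and "compatible N F K S"
    and "\<And>n. is_quotient_trace N F K S n (Rq n)"
    and "\<forall>\<^sub>F \<epsilon> in at_right 0. \<forall>I\<in>vertices N F K 0 // S. \<forall>J\<in>vertices N F K 0 // S. I \<noteq> J \<longrightarrow>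
           (\<lambda>n. ennreal (Rs powr ((1 - \<epsilon>) * real n)) / Rq n I J) \<longlonglongrightarrow> 0"
    and "Max ((\<lambda>J. hausdorff_dim (closure J)) ` boundary_classes N F K S) < hausdorff_dim K"
  shows "(\<forall>\<sigma>>0. ereal \<sigma> < sigma_sharp \<alpha> \<mu> \<longrightarrow> dense_in_L2 \<mu> (besov \<alpha> \<mu> \<sigma>)) \<and>
         ((\<forall>u\<in>class_functions S. \<exists>v\<in>class_functions (all_vertices_rel N F K S).
             (\<forall>x\<in>vertices N F K 0. v x = u x) \<and>
             bdd_above (range (\<lambda>n. Rs ^ n * energy N F K n v)))
          \<longrightarrow> dense_in_L2 \<mu> (besov \<alpha> \<mu> (real_of_ereal (sigma_sharp \<alpha> \<mu>))))"
proof -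
  interpret pcf_ifs_measure_rel N \<rho> b F K \<mu> S
    using assms(1-8,13) by unfold_locales auto
  obtain p q where pq: "p \<in> vertices N F K 0" "q \<in> vertices N F K 0" "p \<noteq> q" "Rs = R p q"
    using R_sharp_attained(2)[OF finite_V0 two_vertices, of R] assms(12) by blast
  then have Rs: "1 < Rs" using assms(11)[OF pq(1-3)] by (simp add: has_growth_rate_def)
  have le: "sigma_sharp \<alpha> \<mu> \<le> ereal (critical_exponent Rs)"
    unfolding assms(9) by (rule sigma_sharp_le[OF assms(10,11,12) Rs])
  have null: "emeasure \<mu> (closure boundary_points) = 0"
    by (rule emeasure_closure_boundary_points[OF assms(16)])
  show ?thesis
  proof (intro conjI allI impI)
    fix \<sigma> :: real assume "ereal \<sigma> < sigma_sharp \<alpha> \<mu>"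
    then have "ereal \<sigma> < ereal (critical_exponent Rs)" using le by (rule less_le_trans)
    then show "dense_in_L2 \<mu> (besov \<alpha> \<mu> \<sigma>)"
      unfolding assms(9) by (intro besov_dense_below_critical[OF Rs assms(14,15) null]) simp
  next
    assume ext: "\<forall>u\<in>class_functions S. \<exists>v\<in>class_functions (all_vertices_rel N F K S).
             (\<forall>x\<in>vertices N F K 0. v x = u x) \<and>
             bdd_above (range (\<lambda>n. Rs ^ n * energy N F K n v))"
    have "0 < critical_exponent Rs" using critical_exponent_gt[OF Rs] \<alpha>_pos by linarith
    then have "real_of_ereal (sigma_sharp \<alpha> \<mu>) \<le> critical_exponent Rs"
      \<comment> \<open>If the supremum is over the empty set, its real value is 0 by convention.\<close>
      using le by (cases "sigma_sharp \<alpha> \<mu>") auto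
    then show "dense_in_L2 \<mu> (besov \<alpha> \<mu> (real_of_ereal (sigma_sharp \<alpha> \<mu>)))"
      unfolding assms(9) by (intro dense_in_L2_mono[OF besov_dense_at_critical[OF Rs ext null]]) simp
  qed
qed

end
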